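(* Let $f:\mathbb{R}^d\to\mathbb{R}$ be a $C^2$, $\ell$-gradient Lipschitz function. Assume that $f$ is analytic, has compact sub-level sets, and that all of its saddle points are strict. Let $g_0$ be an $(L,B,c)$-well-behaved function for $f$ with parameters $\eta,\beta>0$ satisfying $\eta<\min\{\frac1L,\frac1{2\ell}\}$ and $\beta<\frac{1-2\eta\ell}{B}$. If the initialization point $\mathbf{x}_0$ is picked at random (from a distribution absolutely continuous with respect to Lebesgue measure on $\mathbb{R}^d$), then for every $h_0\in\mathbb{R}$, the iterates $\mathbf{x}_k$ of $g_0$ started from $(\mathbf{x}_0,h_0)$ satisfy $$\Pr\left(\lim_{k\to\infty}\mathbf{x}_k=\mathbf{x}^*\right)=1,$$ where $\mathbf{x}^*$ is a local minimizer of $f$ (that is, with probability one the limit exists and is a local minimizer of $f$).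
   Context: $f$ is $\ell$-gradient Lipschitz if $\|\nabla f(\mathbf{x})-\nabla f(\mathbf{y})\|\le \ell\|\mathbf{x}-\mathbf{y}\|$ for all $\mathbf{x},\mathbf{y}\in\mathbb{R}^d$. A saddle point of $f$ is a point with $\nabla f(\mathbf{x})=0$ that is not a local minimum (local maxima are counted as saddle points). A strict saddle point is a point $\mathbf{x}$ with $\nabla f(\mathbf{x})=0$ and $\lambda_{\min}(\nabla^2 f(\mathbf{x}))<0$. Dynamical system: for $\eta,\beta>0$, $q_x:\mathbb{R}^d\times\mathbb{R}\to\mathbb{R}^d$ and $q_h:\mathbb{R}\to\mathbb{R}$, let $g_0(\mathbf{x},h)=(\mathbf{x}-\eta\, q_x(\mathbf{x},h),\ \beta\, q_h(h))$ on $\mathbb{R}^{d+1}$, with iterates $(\mathbf{x}_{k+1},h_{k+1})=g_0(\mathbf{x}_k,h_k)$. For a $C^2$, $\ell$-gradient Lipschitz $f$, a map $g_0$ of this form is $(L,B,c)$-well-behaved (for $f$) if: (i) $q_x,q_h\in C^1$ and $q_h(0)=0$; (ii) for all $h\in\mathbb{R}$, $q_x(\cdot,h)$ is $L$-Lipschitz and $0<\frac{\partial q_h(h)}{\partial h}\le B$; (iii) for all $(\mathbf{x},h)\in\mathbb{R}^{d+1}$, $\|q_x(\mathbf{x},h)-\nabla f(\mathbf{x})\|\le c|h|$. *)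

theory Defs
  imports "HOL-Probability.Probability"
begin

definition C1_fun :: "('a::real_normed_vector \<Rightarrow> 'b::real_normed_vector) \<Rightarrow> bool" where
  "C1_fun f \<longleftrightarrow>
     (\<exists>f' :: 'a \<Rightarrow> 'a \<Rightarrow>\<^sub>L 'b.
        (\<forall>x. (f has_derivative blinfun_apply (f' x)) (at x)) \<and> continuous_on UNIV f')"

definition C2_fun :: "('a::real_normed_vector \<Rightarrow> 'b::real_normed_vector) \<Rightarrow> bool" where
  "C2_fun f \<longleftrightarrow>
     (\<exists>f' :: 'a \<Rightarrow> 'a \<Rightarrow>\<^sub>L 'b.
        (\<forall>x. (f has_derivative blinfun_apply (f' x)) (at x)) \<and> C1_fun f')"

(* Around every point a, f is the sum of a power series in x - a. The series is indexed by
   multi-indices \<alpha>; has_sum on the reals is absolute convergence. *)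
definition real_analytic :: "(real ^ 'd \<Rightarrow> real) \<Rightarrow> bool" where
  "real_analytic f \<longleftrightarrow>
     (\<forall>a. \<exists>(coef :: ('d \<Rightarrow> nat) \<Rightarrow> real) r. r > 0 \<and>
        (\<forall>x \<in> ball a r.
           ((\<lambda>\<alpha>. coef \<alpha> * (\<Prod>i\<in>UNIV. (x $ i - a $ i) ^ \<alpha> i)) has_sum f x) UNIV))"

(* Meaningful only where f is differentiable. *)
definition gradient :: "(real ^ 'd \<Rightarrow> real) \<Rightarrow> real ^ 'd \<Rightarrow> real ^ 'd" where
  "gradient f x = (THE D. GDERIV f x :> D)"

definition hessian :: "(real ^ 'd \<Rightarrow> real) \<Rightarrow> real ^ 'd \<Rightarrow> real ^ 'd ^ 'd" where
  "hessian f x = jacobian (gradient f) (at x)"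

definition eigenvalues :: "real ^ 'd ^ 'd \<Rightarrow> real set" where
  "eigenvalues A = {t. \<exists>v. v \<noteq> 0 \<and> A *v v = t *\<^sub>R v}"

(* The set of real eigenvalues is always finite; it is nonempty if A is symmetric. *)
definition lambda_min :: "real ^ 'd ^ 'd \<Rightarrow> real" where
  "lambda_min A = Min (eigenvalues A)"

definition gradient_Lipschitz :: "real \<Rightarrow> (real ^ 'd \<Rightarrow> real) \<Rightarrow> bool" where
  "gradient_Lipschitz l f \<longleftrightarrow>
     (\<forall>x y. norm (gradient f x - gradient f y) \<le> l * norm (x - y))"

definition local_minimizer :: "('a::topological_space \<Rightarrow> real) \<Rightarrow> 'a \<Rightarrow> bool" where
  "local_minimizer f x \<longleftrightarrow> (\<forall>\<^sub>F y in nhds x. f x \<le> f y)"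

definition saddle_point :: "(real ^ 'd \<Rightarrow> real) \<Rightarrow> real ^ 'd \<Rightarrow> bool" where
  "saddle_point f x \<longleftrightarrow> gradient f x = 0 \<and> \<not> local_minimizer f x"

definition strict_saddle_point :: "(real ^ 'd \<Rightarrow> real) \<Rightarrow> real ^ 'd \<Rightarrow> bool" where
  "strict_saddle_point f x \<longleftrightarrow> gradient f x = 0 \<and> lambda_min (hessian f x) < 0"

definition dynamics ::
    "real \<Rightarrow> real \<Rightarrow> ((real ^ 'd) \<times> real \<Rightarrow> real ^ 'd) \<Rightarrow> (real \<Rightarrow> real) \<Rightarrow>
     (real ^ 'd) \<times> real \<Rightarrow> (real ^ 'd) \<times> real" where
  "dynamics \<eta> \<beta> q\<^sub>x q\<^sub>h = (\<lambda>(x, h). (x - \<eta> *\<^sub>R q\<^sub>x (x, h), \<beta> * q\<^sub>h h))"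

(* For positive \<eta> and \<beta>, the map g determines q\<^sub>x and q\<^sub>h. *)
definition well_behaved ::
    "(real ^ 'd \<Rightarrow> real) \<Rightarrow> real \<Rightarrow> real \<Rightarrow> real \<Rightarrow> real \<Rightarrow> real \<Rightarrow>
     ((real ^ 'd) \<times> real \<Rightarrow> (real ^ 'd) \<times> real) \<Rightarrow> bool" where
  "well_behaved f \<eta> \<beta> L B c g \<longleftrightarrow>
     (\<exists>q\<^sub>x q\<^sub>h. g = dynamics \<eta> \<beta> q\<^sub>x q\<^sub>h \<and>
        C1_fun q\<^sub>x \<and> C1_fun q\<^sub>h \<and> q\<^sub>h 0 = 0 \<and>
        (\<forall>h. L-lipschitz_on UNIV (\<lambda>x. q\<^sub>x (x, h)) \<and> 0 < deriv q\<^sub>h h \<and> deriv q\<^sub>h h \<le> B) \<and>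
        (\<forall>x h. norm (q\<^sub>x (x, h) - gradient f x) \<le> c * \<bar>h\<bar>))"

end

theory Submission
  imports Defs "HOL-Complex_Analysis.Conformal_Mappings"
begin

text \<open>
  Convergence: \<open>f\<close> extends to a holomorphic function near every point. Repeated blow-ups and
  Tschirnhausen transformations turn it locally into a monomial times a unit; such functions satisfy
  the Lojasiewicz gradient inequality, which descends along the blow-ups. As \<open>f x + K * h\<^sup>2\<close> decreases
  along the iteration by a multiple of the squared step length, the inequality bounds the length of
  the trajectory, and the iterates converge to a critical point.

  Avoidance of saddles: near a strict saddle, a quadratic form that is positive in a direction \<open>v\<close> of
  negative curvature grows exponentially on differences of two trajectories. Thus every line in
  direction \<open>v\<close> contains at most one point whose trajectory stays near the saddle, so that this
  compact set has infinitely many disjoint translates in a bounded region and is null. As the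
  maps \<open>x \<mapsto> x - \<eta> *\<^sub>R q\<^sub>x (x, h)\<close> have Lipschitz inverses, preimages of null sets are null, and
  by the Lindelof property countably many saddle neighbourhoods suffice.
\<close>

section \<open>Holomorphic functions of several variables\<close>

text \<open>The passage to complex variables is forced by the comparison of coefficients in the
  induction on the order: their fractional powers become honest monomials after substitutions
  \<open>z $ i \<mapsto> z $ i ^ N\<close>. Over the complex numbers these cover a neighbourhood of
  the origin, over the reals not for even \<open>N\<close>. A weak form of resolution is enough. The
  gradient of \<open>F \<circ> \<phi>\<close> is at most the gradient of \<open>F\<close> times a
  local bound for the derivative of \<open>\<phi>\<close>, so an inequality in the source of
  \<open>\<phi>\<close> yields one on its image. Charts only have to cover; they may ramify or
  contract. At the saddles the obstacle is that the claim concerns every fixed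
  \<open>h\<^sub>0\<close>: a null set of starting points \<open>(x, h)\<close>, as a centre-stable
  manifold of \<open>g\<^sub>0\<close> would provide, may contain the whole slice over
  \<open>h\<^sub>0\<close>. As \<open>h\<close> evolves independently of \<open>x\<close>, its
  iterates are treated as a given sequence tending to 0; \<open>x\<close> follows a non-autonomous
  iteration, and the null sets are found among the \<open>x\<close> alone. The neighbourhood of a
  saddle must then be chosen uniformly over all small sequences \<open>h\<close>.\<close>

definition cdot :: "complex ^ 'd \<Rightarrow> complex ^ 'd \<Rightarrow> complex" where
  "cdot D h = (\<Sum>i\<in>UNIV. D $ i * h $ i)"

lemma cdot_axis [simp]: "cdot D (axis i c) = D $ i * c"
  unfolding cdot_def axis_def
  by (simp add: if_distrib[of "\<lambda>c. _ * c"] cong: if_cong)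

lemma bounded_bilinear_cdot: "bounded_bilinear (cdot :: complex ^ 'd \<Rightarrow> _)"
proof
  show "\<exists>K. \<forall>a b :: complex ^ 'd. norm (cdot a b) \<le> norm a * norm b * K"
  proof (intro exI allI)
    fix a b :: "complex ^ 'd"
    have "norm (cdot a b) \<le> (\<Sum>i\<in>(UNIV :: 'd set). norm a * norm b)"
      unfolding cdot_def
      by (rule order.trans[OF norm_sum sum_mono])
        (auto simp: norm_mult intro!: mult_mono Finite_Cartesian_Product.norm_nth_le)
    then show "norm (cdot a b) \<le> norm a * norm b * real CARD('d)"
      by (simp add: mult.commute)
  qed
qed (auto simp: cdot_def algebra_simps sum.distrib sum_distrib_left scaleR_sum_right)

interpretation cdot: bounded_bilinear cdot
  by (rule bounded_bilinear_cdot)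

text \<open>\<open>has_derivative\<close> is real differentiability; a derivative of the form
  \<open>cdot D\<close>, with \<open>cdot\<close> bilinear and free of conjugation, is complex
  linear. All variables are treated jointly, so the real chain rule and the real inverse function
  theorem apply directly.\<close>

definition cdiff :: "(complex ^ 'd \<Rightarrow> complex) \<Rightarrow> complex ^ 'd \<Rightarrow> bool" where
  "cdiff F z \<longleftrightarrow> (\<exists>D. (F has_derivative cdot D) (at z))"

definition cgrad :: "(complex ^ 'd \<Rightarrow> complex) \<Rightarrow> complex ^ 'd \<Rightarrow> complex ^ 'd" where
  "cgrad F z = (\<chi> i. deriv (\<lambda>s. F (z + axis i s)) 0)"

definition holo :: "(complex ^ 'd \<Rightarrow> complex) \<Rightarrow> complex ^ 'd \<Rightarrow> bool" where
  "holo F p \<longleftrightarrow> (\<forall>\<^sub>F z in nhds p. cdiff F z)"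

definition vholo :: "(complex ^ 'd \<Rightarrow> complex ^ 'd) \<Rightarrow> complex ^ 'd \<Rightarrow> bool" where
  "vholo \<phi> p \<longleftrightarrow> (\<forall>i. holo (\<lambda>z. \<phi> z $ i) p)"

lemma has_derivative_vecI:
  fixes f :: "'a::real_normed_vector \<Rightarrow> 'b::real_normed_vector ^ 'n"
  assumes "\<And>i. ((\<lambda>x. f x $ i) has_derivative (\<lambda>h. f' h $ i)) (at a)"
  shows "(f has_derivative f') (at a)"
proof -
  have bl: "bounded_linear (\<lambda>h. f' h $ i)" for i
    using assms has_derivative_bounded_linear by blast
  have "bounded_linear f'"
  proof -
    have lin: "linear f'"
      by (rule linearI)
        (use linear_add[OF bounded_linear.linear[OF bl]]
          linear_scale[OF bounded_linear.linear[OF bl]] in \<open>auto simp: vec_eq_iff\<close>)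
    have "\<forall>i. \<exists>K. \<forall>h. norm (f' h $ i) \<le> norm h * K"
      using bl bounded_linear.bounded by blast
    then obtain K where K: "\<And>i h. norm (f' h $ i) \<le> norm h * K i"
      by metis
    have "norm (f' h) \<le> norm h * (\<Sum>i\<in>UNIV. K i)" for h
    proof -
      have "norm (f' h) \<le> (\<Sum>i\<in>UNIV. norm (f' h $ i))"
        unfolding norm_vec_def by (rule L2_set_le_sum) simp
      also have "\<dots> \<le> (\<Sum>i\<in>UNIV. norm h * K i)"
        by (rule sum_mono) (rule K)
      finally show ?thesis by (simp add: sum_distrib_left)
    qed
    with lin show ?thesis
      by (intro bounded_linear_intro) (auto simp: linear_add linear_scale)
  qed
  moreover have "(\<lambda>x. (f x - f a - f' (x - a)) /\<^sub>R norm (x - a)) \<midarrow>a\<rightarrow> 0"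
    by (rule vec_tendstoI)
      (use assms in \<open>auto simp: has_derivative_at_within bl\<close>)
  ultimately show ?thesis
    by (auto simp: has_derivative_at_within)
qed

lemma bounded_linear_axis: "bounded_linear (axis i :: complex \<Rightarrow> complex ^ 'd)"
proof (rule has_derivative_bounded_linear[where F="at 0" and f="axis i"])
  show "(axis i has_derivative axis i) (at (0::complex))"
  proof (rule has_derivative_vecI)
    show "((\<lambda>x. axis i x $ j) has_derivative (\<lambda>h. axis i h $ j)) (at (0::complex))" for j
      by (cases "j = i") (auto simp: axis_def)
  qed
qed

lemma norm_axis [simp]: "norm (axis i (s::complex)) = norm s"
proof -
  have "(\<Sum>j\<in>UNIV. (norm ((axis i s) $ j))\<^sup>2) = (\<Sum>j\<in>UNIV. if j = i then (norm s)\<^sup>2 else 0)"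
    by (rule sum.cong) (auto simp: axis_def)
  also have "\<dots> = (norm s)\<^sup>2" by simp
  finally show ?thesis by (simp add: norm_vec_def L2_set_def)
qed

lemma has_derivative_cdot_axis:
  assumes "(F has_derivative cdot D) (at (a + axis i s))"
  shows "((\<lambda>s. F (a + axis i s)) has_field_derivative D $ i) (at s)"
proof -
  have 1: "((\<lambda>s. a + axis i s) has_derivative axis i) (at s)"
    by (auto intro!: derivative_eq_intros bounded_linear.has_derivative[OF bounded_linear_axis])
  have "((\<lambda>s. F (a + axis i s)) has_derivative (\<lambda>h. cdot D (axis i h))) (at s)"
    by (rule has_derivative_compose[OF 1, of F "cdot D"]) (use assms in simp)
  then show ?thesis
    by (simp add: has_field_derivative_def)
qed

lemma has_derivative_cgrad:
  assumes "(F has_derivative cdot D) (at z)"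
  shows "cgrad F z = D"
proof -
  have "deriv (\<lambda>s. F (z + axis i s)) 0 = D $ i" for i
    by (rule DERIV_imp_deriv) (use has_derivative_cdot_axis[of F D z i 0] assms in \<open>simp add: axis_eq_0_iff[THEN iffD2]\<close>)
  then show ?thesis by (simp add: cgrad_def vec_eq_iff)
qed

lemma cdiff_iff: "cdiff F z \<longleftrightarrow> (F has_derivative cdot (cgrad F z)) (at z)"
  unfolding cdiff_def using has_derivative_cgrad by metis

lemma cdiffD: "cdiff F z \<Longrightarrow> (F has_derivative cdot (cgrad F z)) (at z)"
  by (simp add: cdiff_iff)

lemma cdiffI: "(F has_derivative F') (at z) \<Longrightarrow> (\<And>h. F' h = cdot D h) \<Longrightarrow> cdiff F z"
  unfolding cdiff_def by (metis ext)

lemma cdiff_const [intro]: "cdiff (\<lambda>_. c) z"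
  by (rule cdiffI[where D=0]) (auto intro: derivative_eq_intros simp: cdot_def)

lemma cdiff_nth [intro]: "cdiff (\<lambda>z. z $ i) z"
  by (rule cdiffI[where D="axis i 1"])
    (auto intro!: derivative_eq_intros bounded_linear.has_derivative[OF bounded_linear_vec_nth]
      simp: cdot_def axis_def if_distrib[of "\<lambda>c. c * _"] cong: if_cong)

lemma cdiff_add [intro]: "cdiff F z \<Longrightarrow> cdiff G z \<Longrightarrow> cdiff (\<lambda>z. F z + G z) z"
  by (rule cdiffI[where D="cgrad F z + cgrad G z"])
    (auto dest!: cdiffD intro!: derivative_eq_intros simp: cdot.add_left)

lemma cdiff_uminus [intro]: "cdiff F z \<Longrightarrow> cdiff (\<lambda>z. - F z) z"
  by (rule cdiffI[where D="- cgrad F z"])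
    (auto dest!: cdiffD intro!: derivative_eq_intros simp: cdot.minus_left)

lemma cdiff_diff [intro]: "cdiff F z \<Longrightarrow> cdiff G z \<Longrightarrow> cdiff (\<lambda>z. F z - G z) z"
  using cdiff_add[of F z "\<lambda>z. - G z"] by auto

lemma cdiff_mult [intro]: "cdiff F z \<Longrightarrow> cdiff G z \<Longrightarrow> cdiff (\<lambda>z. F z * G z) z"
  by (rule cdiffI[where D="\<chi> i. F z * cgrad G z $ i + cgrad F z $ i * G z"])
    (auto dest!: cdiffD intro!: derivative_eq_intros
      simp: cdot_def sum.distrib sum_distrib_left sum_distrib_right algebra_simps)

lemma cdiff_compose_has:
  assumes "\<And>i. cdiff (\<lambda>z. \<phi> z $ i) z"
  shows "(\<phi> has_derivative (\<lambda>h. \<chi> i. cdot (cgrad (\<lambda>z. \<phi> z $ i) z) h)) (at z)"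
  by (rule has_derivative_vecI) (use cdiffD[OF assms] in simp)

lemma cdiff_compose_grad:
  assumes "\<And>i. cdiff (\<lambda>z. \<phi> z $ i) z" and "cdiff F (\<phi> z)"
  shows "((\<lambda>z. F (\<phi> z)) has_derivative
      cdot (\<chi> k. \<Sum>i\<in>UNIV. cgrad F (\<phi> z) $ i * cgrad (\<lambda>z. \<phi> z $ i) z $ k)) (at z)"
proof -
  have "((\<lambda>z. F (\<phi> z)) has_derivative
      (\<lambda>h. cdot (cgrad F (\<phi> z)) (\<chi> i. cdot (cgrad (\<lambda>z. \<phi> z $ i) z) h))) (at z)"
    by (rule has_derivative_compose[OF cdiff_compose_has[OF assms(1)]])
      (use cdiffD[OF assms(2)] in simp)
  moreover have "(\<lambda>h. cdot (cgrad F (\<phi> z)) (\<chi> i. cdot (cgrad (\<lambda>z. \<phi> z $ i) z) h)) =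
    cdot (\<chi> k. \<Sum>i\<in>UNIV. cgrad F (\<phi> z) $ i * cgrad (\<lambda>z. \<phi> z $ i) z $ k)"
    unfolding cdot_def fun_eq_iff
    apply (simp add: sum_distrib_left sum_distrib_right)
    apply (subst sum.swap)
    apply (simp add: mult.assoc)
    done
  ultimately show ?thesis by simp
qed

lemma cdiff_compose:
  assumes "\<And>i. cdiff (\<lambda>z. \<phi> z $ i) z" and "cdiff F (\<phi> z)"
  shows "cdiff (\<lambda>z. F (\<phi> z)) z"
  using cdiff_compose_grad[OF assms] unfolding cdiff_def by blast

lemma cdiff_cong_ev:
  assumes "\<forall>\<^sub>F w in nhds z. F w = G w" "cdiff F z"
  shows "cdiff G z"
  using assms unfolding cdiff_def
  by (metis (mono_tags, lifting) eventually_nhds_x_imp_x has_derivative_transform_eventually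
      eventually_nhds_conv_at UNIV_I)

lemma cdiff_isCont: "cdiff F z \<Longrightarrow> isCont F z"
  by (auto simp: cdiff_def dest: has_derivative_continuous)

lemma holo_lift:
  "(\<And>z. cdiff F z \<Longrightarrow> cdiff G z) \<Longrightarrow> holo F p \<Longrightarrow> holo G p"
  unfolding holo_def by (rule eventually_mono)

lemma holo_lift2:
  assumes "\<And>z. cdiff F z \<Longrightarrow> cdiff G z \<Longrightarrow> cdiff H z" "holo F p" "holo G p"
  shows "holo H p"
  using assms(2,3) unfolding holo_def by eventually_elim (rule assms(1))

lemma holo_const [intro, simp]: "holo (\<lambda>_. c) p"
  by (simp add: holo_def cdiff_const)

lemma holo_nth [intro, simp]: "holo (\<lambda>z. z $ i) p"
  by (simp add: holo_def cdiff_nth)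

lemma holo_add [intro]: "holo F p \<Longrightarrow> holo G p \<Longrightarrow> holo (\<lambda>z. F z + G z) p"
  by (rule holo_lift2[of F G]) auto

lemma holo_diff [intro]: "holo F p \<Longrightarrow> holo G p \<Longrightarrow> holo (\<lambda>z. F z - G z) p"
  by (rule holo_lift2[of F G]) auto

lemma holo_uminus [intro]: "holo F p \<Longrightarrow> holo (\<lambda>z. - F z) p"
  by (rule holo_lift[of F]) auto

lemma holo_mult [intro]: "holo F p \<Longrightarrow> holo G p \<Longrightarrow> holo (\<lambda>z. F z * G z) p"
  by (rule holo_lift2[of F G]) auto

lemma holo_power [intro]: "holo F p \<Longrightarrow> holo (\<lambda>z. F z ^ n) p"
  by (induction n) auto

lemma holo_sum [intro]: "(\<And>i. i \<in> I \<Longrightarrow> holo (F i) p) \<Longrightarrow> holo (\<lambda>z. \<Sum>i\<in>I. F i z) p"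
  by (induction I rule: infinite_finite_induct) auto

lemma holo_prod [intro]: "(\<And>i. i \<in> I \<Longrightarrow> holo (F i) p) \<Longrightarrow> holo (\<lambda>z. \<Prod>i\<in>I. F i z) p"
  by (induction I rule: infinite_finite_induct) auto

lemma holo_isCont: "holo F p \<Longrightarrow> isCont F p"
  using cdiff_isCont eventually_nhds_x_imp_x unfolding holo_def by blast

lemma holo_tendsto: "holo F p \<Longrightarrow> (F \<longlongrightarrow> F p) (nhds p)"
  using holo_isCont isContD tendsto_at_iff_tendsto_nhds by metis

lemma vholo_tendsto: "vholo \<phi> p \<Longrightarrow> (\<phi> \<longlongrightarrow> \<phi> p) (nhds p)"
  by (rule vec_tendstoI) (auto simp: vholo_def intro: holo_tendsto)

lemma holo_compose:
  assumes "vholo \<phi> p" "holo F (\<phi> p)"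
  shows "holo (\<lambda>z. F (\<phi> z)) p"
proof -
  have "\<forall>\<^sub>F z in nhds p. \<forall>i. cdiff (\<lambda>z. \<phi> z $ i) z"
    using assms(1) by (auto simp: vholo_def holo_def eventually_all_finite)
  moreover have "\<forall>\<^sub>F z in nhds p. cdiff F (\<phi> z)"
    using vholo_tendsto[OF assms(1)] assms(2) unfolding holo_def
    by (simp add: filterlim_iff)
  ultimately show ?thesis
    unfolding holo_def by eventually_elim (auto intro: cdiff_compose)
qed

lemma holo_cong_ev:
  assumes "\<forall>\<^sub>F w in nhds p. F w = G w" "holo F p"
  shows "holo G p"
proof -
  have "\<forall>\<^sub>F z in nhds p. \<forall>\<^sub>F w in nhds z. F w = G w"
    using assms(1) by (simp add: eventually_eventually)
  with assms(2) show ?thesis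
    unfolding holo_def by eventually_elim (auto intro: cdiff_cong_ev)
qed

section \<open>Differentiation under the integral and Cauchy's formula\<close>

lemma cdiff_param_integral:
  fixes k :: "complex ^ 'd \<Rightarrow> real \<Rightarrow> complex"
  assumes U: "open U" "convex U"
    and der: "\<And>z t. z \<in> U \<Longrightarrow> t \<in> cbox 0 1 \<Longrightarrow> ((\<lambda>z. k z t) has_derivative cdot (D z t)) (at z)"
    and cont: "continuous_on (U \<times> cbox 0 1) (\<lambda>(z, t). D z t)"
    and int: "\<And>z. z \<in> U \<Longrightarrow> k z integrable_on cbox 0 1"
    and z: "z \<in> U"
  shows "cdiff (\<lambda>z. integral (cbox 0 1) (k z)) z"
proof -
  \<comment> \<open>\<open>leibniz_rule\<close> expects derivatives in the space of bounded linear
    maps; \<open>L\<close> embeds the gradients there. Linearity of \<open>cdot\<close> in its first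
    argument then identifies the integrated derivative as \<open>cdot\<close> of the integrated
    gradient.\<close>
  define L where "L D = Blinfun (cdot D)" for D :: "complex ^ 'd"
  have L: "blinfun_apply (L D) h = cdot D h" for D h
    unfolding L_def by (simp add: bounded_linear_Blinfun_apply cdot.bounded_linear_right)
  have L': "blinfun_apply (L D) = cdot D" for D
    by (rule ext) (rule L)
  have contL: "continuous_on (U \<times> cbox 0 1) (\<lambda>(z, t). L (D z t))"
    using cont
    by (intro continuous_on_blinfun_componentwise)
      (auto simp: L split_beta intro!: continuous_on_compose2[OF linear_continuous_on[OF cdot.bounded_linear_left]])
  have "((\<lambda>z. integral (cbox 0 1) (k z)) has_derivative blinfun_apply (integral (cbox 0 1) (\<lambda>t. L (D z t))))
    (at z within U)"
  proof (rule leibniz_rule[OF _ int contL z \<open>convex U\<close>])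
    fix x t assume "x \<in> U" "t \<in> cbox 0 (1::real)"
    then show "((\<lambda>x. k x t) has_derivative blinfun_apply (L (D x t))) (at x within U)"
      unfolding L' by (rule has_derivative_at_withinI[OF der])
  qed
  then have der': "((\<lambda>z. integral (cbox 0 1) (k z)) has_derivative
      blinfun_apply (integral (cbox 0 1) (\<lambda>t. L (D z t)))) (at z)"
    by (simp only: at_within_open[OF z U(1)])
  have contz: "continuous_on (cbox 0 1) (\<lambda>t. D z t)"
    by (rule continuous_on_compose2[OF cont, of _ "\<lambda>t. (z, t)", simplified])
      (auto intro!: continuous_intros z)
  have contLz: "continuous_on (cbox 0 1) (\<lambda>t. L (D z t))"
    by (rule continuous_on_compose2[OF contL, of _ "\<lambda>t. (z, t)", simplified])
      (auto intro!: continuous_intros z)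
  have "blinfun_apply (integral (cbox 0 1) (\<lambda>t. L (D z t))) h = cdot (integral (cbox 0 1) (D z)) h" for h
  proof -
    have "blinfun_apply (integral (cbox 0 1) (\<lambda>t. L (D z t))) h
        = integral (cbox 0 1) (\<lambda>t. blinfun_apply (L (D z t)) h)"
      using integral_linear[OF integrable_continuous[OF contLz] blinfun.bounded_linear_left, of h]
      by (simp add: o_def)
    also have "\<dots> = cdot (integral (cbox 0 1) (D z)) h"
      using integral_linear[OF integrable_continuous[OF contz] cdot.bounded_linear_left, of h]
      by (simp add: o_def L)
    finally show ?thesis .
  qed
  with der' show ?thesis by (intro cdiffI)
qed

abbreviation circ :: "real \<Rightarrow> real \<Rightarrow> complex" where
  "circ r t \<equiv> of_real r * exp (2 * of_real pi * \<i> * of_real t)"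

lemma axis_zero: "axis i (0 :: 'a::zero) = 0"
  by (simp add: axis_def vec_eq_iff)

text \<open>Cauchy's formula for the derivative at the centre, on the \<open>i\<close>-th coordinate
  line through \<open>z\<close>. With the circle parametrised over the unit interval,
  \<open>z\<close> enters only through a translation in the integrand, which suits differentiation
  under the integral.\<close>

lemma cgrad_Cauchy:
  assumes "r > 0" and F: "\<And>s. norm s \<le> r \<Longrightarrow> cdiff F (z + axis i s)"
  shows "cgrad F z $ i = integral (cbox 0 1) (\<lambda>t. F (z + axis i (circ r t)) / circ r t)"
proof -
  define f where "f = (\<lambda>s. F (z + axis i s))"
  have der: "(f has_field_derivative cgrad F (z + axis i s) $ i) (at s)" if "norm s \<le> r" for s
    unfolding f_def using has_derivative_cdot_axis cdiffD[OF F[OF that]] by blast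
  have "continuous_on (cball 0 r) f"
    by (intro continuous_at_imp_continuous_on ballI DERIV_isCont[OF der]) auto
  moreover have "f holomorphic_on ball 0 r"
  proof (rule holomorphic_onI)
    fix x :: complex assume "x \<in> ball 0 r"
    then have "(f has_field_derivative cgrad F (z + axis i x) $ i) (at x)"
      by (intro der) auto
    then show "f field_differentiable at x within ball 0 r"
      unfolding field_differentiable_def by (intro exI) (rule has_field_derivative_at_within)
  qed
  ultimately have "(f has_field_derivative (1 / (2 * of_real pi * \<i>) *
      contour_integral (circlepath 0 r) (\<lambda>u. f u / (u - 0)^2))) (at 0)"
    using \<open>r > 0\<close> by (intro Cauchy_derivative_integral_circlepath) auto
  then have eq: "cgrad F z $ i = 1 / (2 * of_real pi * \<i>) *
      contour_integral (circlepath 0 r) (\<lambda>u. f u / u^2)"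
    using DERIV_unique[OF der[of 0]] \<open>r > 0\<close> by (simp add: axis_zero)
  have "contour_integral (circlepath 0 r) (\<lambda>u. f u / u^2) =
     integral {0..1} (\<lambda>t. 2 * of_real pi * \<i> * (F (z + axis i (circ r t)) / circ r t))"
    unfolding contour_integral_integral
  proof (rule integral_cong)
    fix t :: real assume t: "t \<in> {0..1}"
    have "vector_derivative (circlepath 0 r) (at t) = 2 * of_real pi * \<i> * circ r t"
      using vector_derivative_circlepath[of 0 r t] by simp
    moreover have "circlepath 0 r t = circ r t"
      by (simp add: circlepath)
    moreover have "circ r t \<noteq> 0" using \<open>r > 0\<close> by simp
    moreover have "w / c\<^sup>2 * (k * c) = k * (w / c)" if "c \<noteq> 0" for w c k :: complex
      using that by (simp add: power2_eq_square)
    ultimately show "f (circlepath 0 r t) / (circlepath 0 r t)\<^sup>2 * vector_derivative (circlepath 0 r) (at t)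
       = 2 * of_real pi * \<i> * (F (z + axis i (circ r t)) / circ r t)"
      unfolding f_def by metis
  qed
  also have "\<dots> = 2 * of_real pi * \<i> * integral {0..1} (\<lambda>t. F (z + axis i (circ r t)) / circ r t)"
    by (rule integral_mult_right)
  finally show ?thesis
    unfolding eq box_real by simp
qed

lemma circ_norm [simp]: "r \<ge> 0 \<Longrightarrow> norm (circ r t) = r"
  by (simp add: norm_mult norm_exp_eq_Re)

lemma circ_cont [continuous_intros]: "continuous_on S (\<lambda>x. t x) \<Longrightarrow> continuous_on S (\<lambda>x. circ r (t x))"
  by (intro continuous_intros)

lemma axis_cont [continuous_intros]:
  "continuous_on S s \<Longrightarrow> continuous_on S (\<lambda>x. axis i (s x :: complex))"
  by (rule bounded_linear.continuous_on[OF bounded_linear_axis])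

lemma cdiff_cgrad_aux:
  fixes F :: "complex ^ 'd \<Rightarrow> complex"
  assumes "open U" and F: "\<And>z. z \<in> U \<Longrightarrow> cdiff F z" and z: "z0 \<in> U"
  obtains r where "r > 0" "ball z0 r \<subseteq> U"
    "\<And>z s. z \<in> ball z0 r \<Longrightarrow> norm s \<le> r \<Longrightarrow> z + axis i s \<in> U"
    "\<And>z. z \<in> ball z0 r \<Longrightarrow> cgrad F z $ i = integral (cbox 0 1) (\<lambda>t. F (z + axis i (circ r t)) / circ r t)"
proof -
  obtain e where e: "e > 0" "ball z0 e \<subseteq> U"
    using assms openE by blast
  \<comment> \<open>Half the radius: circles of radius \<open>r\<close> around points of
    \<open>ball z0 r\<close> stay in \<open>ball z0 e\<close>.\<close>
  define r where "r = e / 2"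
  have r: "r > 0" using e by (simp add: r_def)
  have in_U: "z + axis i s \<in> U" if "z \<in> ball z0 r" "norm s \<le> r" for z s
  proof -
    have "dist z0 (z + axis i s) \<le> dist z0 z + dist z (z + axis i s)" by (rule dist_triangle)
    also have "\<dots> < e" using that by (simp add: r_def dist_norm)
    finally show ?thesis using e by auto
  qed
  show ?thesis
  proof (rule that[OF r])
    show "ball z0 r \<subseteq> U" using e by (auto simp: r_def)
    show "z + axis i s \<in> U" if "z \<in> ball z0 r" "norm s \<le> r" for z s
      using in_U that .
    show "cgrad F z $ i = integral (cbox 0 1) (\<lambda>t. F (z + axis i (circ r t)) / circ r t)"
      if "z \<in> ball z0 r" for z
      by (rule cgrad_Cauchy[OF r]) (rule F[OF in_U[OF that]])
  qed
qed

lemma continuous_on_cdiff: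
  assumes "\<And>z. z \<in> U \<Longrightarrow> cdiff F z" shows "continuous_on U F"
  by (intro continuous_at_imp_continuous_on ballI cdiff_isCont assms)

text \<open>Continuity of the gradient is not part of \<open>cdiff\<close>. The Cauchy integral
  gives it from the continuity of \<open>F\<close> alone; differentiating that same integral will
  require it.\<close>

lemma continuous_on_cgrad_nth:
  fixes F :: "complex ^ 'd \<Rightarrow> complex"
  assumes U: "open U" and F: "\<And>z. z \<in> U \<Longrightarrow> cdiff F z"
  shows "continuous_on U (\<lambda>z. cgrad F z $ i)"
proof (intro continuous_at_imp_continuous_on ballI)
  fix z0 assume z0: "z0 \<in> U"
  obtain r where r: "r > 0" "ball z0 r \<subseteq> U"
    "\<And>z s. z \<in> ball z0 r \<Longrightarrow> norm s \<le> r \<Longrightarrow> z + axis i s \<in> U"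
    "\<And>z. z \<in> ball z0 r \<Longrightarrow> cgrad F z $ i = integral (cbox 0 1) (\<lambda>t. F (z + axis i (circ r t)) / circ r t)"
    using cdiff_cgrad_aux[OF U F z0, where i=i] by blast
  have "continuous_on (ball z0 r) (\<lambda>z. integral (cbox 0 1) (\<lambda>t. F (z + axis i (circ r t)) / circ r t))"
    using r unfolding split_beta
    by (intro integral_continuous_on_param)
      (auto simp: split_beta intro!: continuous_intros continuous_on_compose2[OF continuous_on_cdiff[OF F]])
  then have "continuous_on (ball z0 r) (\<lambda>z. cgrad F z $ i)"
    by (rule continuous_on_eq) (simp only: r(4))
  then show "isCont (\<lambda>z. cgrad F z $ i) z0"
    using r(1) by (simp add: continuous_on_eq_continuous_at)
qed

lemma continuous_on_cgrad:
  fixes F :: "complex ^ 'd \<Rightarrow> complex"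
  assumes U: "open U" and F: "\<And>z. z \<in> U \<Longrightarrow> cdiff F z"
  shows "continuous_on U (cgrad F)"
proof -
  have "continuous_on U (\<lambda>z. \<chi> i. cgrad F z $ i)"
    by (rule continuous_on_vec_lambda) (rule continuous_on_cgrad_nth[OF assms])
  then show ?thesis by simp
qed

text \<open>The \<open>z\<close>-derivative of the Cauchy integrand is the gradient of
  \<open>F\<close> on the circle divided by the circle parameter, continuous by the preceding
  lemmas, so Leibniz' rule applies. Hence germs are closed under partial derivatives.\<close>

lemma cdiff_cgrad_nth:
  fixes F :: "complex ^ 'd \<Rightarrow> complex"
  assumes U: "open U" and F: "\<And>z. z \<in> U \<Longrightarrow> cdiff F z" and z0: "z0 \<in> U"
  shows "cdiff (\<lambda>z. cgrad F z $ i) z0"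
proof -
  obtain r where r: "r > 0" "ball z0 r \<subseteq> U"
    "\<And>z s. z \<in> ball z0 r \<Longrightarrow> norm s \<le> r \<Longrightarrow> z + axis i s \<in> U"
    "\<And>z. z \<in> ball z0 r \<Longrightarrow> cgrad F z $ i = integral (cbox 0 1) (\<lambda>t. F (z + axis i (circ r t)) / circ r t)"
    using cdiff_cgrad_aux[OF U F z0, where i=i] by blast
  have cont: "continuous_on (ball z0 r \<times> cbox 0 1) (\<lambda>x. F (fst x + axis i (circ r (snd x))) / circ r (snd x))"
  proof (intro continuous_on_divide continuous_on_compose2[OF continuous_on_cdiff[OF F]])
    show "continuous_on (ball z0 r \<times> cbox 0 1) (\<lambda>x. fst x + axis i (circ r (snd x)))"
      by (intro continuous_intros)
    show "(\<lambda>x. fst x + axis i (circ r (snd x))) ` (ball z0 r \<times> cbox 0 1) \<subseteq> U"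
      using r(1,3) by auto
  qed (use r(1) in \<open>auto intro!: continuous_intros\<close>)
  have "cdiff (\<lambda>z. integral (cbox 0 1) (\<lambda>t. F (z + axis i (circ r t)) / circ r t)) z0"
  proof (rule cdiff_param_integral[where U="ball z0 r"])
    fix z t assume z: "z \<in> ball z0 r" and t: "t \<in> cbox 0 (1::real)"
    have "cdiff F (z + axis i (circ r t))"
      by (intro F r(3) z) (use r in auto)
    have "((\<lambda>z. z + axis i (circ r t)) has_derivative (\<lambda>h. h)) (at z)"
      by (auto intro!: derivative_eq_intros)
    from has_derivative_compose[OF this cdiffD[OF \<open>cdiff F (z + axis i (circ r t))\<close>]]
    have *: "((\<lambda>z. F (z + axis i (circ r t))) has_derivative cdot (cgrad F (z + axis i (circ r t)))) (at z)" .
    define c where "c = circ r t"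
    note * = *[folded c_def]
    have "((\<lambda>z. F (z + axis i c) * inverse c) has_derivative
      (\<lambda>h. cdot (cgrad F (z + axis i c)) h * inverse c)) (at z)"
      by (rule has_derivative_mult_left[OF *])
    moreover have "cdot (cgrad F (z + axis i c)) h * inverse c = cdot (\<chi> j. cgrad F (z + axis i c) $ j / c) h" for h
      unfolding cdot_def sum_distrib_right by (simp add: divide_inverse mult_ac)
    ultimately show "((\<lambda>z. F (z + axis i (circ r t)) / circ r t) has_derivative
      cdot (\<chi> j. cgrad F (z + axis i (circ r t)) $ j / circ r t)) (at z)"
      unfolding c_def[symmetric] by (simp add: divide_inverse)
  next
    show "continuous_on (ball z0 r \<times> cbox 0 1)
      (\<lambda>(z, t). \<chi> j. cgrad F (z + axis i (circ r t)) $ j / circ r t)"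
      unfolding split_beta
    proof (intro continuous_on_vec_lambda continuous_on_divide
        continuous_on_compose2[OF continuous_on_cgrad_nth[OF U F]])
      show "continuous_on (ball z0 r \<times> cbox 0 1) (\<lambda>x. fst x + axis i (circ r (snd x)))"
        by (intro continuous_intros)
      show "(\<lambda>x. fst x + axis i (circ r (snd x))) ` (ball z0 r \<times> cbox 0 1) \<subseteq> U"
        using r(1,3) by auto
    qed (use r(1) in \<open>auto intro!: continuous_intros\<close>)
  next
    fix z assume "z \<in> ball z0 r"
    then show "(\<lambda>t. F (z + axis i (circ r t)) / circ r t) integrable_on cbox 0 1"
      using continuous_on_compose2[OF cont continuous_on_Pair[OF continuous_on_const continuous_on_id],
          of z "cbox 0 1"]
      by (intro integrable_continuous) (auto simp: image_subset_iff)
  qed (use r(1) in auto)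
  moreover have "\<forall>\<^sub>F z in nhds z0. z \<in> ball z0 r"
    using r(1) by (intro eventually_nhds_in_open) auto
  then have "\<forall>\<^sub>F z in nhds z0. integral (cbox 0 1) (\<lambda>t. F (z + axis i (circ r t)) / circ r t) = cgrad F z $ i"
    by eventually_elim (simp only: r(4))
  ultimately show ?thesis
    using cdiff_cong_ev[of "\<lambda>z. integral (cbox 0 1) (\<lambda>t. F (z + axis i (circ r t)) / circ r t)" _ z0] by simp
qed

lemma holo_open:
  assumes "holo F p"
  obtains r where "r > 0" "\<And>z. z \<in> ball p r \<Longrightarrow> cdiff F z"
  using assms unfolding holo_def eventually_nhds_metric by (auto simp: dist_commute)

lemma holo_cgrad [intro]:
  assumes "holo F p" shows "holo (\<lambda>z. cgrad F z $ i) p"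
proof -
  obtain r where r: "r > 0" "\<And>z. z \<in> ball p r \<Longrightarrow> cdiff F z"
    using holo_open assms by blast
  have "cdiff (\<lambda>z. cgrad F z $ i) z" if "z \<in> ball p r" for z
    by (rule cdiff_cgrad_nth[OF open_ball _ that]) (rule r(2))
  then show ?thesis
    unfolding holo_def eventually_nhds using r(1) by (intro exI[of _ "ball p r"]) simp
qed

section \<open>Division by a coordinate\<close>

definition zap :: "'d \<Rightarrow> complex ^ 'd \<Rightarrow> complex ^ 'd" where
  "zap j z = (\<chi> i. if i = j then 0 else z $ i)"

definition squeeze :: "'d \<Rightarrow> real \<Rightarrow> complex ^ 'd \<Rightarrow> complex ^ 'd" where
  "squeeze j t z = (\<chi> i. (if i = j then of_real t else 1) * z $ i)"

text \<open>Hadamard's quotient: \<open>F z - F (zap j z)\<close> is the integral of the derivative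
  of \<open>F\<close> along the segment \<open>squeeze j t z\<close>, and \<open>z $ j\<close> is
  pulled out of the integrand. In this form the quotient is holomorphic across
  \<open>z $ j = 0\<close>.\<close>

definition hquot :: "'d \<Rightarrow> (complex ^ 'd \<Rightarrow> complex) \<Rightarrow> complex ^ 'd \<Rightarrow> complex" where
  "hquot j F z = integral (cbox 0 1) (\<lambda>t. cgrad F (squeeze j t z) $ j)"

lemma norm_squeeze: "0 \<le> t \<Longrightarrow> t \<le> 1 \<Longrightarrow> norm (squeeze j t z) \<le> norm z"
  by (rule norm_le_componentwise_cart) (auto simp: squeeze_def norm_mult mult_left_le_one_le)

lemma continuous_on_if_const:
  "continuous_on S f \<Longrightarrow> continuous_on S g \<Longrightarrow> continuous_on S (\<lambda>x. if b then f x else g x)"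
  by (cases b) auto

lemma continuous_on_squeeze [continuous_intros]:
  assumes "continuous_on S f" "continuous_on S t"
  shows "continuous_on S (\<lambda>x. squeeze j (t x) (f x))"
  unfolding squeeze_def using assms
  by (intro continuous_on_vec_lambda continuous_on_mult continuous_on_component)
    (auto intro!: continuous_intros continuous_on_if_const)

lemma hquot:
  fixes F :: "complex ^ 'd \<Rightarrow> complex"
  assumes "holo F 0"
  shows "holo (hquot j F) 0" "\<forall>\<^sub>F z in nhds 0. F z = F (zap j z) + z $ j * hquot j F z"
proof -
  obtain r where r: "r > 0" and F: "\<And>z. z \<in> ball 0 r \<Longrightarrow> cdiff F z"
    using holo_open assms by blast
  let ?U = "ball (0 :: complex ^ 'd) r"
  let ?G = "\<lambda>z. cgrad F z $ j"
  have contG: "continuous_on ?U ?G"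
    by (rule continuous_on_cgrad_nth[OF open_ball]) (rule F)
  have G: "cdiff ?G z" if "z \<in> ?U" for z
    by (rule cdiff_cgrad_nth[OF open_ball _ that]) (rule F)
  have sq: "squeeze j t z \<in> ?U" if "z \<in> ?U" "t \<in> cbox 0 1" for t z
    using norm_squeeze[of t j z] that by auto
  have contGt: "continuous_on (cbox 0 1) (\<lambda>t. ?G (squeeze j t z))" if "z \<in> ?U" for z
    by (rule continuous_on_compose2[OF contG]) (use sq[OF that] in \<open>auto intro!: continuous_on_squeeze continuous_on_id continuous_on_const\<close>)
  have der: "((\<lambda>z. ?G (squeeze j t z)) has_derivative
      cdot (\<chi> k. cgrad ?G (squeeze j t z) $ k * (if k = j then of_real t else 1))) (at z)"
    if z: "z \<in> ?U" and t: "t \<in> cbox 0 1" for z t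
  proof -
    have "(squeeze j t has_derivative squeeze j t) (at z)"
      unfolding squeeze_def
      by (rule has_derivative_vecI)
        (simp only: vec_lambda_beta, rule has_derivative_mult_right,
          rule bounded_linear_imp_has_derivative, rule bounded_linear_vec_nth)
    from has_derivative_compose[OF this cdiffD[OF G[OF sq[OF z t]]]]
    show ?thesis
      by (rule has_derivative_eq_rhs) (simp add: cdot_def[abs_def] squeeze_def mult.assoc)
  qed
  have "cdiff (hquot j F) z" if z: "z \<in> ?U" for z
    unfolding hquot_def
  proof (rule cdiff_param_integral[OF _ _ der _ _ z])
    show "continuous_on (?U \<times> cbox 0 1)
      (\<lambda>(z, t). \<chi> k. cgrad ?G (squeeze j t z) $ k * (if k = j then complex_of_real t else 1))"
      unfolding split_beta
      by (intro continuous_on_vec_lambda continuous_on_mult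
            continuous_on_compose2[OF continuous_on_cgrad_nth[OF open_ball[of 0 r] G]])
        (use sq in \<open>auto intro!: continuous_on_squeeze continuous_on_fst continuous_on_snd continuous_on_id
          continuous_on_const continuous_on_of_real continuous_on_if_const\<close>)
  next
    show "(\<lambda>t. ?G (squeeze j t z)) integrable_on cbox 0 1" if "z \<in> ?U" for z
      by (rule integrable_continuous[OF contGt[OF that]])
  qed auto
  then show "holo (hquot j F) 0"
    unfolding holo_def eventually_nhds using r(1) by (intro exI[of _ ?U]) simp
  have "F z = F (zap j z) + z $ j * hquot j F z" if z: "z \<in> ?U" for z
  proof -
    have "((\<lambda>t. F (squeeze j t z)) has_vector_derivative ?G (squeeze j t z) * z $ j) (at t within {0..1})"
      if t: "t \<in> {0..1}" for t
    proof -
      have 1: "((\<lambda>t. squeeze j t z) has_derivative (\<lambda>h. axis j (of_real h * z $ j))) (at t)"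
        unfolding squeeze_def
      proof (rule has_derivative_vecI)
        fix i show "((\<lambda>x. (\<chi> i. (if i = j then complex_of_real x else 1) * z $ i) $ i) has_derivative
           (\<lambda>h. axis j (complex_of_real h * z $ j) $ i)) (at t)"
          by (cases "i = j") (auto simp: axis_def intro!: derivative_eq_intros)
      qed
      have "((\<lambda>t. F (squeeze j t z)) has_derivative (\<lambda>h. cdot (cgrad F (squeeze j t z)) (axis j (of_real h * z $ j)))) (at t)"
        by (rule has_derivative_compose[OF 1 cdiffD[OF F[OF sq[OF z]]]]) (use t in simp)
      moreover have "(\<lambda>h. cdot (cgrad F (squeeze j t z)) (axis j (of_real h * z $ j))) =
          (\<lambda>h. h *\<^sub>R (?G (squeeze j t z) * z $ j))"
        by (simp add: scaleR_conv_of_real mult_ac)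
      ultimately have "((\<lambda>t. F (squeeze j t z)) has_derivative (\<lambda>h. h *\<^sub>R (?G (squeeze j t z) * z $ j))) (at t)"
        by simp
      then show ?thesis
        unfolding has_vector_derivative_def by (rule has_derivative_at_withinI)
    qed
    from fundamental_theorem_of_calculus[OF zero_le_one this]
    have "((\<lambda>t. ?G (squeeze j t z) * z $ j) has_integral F (squeeze j 1 z) - F (squeeze j 0 z)) {0..1}" .
    moreover have "((\<lambda>t. ?G (squeeze j t z) * z $ j) has_integral hquot j F z * z $ j) {0..1}"
      unfolding hquot_def
      using has_integral_mult_left[OF integrable_integral[OF integrable_continuous[OF contGt[OF z]]], of "z $ j"]
      by (simp add: box_real)
    moreover have "squeeze j 1 z = z" "squeeze j 0 z = zap j z"
      by (auto simp: squeeze_def zap_def vec_eq_iff)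
    ultimately have "F z - F (zap j z) = hquot j F z * z $ j"
      using has_integral_unique by metis
    then show ?thesis by (simp add: algebra_simps)
  qed
  moreover have "\<forall>\<^sub>F z in nhds 0. z \<in> ?U"
    using r(1) by (intro eventually_nhds_in_open) auto
  ultimately show "\<forall>\<^sub>F z in nhds 0. F z = F (zap j z) + z $ j * hquot j F z"
    by (rule eventually_mono[rotated])
qed

section \<open>Germs at the origin\<close>

abbreviation ev :: "(complex ^ 'd \<Rightarrow> bool) \<Rightarrow> bool" where
  "ev P \<equiv> eventually P (nhds 0)"

lemma ev_compose:
  assumes "ev P" "vholo \<phi> q" "\<phi> q = 0"
  shows "\<forall>\<^sub>F z in nhds q. P (\<phi> z)"
  using vholo_tendsto[OF assms(2)] assms(1,3) by (simp add: filterlim_iff)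

lemma vholo_zap [intro, simp]: "vholo (zap j) p"
  unfolding vholo_def zap_def
proof
  fix i show "holo (\<lambda>z. (\<chi> i. if i = j then 0 else z $ i) $ i) p"
    by (cases "i = j") auto
qed

lemma zap_0 [simp]: "zap j 0 = 0"
  by (simp add: zap_def vec_eq_iff)

section \<open>Identity theorem and absence of zero divisors\<close>

lemma has_derivative_line:
  "((\<lambda>s. a + s *s v) has_derivative (\<lambda>h. h *s v)) (at (s :: complex))"
  by (rule has_derivative_vecI) (auto intro!: derivative_eq_intros)

lemma holomorphic_on_line:
  fixes F :: "complex ^ 'd \<Rightarrow> complex"
  assumes "\<And>s. s \<in> T \<Longrightarrow> cdiff F (a + s *s v)"
  shows "(\<lambda>s. F (a + s *s v)) holomorphic_on T"
proof (rule holomorphic_onI)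
  fix s assume "s \<in> T"
  from has_derivative_compose[OF has_derivative_line cdiffD[OF assms[OF this]]]
  have "((\<lambda>s. F (a + s *s v)) has_derivative (\<lambda>h. cdot (cgrad F (a + s *s v)) (h *s v))) (at s)" .
  moreover have "(\<lambda>h. cdot (cgrad F (a + s *s v)) (h *s v)) = (*) (cdot (cgrad F (a + s *s v)) v)"
    by (simp add: cdot_def fun_eq_iff sum_distrib_left sum_distrib_right mult_ac)
  ultimately show "(\<lambda>s. F (a + s *s v)) field_differentiable at s within T"
    unfolding field_differentiable_def has_field_derivative_def
    by (intro exI) (rule has_derivative_at_withinI, simp)
qed

lemma continuous_on_line: "continuous_on T (\<lambda>s :: complex. a + s *s v)"
  by (intro continuous_at_imp_continuous_on ballI has_derivative_continuous[OF has_derivative_line])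

text \<open>Restrict \<open>Q\<close> to the complex line through \<open>z0\<close> (parameter 0)
  and \<open>w\<close> (parameter 1). The parameters whose points lie in the ball form an open
  convex set, so one-variable analytic continuation carries the vanishing from 0 to 1.\<close>

lemma identity_ball:
  fixes Q :: "complex ^ 'd \<Rightarrow> complex"
  assumes Q: "\<And>z. z \<in> ball 0 r \<Longrightarrow> cdiff Q z"
    and z0: "z0 \<in> ball 0 r" and w: "w \<in> ball 0 r"
    and zero: "\<forall>\<^sub>F z in nhds z0. Q z = 0"
  shows "Q w = 0"
proof -
  define T where "T = (\<lambda>s :: complex. z0 + s *s (w - z0)) -` ball 0 r"
  let ?f = "\<lambda>s. Q (z0 + s *s (w - z0))"
  have lim: "((\<lambda>s :: complex. z0 + s *s (w - z0)) \<longlongrightarrow> z0) (nhds 0)"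
    using has_derivative_continuous[OF has_derivative_line[of z0 "w - z0" 0]]
      tendsto_at_iff_tendsto_nhds[of "\<lambda>s. z0 + s *s (w - z0)" 0]
    unfolding isCont_def by auto
  have "?f holomorphic_on T"
    by (rule holomorphic_on_line) (auto simp: T_def intro: Q)
  moreover have "open T"
    unfolding T_def by (intro open_vimage continuous_on_line) simp
  moreover have "connected T"
  proof -
    have "convex T"
    proof (rule convexI)
      fix x y :: complex and u v :: real
      assume xy: "x \<in> T" "y \<in> T" and uv: "0 \<le> u" "0 \<le> v" "u + v = 1"
      have "z0 + (u *\<^sub>R x + v *\<^sub>R y) *s (w - z0) =
        u *\<^sub>R (z0 + x *s (w - z0)) + v *\<^sub>R (z0 + y *s (w - z0))"
        using uv(3) by (simp add: vec_eq_iff algebra_simps flip: scaleR_left_distrib)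
      also have "\<dots> \<in> ball 0 r"
        using convex_ball[of 0 r] xy uv unfolding T_def convex_def by blast
      finally show "u *\<^sub>R x + v *\<^sub>R y \<in> T" by (simp add: T_def)
    qed
    then show ?thesis by (rule convex_connected)
  qed
  moreover obtain e where e: "e > 0" "\<And>s. norm s < e \<Longrightarrow> ?f s = 0"
  proof -
    have "\<forall>\<^sub>F s in nhds 0. ?f s = 0"
      using zero lim unfolding filterlim_iff by blast
    then show ?thesis using that unfolding eventually_nhds_metric by auto
  qed
  moreover have "0 \<in> T" "1 \<in> T" using z0 w by (auto simp: T_def)
  moreover have "(0::complex) islimpt (ball 0 e \<inter> T)"
    using \<open>0 \<in> T\<close> \<open>open T\<close> e(1) by (intro interior_limit_point) (auto simp: interior_open open_Int)
  ultimately have "?f 1 = 0"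
    by (intro analytic_continuation[of ?f T "ball 0 e \<inter> T" 0 1]) auto
  then show ?thesis by simp
qed

text \<open>If \<open>Q\<close> is not the zero germ, it is nonzero at some \<open>w\<close> of any
  small ball, hence near \<open>w\<close>. There \<open>P\<close> must vanish, and the identity
  theorem spreads this over the whole ball.\<close>

lemma holo_domain:
  fixes P Q :: "complex ^ 'd \<Rightarrow> complex"
  assumes P: "holo P 0" and Q: "holo Q 0" and PQ: "ev (\<lambda>z. P z * Q z = 0)"
  shows "ev (\<lambda>z. P z = 0) \<or> ev (\<lambda>z. Q z = 0)"
proof (rule disjCI)
  assume nQ: "\<not> ev (\<lambda>z. Q z = 0)"
  have "\<forall>\<^sub>F z in nhds 0. cdiff P z \<and> cdiff Q z \<and> P z * Q z = 0"
    using assms unfolding holo_def by (simp add: eventually_conj)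
  then obtain r where r: "r > 0" and all: "\<And>z. z \<in> ball 0 r \<Longrightarrow> cdiff P z \<and> cdiff Q z \<and> P z * Q z = 0"
    unfolding eventually_nhds_metric by (auto simp: dist_commute)
  have "\<exists>w\<in>ball 0 r. Q w \<noteq> 0"
  proof (rule ccontr)
    assume "\<not> ?thesis"
    then have "\<And>z. z \<in> ball 0 r \<Longrightarrow> Q z = 0" by blast
    moreover have "ev (\<lambda>z. z \<in> ball 0 r)" using r by (intro eventually_nhds_in_open) auto
    ultimately have "ev (\<lambda>z. Q z = 0)" by (rule eventually_mono[rotated])
    with nQ show False by simp
  qed
  then obtain w where w: "w \<in> ball 0 r" "Q w \<noteq> 0" by blast
  have "P z = 0" if z: "z \<in> ball 0 r" for z
  proof (rule identity_ball[OF _ w(1) z])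
    show "cdiff P z" if "z \<in> ball 0 r" for z using all that by blast
    have "isCont Q w" using all w(1) cdiff_isCont by blast
    then have "(Q \<longlongrightarrow> Q w) (nhds w)"
      by (simp add: isCont_def tendsto_at_iff_tendsto_nhds)
    then have "\<forall>\<^sub>F z in nhds w. Q z \<noteq> 0"
      using w(2) by (rule tendsto_imp_eventually_ne)
    moreover have "\<forall>\<^sub>F z in nhds w. z \<in> ball 0 r"
      using w(1) by (intro eventually_nhds_in_open) auto
    ultimately show "\<forall>\<^sub>F z in nhds w. P z = 0"
      by eventually_elim (use all in force)
  qed
  moreover have "ev (\<lambda>z. z \<in> ball 0 r)" using r by (intro eventually_nhds_in_open) auto
  ultimately show "ev (\<lambda>z. P z = 0)" by (rule eventually_mono[rotated])
qed

lemma not_ev_nth: "\<not> ev (\<lambda>z :: complex ^ 'd. z $ j = 0)"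
proof
  assume "ev (\<lambda>z :: complex ^ 'd. z $ j = 0)"
  then obtain e where "e > 0" "\<And>z :: complex ^ 'd. norm z < e \<Longrightarrow> z $ j = 0"
    unfolding eventually_nhds_metric by auto
  from this(2)[of "axis j (of_real (e / 2))"] this(1) show False by simp
qed

lemma holo_cancel:
  assumes "holo P 0" "holo Q 0" "ev (\<lambda>z. z $ j * P z = z $ j * Q z)"
  shows "ev (\<lambda>z. P z = Q z)"
proof -
  have "ev (\<lambda>z. z $ j * (P z - Q z) = 0)"
    using assms(3) by eventually_elim (simp add: algebra_simps)
  then have "ev (\<lambda>z. P z - Q z = 0)"
    using holo_domain[of "\<lambda>z. z $ j" "\<lambda>z. P z - Q z"] not_ev_nth assms by (auto intro: holo_diff)
  then show ?thesis by eventually_elim simp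
qed

lemma holo_divide_coord:
  assumes "holo P 0" "ev (\<lambda>z. P (zap j z) = 0)"
  obtains P1 where "holo P1 0" "ev (\<lambda>z. P z = z $ j * P1 z)"
proof
  show "holo (hquot j P) 0" by (rule hquot[OF assms(1)])
  show "ev (\<lambda>z. P z = z $ j * hquot j P z)"
    using hquot(2)[OF assms(1), of j] assms(2) by eventually_elim (metis add_0)
qed

section \<open>Monomials times units\<close>

definition mon :: "'d set \<Rightarrow> ('d \<Rightarrow> nat) \<Rightarrow> complex ^ 'd \<Rightarrow> complex" where
  "mon S a z = (\<Prod>i\<in>S. z $ i ^ a i)"

text \<open>Germs that are a monomial times a unit, i.e. with normal crossings.\<close>

definition MU :: "'d set \<Rightarrow> (complex ^ 'd \<Rightarrow> complex) \<Rightarrow> bool" where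
  "MU S F \<longleftrightarrow> (\<exists>a u. holo u 0 \<and> u 0 \<noteq> 0 \<and> ev (\<lambda>z. F z = mon S a z * u z))"

lemma holo_mon [intro, simp]: "holo (mon S a) p"
  unfolding mon_def by (intro holo_prod holo_power holo_nth)

lemma mon_add: "mon S (\<lambda>i. a i + b i) z = mon S a z * mon S b z"
  by (simp add: mon_def power_add prod.distrib)

lemma mon_0 [simp]: "mon S (\<lambda>_. 0) z = 1"
  by (simp add: mon_def)

lemma mon_single:
  fixes S :: "'d::finite set"
  assumes "j \<in> S" shows "mon S (\<lambda>i. if i = j then k else 0) z = z $ j ^ k"
proof -
  have "mon S (\<lambda>i. if i = j then k else 0) z = (\<Prod>i\<in>S. if i = j then z $ j ^ k else 1)"
    unfolding mon_def by (rule prod.cong) auto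
  also have "\<dots> = z $ j ^ k" using assms by simp
  finally show ?thesis .
qed

lemma mon_dec:
  fixes S :: "'d::finite set"
  assumes "j \<in> S" "a j > 0" shows "mon S a z = z $ j * mon S (a(j := a j - 1)) z"
proof -
  have "a = (\<lambda>i. (if i = j then 1 else 0) + (a(j := a j - 1)) i)"
    using assms(2) by (auto simp: fun_eq_iff)
  then have "mon S a z = mon S (\<lambda>i. (if i = j then 1 else 0) + (a(j := a j - 1)) i) z" by simp
  also have "\<dots> = z $ j * mon S (a(j := a j - 1)) z"
    unfolding mon_add[of S "\<lambda>i. if i = j then 1 else 0" "a(j := a j - 1)"] mon_single[OF assms(1)] by simp
  finally show ?thesis .
qed

lemma MU_cong: "ev (\<lambda>z. F z = G z) \<Longrightarrow> MU S F \<Longrightarrow> MU S G"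
proof -
  assume FG: "ev (\<lambda>z. F z = G z)" and "MU S F"
  then obtain a u where u: "holo u 0" "u 0 \<noteq> 0" and F: "ev (\<lambda>z. F z = mon S a z * u z)"
    unfolding MU_def by blast
  have "ev (\<lambda>z. G z = mon S a z * u z)"
    using FG F by eventually_elim simp
  with u show ?thesis unfolding MU_def by blast
qed

lemma MU_mon: "MU S (mon S a)"
  unfolding MU_def by (intro exI[of _ a] exI[of _ "\<lambda>_. 1"]) auto

lemma MU_unit: "holo u 0 \<Longrightarrow> u 0 \<noteq> 0 \<Longrightarrow> MU S u"
  unfolding MU_def by (intro exI[of _ "\<lambda>_. 0"] exI[of _ u]) auto

lemma MU_mult:
  assumes "MU S F" "MU S G" shows "MU S (\<lambda>z. F z * G z)"
proof -
  obtain a u b v where "holo u 0" "u 0 \<noteq> 0" "holo v 0" "v 0 \<noteq> 0"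
    and F: "ev (\<lambda>z. F z = mon S a z * u z)" and G: "ev (\<lambda>z. G z = mon S b z * v z)"
    using assms unfolding MU_def by blast
  moreover have "ev (\<lambda>z. F z * G z = mon S (\<lambda>i. a i + b i) z * (u z * v z))"
    using F G by eventually_elim (simp add: mon_add)
  ultimately show ?thesis
    unfolding MU_def by (intro exI[of _ "\<lambda>i. a i + b i"] exI[of _ "\<lambda>z. u z * v z"]) auto
qed

lemma MU_power: "MU S F \<Longrightarrow> MU S (\<lambda>z. F z ^ n)"
  by (induction n) (auto intro: MU_mult MU_unit)

lemma MU_holo: "MU S F \<Longrightarrow> holo F 0"
  unfolding MU_def
proof (elim exE conjE)
  fix a u assume "holo u 0" "ev (\<lambda>z. F z = mon S a z * u z)"
  then show "holo F 0"
    by (intro holo_cong_ev[of "\<lambda>z. mon S a z * u z" F]) (auto simp: eq_commute)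
qed

lemma MU_coord: "j \<in> S \<Longrightarrow> MU (S :: 'd::finite set) (\<lambda>z. z $ j)"
  using MU_mon[of S "\<lambda>i. if i = j then 1 else 0"] mon_single[of j S 1]
  by (metis (no_types, lifting) ext power_one_right)

text \<open>As there are no zero divisors among the germs, a coordinate dividing a product divides one of
  the factors and can be cancelled.\<close>

lemma MU_factor:
  fixes S :: "'d::finite set"
  assumes "holo P 0" "holo Q 0" "MU S (\<lambda>z. P z * Q z)"
  shows "MU S P"
proof -
  obtain a u where "holo u 0" "u 0 \<noteq> 0" "ev (\<lambda>z. P z * Q z = mon S a z * u z)"
    using assms(3) unfolding MU_def by blast
  with assms(1,2) show ?thesis
  proof (induction "\<Sum>i\<in>S. a i" arbitrary: a P Q)
    case 0
    then have "mon S a z = 1" for z by (simp add: mon_def)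
    with 0 have "P 0 * Q 0 = u 0" by (auto dest: eventually_nhds_x_imp_x)
    with 0 show ?case by (intro MU_unit) auto
  next
    case (Suc k)
    then obtain j where j: "j \<in> S" "a j > 0"
      by (metis finite gr0I nat.simps(3) sum.neutral)
    define a' where "a' = a(j := a j - 1)"
    have "(\<Sum>i\<in>S. a i) = Suc (\<Sum>i\<in>S. a' i)"
      using j by (simp add: sum.remove[OF finite j(1)] a'_def)
    then have k: "k = (\<Sum>i\<in>S. a' i)" using Suc.hyps(2) by simp
    define R where "R z = mon S a' z * u z" for z
    have R: "holo R 0" unfolding R_def using Suc.prems by auto
    have PQ: "ev (\<lambda>z. P z * Q z = z $ j * R z)"
      using Suc.prems(5) mon_dec[of j S a, OF j] by (simp add: R_def a'_def mult.assoc)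
    \<comment> \<open>On the hyperplane \<open>z $ j = 0\<close> the product vanishes. The
      restrictions of \<open>P\<close> and \<open>Q\<close> are germs again, so one of them is zero,
      and that factor is divisible by \<open>z $ j\<close>.\<close>
    have "ev (\<lambda>z. P (zap j z) * Q (zap j z) = zap j z $ j * R (zap j z))"
      using ev_compose[OF PQ, of "zap j" 0] by simp
    then have "ev (\<lambda>z. P (zap j z) * Q (zap j z) = 0)"
      by (simp add: zap_def)
    then consider "ev (\<lambda>z. P (zap j z) = 0)" | "ev (\<lambda>z. Q (zap j z) = 0)"
      using holo_domain[of "\<lambda>z. P (zap j z)" "\<lambda>z. Q (zap j z)"]
        holo_compose[of "zap j" 0 P] holo_compose[of "zap j" 0 Q] Suc.prems(1,2) by auto
    then show ?case
    proof cases
      case 1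
      obtain P1 where P1: "holo P1 0" "ev (\<lambda>z. P z = z $ j * P1 z)"
        using holo_divide_coord[OF Suc.prems(1) 1] by blast
      have "ev (\<lambda>z. z $ j * (P1 z * Q z) = z $ j * R z)"
        using P1(2) PQ by eventually_elim (simp add: mult.assoc)
      then have "ev (\<lambda>z. P1 z * Q z = R z)"
        using P1 Suc.prems R by (intro holo_cancel[of "\<lambda>z. P1 z * Q z" R j]) auto
      then have "MU S P1"
        using Suc.hyps(1)[OF k P1(1) Suc.prems(2) Suc.prems(3,4)] by (simp add: R_def)
      then have "MU S (\<lambda>z. z $ j * P1 z)"
        by (intro MU_mult MU_coord j)
      then show ?thesis
        by (rule MU_cong[rotated]) (use P1(2) in \<open>simp add: eq_commute\<close>)
    next
      case 2
      obtain Q1 where Q1: "holo Q1 0" "ev (\<lambda>z. Q z = z $ j * Q1 z)"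
        using holo_divide_coord[OF Suc.prems(2) 2] by blast
      have "ev (\<lambda>z. z $ j * (P z * Q1 z) = z $ j * R z)"
        using Q1(2) PQ by eventually_elim (simp add: mult.left_commute)
      then have "ev (\<lambda>z. P z * Q1 z = R z)"
        using Q1 Suc.prems R by (intro holo_cancel[of "\<lambda>z. P z * Q1 z" R j]) auto
      then show ?thesis
        using Suc.hyps(1)[OF k Suc.prems(1) Q1(1) Suc.prems(3,4)] by (simp add: R_def)
    qed
  qed
qed

lemma MU_prod_factor:
  fixes S :: "'d::finite set"
  assumes "finite I" "\<And>i. i \<in> I \<Longrightarrow> holo (F i) 0" "MU S (\<lambda>z. \<Prod>i\<in>I. F i z)" "i \<in> I"
  shows "MU S (F i)"
proof -
  have "(\<lambda>z. \<Prod>i\<in>I. F i z) = (\<lambda>z. F i z * (\<Prod>i\<in>I - {i}. F i z))"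
    using assms(1,4) by (simp add: prod.remove)
  with assms show ?thesis
    by (intro MU_factor[of "F i" "\<lambda>z. \<Prod>i\<in>I - {i}. F i z"]) auto
qed

lemma ev_test_point:
  assumes "ev P"
  obtains \<epsilon> :: complex where "\<epsilon> \<noteq> 0" "P (\<chi> i. if i \<in> Z then 0 else \<epsilon>)"
proof -
  have "((\<lambda>\<epsilon>::complex. (\<chi> i. if i \<in> Z then 0 else \<epsilon>) :: complex ^ 'a) \<longlongrightarrow> 0) (at 0)"
  proof (rule vec_tendstoI)
    fix i show "((\<lambda>\<epsilon>::complex. ((\<chi> i. if i \<in> Z then 0 else \<epsilon>) :: complex ^ 'a) $ i) \<longlongrightarrow> 0 $ i) (at 0)"
      by (cases "i \<in> Z") (auto intro: tendsto_ident_at)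
  qed
  then have "\<forall>\<^sub>F \<epsilon> in at (0::complex). P (\<chi> i. if i \<in> Z then 0 else \<epsilon>)"
    using assms unfolding filterlim_iff by blast
  moreover have "\<forall>\<^sub>F \<epsilon> in at (0::complex). \<epsilon> \<noteq> 0"
    by (rule eventually_neq_at_within)
  ultimately have "\<forall>\<^sub>F \<epsilon> in at (0::complex). \<epsilon> \<noteq> 0 \<and> P (\<chi> i. if i \<in> Z then 0 else \<epsilon>)"
    by eventually_elim auto
  then obtain \<epsilon> where "\<epsilon> \<noteq> 0 \<and> P (\<chi> i. if i \<in> Z then 0 else \<epsilon>)"
    using eventually_happens'[OF at_neq_bot] by blast
  then show ?thesis using that by blast
qed

text \<open>Evaluation at a point near the origin with coordinates 0 on \<open>Z\<close> and one
  common nonzero value elsewhere detects which exponents of a monomial are positive. This tells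
  monomials apart without any expansion.\<close>

lemma ev_test_monomials:
  fixes S :: "'d::finite set"
  assumes "ev P"
  obtains p where "P p" "\<And>a. mon S a p = 0 \<longleftrightarrow> (\<exists>i\<in>S \<inter> Z. a i > 0)"
proof -
  obtain \<epsilon> :: complex where \<epsilon>: "\<epsilon> \<noteq> 0" "P (\<chi> i. if i \<in> Z then 0 else \<epsilon>)"
    using ev_test_point[OF assms] by blast
  have "mon S a (\<chi> i. if i \<in> Z then 0 else \<epsilon>) = 0 \<longleftrightarrow> (\<exists>i\<in>S \<inter> Z. a i > 0)" for a
    using \<epsilon>(1) by (auto simp: mon_def)
  with \<epsilon>(2) that show ?thesis by blast
qed

lemma ev_unit: "holo u 0 \<Longrightarrow> u 0 \<noteq> 0 \<Longrightarrow> ev (\<lambda>z. u z \<noteq> 0)"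
  by (rule tendsto_imp_eventually_ne[OF holo_tendsto])

text \<open>Variables common to both monomials divide the right-hand side too and are cancelled.
  Suppose each side then kept a private variable, \<open>j\<close> and \<open>l\<close>. Setting
  \<open>z $ j = 0\<close>, or jointly with it one variable \<open>m\<close> of the right-hand side,
  kills every term but one; if \<open>m\<close> occurs in the second monomial, \<open>l\<close>
  takes the place of \<open>j\<close>. The flag \<open>k\<close> covers a vanishing difference as
  well.\<close>

lemma mon_compare:
  fixes S :: "'d::finite set"
  assumes "holo u 0" "u 0 \<noteq> 0" "holo v 0" "v 0 \<noteq> 0" "holo w 0" "w 0 \<noteq> 0"
    and "ev (\<lambda>z. mon S a z * u z - mon S b z * v z = of_bool k * (mon S g z * w z))"
  shows "(\<forall>i\<in>S. a i \<le> b i) \<or> (\<forall>i\<in>S. b i \<le> a i)"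
  using assms(7)
proof (induction "(\<Sum>i\<in>S. a i)" arbitrary: a b g rule: less_induct)
  case less
  \<comment> \<open>In \<open>contra\<close>, \<open>contra'\<close> and \<open>contra''\<close>
    exactly one of the three terms survives at a test point: the second on the left, the first on
    the left, and the right-hand side, respectively.\<close>
  have contra: False if "\<exists>i\<in>S \<inter> Z. a i > 0" "\<not> (\<exists>i\<in>S \<inter> Z. b i > 0)" "k \<Longrightarrow> \<exists>i\<in>S \<inter> Z. g i > 0" for Z
  proof -
    have "ev (\<lambda>z. mon S a z * u z - mon S b z * v z = of_bool k * (mon S g z * w z) \<and> v z \<noteq> 0)"
      using less.prems ev_unit[OF assms(3,4)] by eventually_elim auto
    then obtain p where "mon S a p * u p - mon S b p * v p = of_bool k * (mon S g p * w p) \<and> v p \<noteq> 0"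
      and M: "\<And>a. mon S a p = 0 \<longleftrightarrow> (\<exists>i\<in>S \<inter> Z. a i > 0)"
      by (rule ev_test_monomials[where S=S and Z=Z]) blast
    then have eq: "mon S a p * u p - mon S b p * v p = (of_bool k * mon S g p) * w p" "v p \<noteq> 0"
      by (simp_all add: mult.assoc)
    have "mon S a p = 0" "mon S b p \<noteq> 0" "of_bool k * mon S g p = 0"
      using that unfolding M by (blast, blast, cases k) (simp_all add: M)
    with eq show False by simp
  qed
  have contra': False if "\<exists>i\<in>S \<inter> Z. b i > 0" "\<not> (\<exists>i\<in>S \<inter> Z. a i > 0)" "k \<Longrightarrow> \<exists>i\<in>S \<inter> Z. g i > 0" for Z
  proof -
    have "ev (\<lambda>z. mon S a z * u z - mon S b z * v z = of_bool k * (mon S g z * w z) \<and> u z \<noteq> 0)"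
      using less.prems ev_unit[OF assms(1,2)] by eventually_elim auto
    then obtain p where "mon S a p * u p - mon S b p * v p = of_bool k * (mon S g p * w p) \<and> u p \<noteq> 0"
      and M: "\<And>a. mon S a p = 0 \<longleftrightarrow> (\<exists>i\<in>S \<inter> Z. a i > 0)"
      by (rule ev_test_monomials[where S=S and Z=Z]) blast
    then have eq: "mon S a p * u p - mon S b p * v p = (of_bool k * mon S g p) * w p" "u p \<noteq> 0"
      by (simp_all add: mult.assoc)
    have "mon S b p = 0" "mon S a p \<noteq> 0" "of_bool k * mon S g p = 0"
      using that unfolding M by (blast, blast, cases k) (simp_all add: M)
    with eq show False by simp
  qed
  have contra'': False if k "\<exists>i\<in>S \<inter> Z. b i > 0" "\<exists>i\<in>S \<inter> Z. a i > 0" "\<not> (\<exists>i\<in>S \<inter> Z. g i > 0)" for Z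
  proof -
    have "ev (\<lambda>z. mon S a z * u z - mon S b z * v z = of_bool k * (mon S g z * w z) \<and> w z \<noteq> 0)"
      using less.prems ev_unit[OF assms(5,6)] by eventually_elim auto
    then obtain p where "mon S a p * u p - mon S b p * v p = of_bool k * (mon S g p * w p) \<and> w p \<noteq> 0"
      and M: "\<And>a. mon S a p = 0 \<longleftrightarrow> (\<exists>i\<in>S \<inter> Z. a i > 0)"
      by (rule ev_test_monomials[where S=S and Z=Z]) blast
    then have eq: "mon S a p * u p - mon S b p * v p = (of_bool k * mon S g p) * w p" "w p \<noteq> 0"
      by (simp_all add: mult.assoc)
    have "mon S b p = 0" "mon S a p = 0" "of_bool k * mon S g p \<noteq> 0"
      using that unfolding M by (blast, blast, cases k) (simp_all add: M)
    with eq show False by simp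
  qed
  show ?case
  proof (cases "\<exists>j\<in>S. a j > 0 \<and> b j > 0")
    case True
    then obtain j where j: "j \<in> S" "a j > 0" "b j > 0" by blast
    have g: "g j > 0" if k
      using contra''[of "{j}"] that j by auto
    let ?d = "\<lambda>a :: 'd \<Rightarrow> nat. a(j := a j - 1)"
    have "ev (\<lambda>z. z $ j * (mon S (?d a) z * u z - mon S (?d b) z * v z) =
        z $ j * (of_bool k * (mon S (?d g) z * w z)))"
      using less.prems
    proof eventually_elim
      case (elim z)
      have "of_bool k * mon S g z = z $ j * (of_bool k * mon S (?d g) z)"
        using g mon_dec[of j S g z] j by (cases k) simp_all
      moreover have "mon S a z = z $ j * mon S (?d a) z" "mon S b z = z $ j * mon S (?d b) z"
        using mon_dec[of j S a z] mon_dec[of j S b z] j by blast+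
      ultimately show ?case
        using elim unfolding right_diff_distrib mult.assoc[symmetric] by simp
    qed
    then have eq: "ev (\<lambda>z. mon S (?d a) z * u z - mon S (?d b) z * v z = of_bool k * (mon S (?d g) z * w z))"
      by (intro holo_cancel[of "\<lambda>z. mon S (?d a) z * u z - mon S (?d b) z * v z"
            "\<lambda>z. of_bool k * (mon S (?d g) z * w z)" j] holo_diff holo_mult holo_mon assms holo_const)
    have "(\<Sum>i\<in>S. ?d a i) < (\<Sum>i\<in>S. a i)"
      using j by (intro sum_strict_mono_ex1) auto
    from less.hyps[OF this eq] show ?thesis
    proof
      assume le: "\<forall>i\<in>S. ?d a i \<le> ?d b i"
      have "a i \<le> b i" if "i \<in> S" for i
        using le[rule_format, OF that] j by (cases "i = j") auto
      then show ?thesis by blast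
    next
      assume le: "\<forall>i\<in>S. ?d b i \<le> ?d a i"
      have "b i \<le> a i" if "i \<in> S" for i
        using le[rule_format, OF that] j by (cases "i = j") auto
      then show ?thesis by blast
    qed
  next
    case False
    show ?thesis
    proof (rule ccontr)
      assume "\<not> ?thesis"
      then obtain j l where j: "j \<in> S" "a j > b j" and l: "l \<in> S" "b l > a l"
        by (auto simp: not_le)
      then have jl: "a j > 0" "b j = 0" "b l > 0" "a l = 0" using False by auto
      show False
      proof (cases k)
        case False
        then show False using contra[of "{j}"] j jl by auto
      next
        case True
        \<comment> \<open>Otherwise the right-hand side is nonzero at the origin, where both terms
          on the left vanish.\<close>
        have "\<exists>m\<in>S. g m > 0"
        proof (rule ccontr)
          assume "\<not> ?thesis"
          then show False
            using contra''[of UNIV] True j(1) l(1) jl(1,3) by (metis Int_UNIV_right)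
        qed
        then obtain m where m: "m \<in> S" "g m > 0" by blast
        show False
        proof (cases "b m = 0")
          case True
          then show False using contra[of "{m, j}"] j jl m by auto
        next
          case bm: False
          then have "a m = 0" using False m by auto
          then show False using contra'[of "{m, l}"] l jl m by auto
        qed
      qed
    qed
  qed
qed

section \<open>Charts and resolvability\<close>

text \<open>Functions of the variables in \<open>S\<close> only. The induction on the number of
  variables runs over \<open>S\<close> and thus stays inside the one type
  \<open>complex ^ 'd\<close>.\<close>

definition dep :: "'d set \<Rightarrow> (complex ^ 'd \<Rightarrow> complex) \<Rightarrow> bool" where
  "dep S F \<longleftrightarrow> (\<forall>z w. (\<forall>i\<in>S. z $ i = w $ i) \<longrightarrow> F z = F w)"

text \<open>A chart moves only the coordinates in \<open>S\<close>, in a way that depends only on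
  them. A chart that resolves the coefficients of a polynomial in \<open>z $ n\<close> is therefore
  also a chart for \<open>insert n S\<close>, and it leaves \<open>z $ n\<close> alone.\<close>

definition chart :: "'d set \<Rightarrow> (complex ^ 'd \<Rightarrow> complex ^ 'd) \<Rightarrow> (complex ^ 'd) set \<Rightarrow> bool" where
  "chart S \<phi> K \<longleftrightarrow> compact K \<and> continuous_on K \<phi> \<and> (\<forall>q\<in>K. \<phi> q = 0 \<longrightarrow> vholo \<phi> q) \<and>
     (\<forall>i. i \<notin> S \<longrightarrow> (\<forall>z. \<phi> z $ i = z $ i)) \<and> (\<forall>i\<in>S. dep S (\<lambda>z. \<phi> z $ i))"

text \<open>A base point \<open>q\<close> with \<open>\<phi> q \<noteq> 0\<close> needs no condition: by compactness of \<open>K\<close>, only the base points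
  over the origin are needed to cover a neighbourhood of the origin.\<close>

inductive resolvable :: "'d set \<Rightarrow> (complex ^ 'd \<Rightarrow> complex) \<Rightarrow> bool" for S where
  MU: "MU S F \<Longrightarrow> resolvable S F"
| cover: "finite \<Phi> \<Longrightarrow> (\<And>\<phi> K. (\<phi>, K) \<in> \<Phi> \<Longrightarrow> chart S \<phi> K) \<Longrightarrow>
    ev (\<lambda>x. \<exists>(\<phi>, K)\<in>\<Phi>. x \<in> \<phi> ` K) \<Longrightarrow>
    (\<And>\<phi> K q. (\<phi>, K) \<in> \<Phi> \<Longrightarrow> q \<in> K \<Longrightarrow> \<phi> q = 0 \<Longrightarrow> resolvable S (\<lambda>z. F (\<phi> (q + z)))) \<Longrightarrow> resolvable S F"

section \<open>The Lojasiewicz gradient inequality\<close>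

text \<open>The parameter \<open>k\<close> controls the exponent and the constant at once, so that finitely many such
  inequalities have a common weakening.\<close>

definition Loj :: "nat \<Rightarrow> (complex ^ 'd \<Rightarrow> complex) \<Rightarrow> complex ^ 'd \<Rightarrow> bool" where
  "Loj k F z \<longleftrightarrow> norm (F z) \<le> 1 \<and> norm (F z) powr (1 - 1 / (real k + 2)) \<le> real k * norm (cgrad F z)"

text \<open>The exponent grows with \<open>k\<close>, and a larger exponent weakens the inequality
  because \<open>norm (F z) \<le> 1\<close>; hence this bound is part of \<open>Loj\<close>.\<close>

lemma Loj_mono:
  assumes "Loj k F z" "k \<le> k'" shows "Loj k' F z"
proof -
  have "norm (F z) powr (1 - 1 / (real k' + 2)) \<le> norm (F z) powr (1 - 1 / (real k + 2))"
    using assms by (intro powr_mono') (auto simp: Loj_def frac_le)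
  also have "\<dots> \<le> real k * norm (cgrad F z)" using assms by (simp add: Loj_def)
  also have "\<dots> \<le> real k' * norm (cgrad F z)" using assms by (intro mult_right_mono) auto
  finally show ?thesis using assms by (simp add: Loj_def)
qed

lemma cgrad_cong:
  assumes "\<forall>\<^sub>F w in nhds z. F w = G w"
  shows "cgrad F z = cgrad G z"
proof -
  have "deriv (\<lambda>s. F (z + axis i s)) 0 = deriv (\<lambda>s. G (z + axis i s)) 0" for i
  proof (rule deriv_cong_ev)
    have "((\<lambda>s. z + axis i s) \<longlongrightarrow> z + axis i 0) (nhds (0::complex))"
      by (intro tendsto_add tendsto_const bounded_linear.tendsto[OF bounded_linear_axis] filterlim_ident)
    then have "filterlim (\<lambda>s. z + axis i s) (nhds z) (nhds (0::complex))"
      by (simp add: axis_zero)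
    with assms show "\<forall>\<^sub>F s in nhds 0. F (z + axis i s) = G (z + axis i s)"
      unfolding filterlim_iff by blast
  qed simp
  then show ?thesis by (simp add: cgrad_def)
qed

text \<open>The Euler operator, \<open>z $ i\<close> times the \<open>i\<close>-th partial
  derivative, reproduces a monomial up to the factor \<open>a i\<close>, so the whole monomial
  splits off without exponents \<open>a i - 1\<close>.\<close>

lemma cgrad_mon_mult:
  fixes S :: "'d::finite set"
  assumes i: "i \<in> S" and u: "cdiff u z"
  shows "z $ i * cgrad (\<lambda>z. mon S a z * u z) z $ i =
    mon S a z * (of_nat (a i) * u z + z $ i * cgrad u z $ i)"
proof -
  define c where "c = mon (S - {i}) a z"
  have mon: "mon S a (z + axis i s) = (z $ i + s) ^ a i * c" for s
  proof -
    have "mon (S - {i}) a (z + axis i s) = c"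
      unfolding mon_def c_def by (rule prod.cong) (auto simp: axis_def)
    then show ?thesis
      using i by (simp add: mon_def prod.remove[of S i])
  qed
  have "((\<lambda>s. u (z + axis i s)) has_field_derivative cgrad u z $ i) (at 0)"
    using has_derivative_cdot_axis[of u _ z i 0] cdiffD[OF u] by (simp add: axis_zero)
  then have "((\<lambda>s. mon S a (z + axis i s) * u (z + axis i s)) has_field_derivative
     (of_nat (a i) * z $ i ^ (a i - 1) * c * u z + z $ i ^ a i * c * cgrad u z $ i)) (at 0)"
    unfolding mon by (auto intro!: derivative_eq_intros simp: axis_zero)
  then have "cgrad (\<lambda>z. mon S a z * u z) z $ i =
      of_nat (a i) * z $ i ^ (a i - 1) * c * u z + z $ i ^ a i * c * cgrad u z $ i"
    by (simp add: cgrad_def DERIV_imp_deriv)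
  moreover have "mon S a z = z $ i ^ a i * c"
    using mon[of 0] by (simp add: axis_zero)
  moreover have "z $ i * (of_nat (a i) * z $ i ^ (a i - 1)) = of_nat (a i) * z $ i ^ a i"
    by (cases "a i") auto
  ultimately show ?thesis
    by (simp add: algebra_simps)
qed

text \<open>For a variable \<open>i\<close> of the monomial \<open>M\<close>, the Euler operator
  shows that the \<open>i\<close>-th partial derivative has size about
  \<open>norm M / norm (z $ i)\<close>. Taking the smallest such coordinate gives
  \<open>norm (z $ i) ^ m \<le> norm M\<close> with \<open>m\<close> the total degree, so the
  gradient is at least a constant times \<open>norm M\<close> to the power
  \<open>1 - 1 / (k + 2)\<close>.\<close>

lemma MU_Loj:
  fixes S :: "'d::finite set"
  assumes "MU S F" "F 0 = 0"
  shows "\<exists>k. ev (Loj k F)"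
proof -
  obtain a u where u: "holo u 0" "u 0 \<noteq> 0" and F: "ev (\<lambda>z. F z = mon S a z * u z)"
    using assms(1) unfolding MU_def by blast
  have "mon S a 0 = 0" using eventually_nhds_x_imp_x[OF F] u(2) assms(2) by simp
  then obtain i0 where i0: "i0 \<in> S" "a i0 > 0" by (auto simp: mon_def)
  define A where "A = {i\<in>S. a i > 0}"
  have A: "finite A" "A \<noteq> {}" using i0 by (auto simp: A_def)
  define U where "U = norm (u 0)"
  have U: "U > 0" using u by (simp add: U_def)
  define m where "m = (\<Sum>i\<in>S. a i)"
  \<comment> \<open>The second bound is \<open>(1 + 2 * U) / (U / 2)\<close>: the upper estimate of
    the unit against the lower estimate of the Euler factor in \<open>ev4\<close>.\<close>
  obtain k where k: "real k \<ge> real m" "real k \<ge> (2 + 4 * U) / U"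
    using real_arch_simple[of "max (real m) ((2 + 4 * U) / U)"] by auto
  have holoF: "holo F 0" using MU_holo assms by blast
  have ev1: "ev (\<lambda>z. norm (F z) < 1)"
  proof -
    have "((\<lambda>z. norm (F z)) \<longlongrightarrow> norm (F 0)) (nhds 0)"
      by (intro tendsto_norm holo_tendsto holoF)
    then show ?thesis using assms(2) by (auto intro: order_tendstoD)
  qed
  have ev2: "ev (\<lambda>z. \<forall>i\<in>A. norm (z $ i) < 1)"
  proof -
    have "((\<lambda>z :: complex ^ 'd. norm (z $ i)) \<longlongrightarrow> norm ((0 :: complex ^ 'd) $ i)) (nhds 0)" for i
      by (intro tendsto_norm holo_tendsto holo_nth)
    then have "ev (\<lambda>z :: complex ^ 'd. norm (z $ i) < 1)" for i
      by (rule order_tendstoD) simp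
    then show ?thesis using A(1) by (simp add: eventually_ball_finite)
  qed
  have ev3: "ev (\<lambda>z. norm (u z) < 2 * U)"
  proof -
    have "((\<lambda>z. norm (u z)) \<longlongrightarrow> norm (u 0)) (nhds 0)"
      by (intro tendsto_norm holo_tendsto u)
    then show ?thesis using U by (auto simp: U_def intro: order_tendstoD)
  qed
  have ev4: "ev (\<lambda>z. \<forall>i\<in>A. norm (of_nat (a i) * u z + z $ i * cgrad u z $ i) > U / 2)"
  proof (intro eventually_ball_finite A(1) ballI)
    fix i assume i: "i \<in> A"
    have "((\<lambda>z. norm (of_nat (a i) * u z + z $ i * cgrad u z $ i)) \<longlongrightarrow>
        norm (of_nat (a i) * u 0 + 0 $ i * cgrad u 0 $ i)) (nhds 0)"
      by (rule tendsto_norm, rule holo_tendsto) (intro holo_add holo_mult holo_const u holo_nth holo_cgrad)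
    moreover have "U / 2 < norm (of_nat (a i) * u 0 + 0 $ i * cgrad u 0 $ i)"
    proof -
      have "U / 2 < 1 * U" using U by simp
      also have "\<dots> \<le> real (a i) * U" using i U by (intro mult_right_mono) (auto simp: A_def)
      finally show ?thesis by (simp add: norm_mult U_def)
    qed
    ultimately show "ev (\<lambda>z. norm (of_nat (a i) * u z + z $ i * cgrad u z $ i) > U / 2)"
      by (rule order_tendstoD)
  qed
  have ev5: "ev (\<lambda>z. cdiff u z)" using u(1) unfolding holo_def .
  have ev6: "ev (\<lambda>z. \<forall>\<^sub>F w in nhds z. F w = mon S a w * u w)"
    using F by (simp add: eventually_eventually)
  have "ev (Loj k F)"
    using ev1 ev2 ev3 ev4 ev5 ev6
  proof eventually_elim
    case (elim z)
    let ?\<theta> = "1 - 1 / (real k + 2)"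
    have grad: "cgrad F z = cgrad (\<lambda>z. mon S a z * u z) z"
      by (rule cgrad_cong[OF elim(6)])
    have Fz: "F z = mon S a z * u z" using elim(6) eventually_nhds_x_imp_x by fastforce
    show "Loj k F z"
    proof (cases "mon S a z = 0")
      case True
      then show ?thesis by (simp add: Loj_def Fz)
    next
      case False
      define M where "M = norm (mon S a z)"
      have M: "M > 0" using False by (simp add: M_def)
      obtain i where i: "i \<in> A" "\<And>j. j \<in> A \<Longrightarrow> norm (z $ i) \<le> norm (z $ j)"
        using arg_min_if_finite[OF A, of "\<lambda>i. norm (z $ i)"] by (metis not_le)
      have zi: "z $ i \<noteq> 0" using False i(1) by (auto simp: mon_def A_def)
      define t where "t = norm (z $ i)"
      have t: "t > 0" "t < 1" using zi elim(2) i(1) by (auto simp: t_def)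
      have "t ^ (k + 2) \<le> t ^ m"
        using t k(1) by (intro power_decreasing) auto
      also have "\<dots> = (\<Prod>j\<in>S. t ^ a j)" by (simp add: m_def power_sum)
      also have "\<dots> \<le> (\<Prod>j\<in>S. norm (z $ j) ^ a j)"
      proof (rule prod_mono)
        fix j assume "j \<in> S"
        then show "0 \<le> t ^ a j \<and> t ^ a j \<le> norm (z $ j) ^ a j"
          using t i(2)[of j] by (cases "a j = 0") (auto simp: A_def t_def intro: power_mono)
      qed
      also have "\<dots> = M" by (simp add: M_def mon_def norm_power flip: prod_norm)
      finally have "t powr (real k + 2) \<le> M"
        using t powr_realpow[of t "k + 2"] by (simp add: add.commute)
      then have "(t powr (real k + 2)) powr (1 / (real k + 2)) \<le> M powr (1 / (real k + 2))"
        by (intro powr_mono2) auto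
      then have tM: "t \<le> M powr (1 / (real k + 2))"
        using t by (simp add: powr_powr)
      have "M powr ?\<theta> = M / M powr (1 / (real k + 2))"
        using M by (simp add: powr_diff)
      also have "\<dots> \<le> M / t"
        using tM M t by (intro divide_left_mono) auto
      finally have Mt: "M powr ?\<theta> \<le> M / t" .
      have "t * norm (cgrad F z $ i) = M * norm (of_nat (a i) * u z + z $ i * cgrad u z $ i)"
        using cgrad_mon_mult[of i S u z a] i(1) elim(5)
        by (simp add: grad t_def M_def A_def flip: norm_mult)
      also have "\<dots> \<ge> M * (U / 2)"
        using elim(4) i(1) M by (intro mult_left_mono) (auto intro: less_imp_le)
      finally have "M / t * (U / 2) \<le> norm (cgrad F z $ i)"
        using t by (simp add: field_simps)
      also have "\<dots> \<le> norm (cgrad F z)" by (rule Finite_Cartesian_Product.norm_nth_le)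
      finally have g: "M / t * (U / 2) \<le> norm (cgrad F z)" .
      have "norm (F z) powr ?\<theta> \<le> (M * (2 * U)) powr ?\<theta>"
        using elim(3) M by (intro powr_mono2) (auto simp: Fz norm_mult M_def intro!: mult_left_mono)
      also have "\<dots> = M powr ?\<theta> * (2 * U) powr ?\<theta>"
        using M U by (simp add: powr_mult)
      also have "\<dots> \<le> (M / t) * (1 + 2 * U)"
      proof (rule mult_mono)
        have "(2 * U) powr ?\<theta> \<le> (1 + 2 * U) powr ?\<theta>" using U by (intro powr_mono2) auto
        also have "\<dots> \<le> (1 + 2 * U) powr 1" using U by (intro powr_mono) auto
        finally show "(2 * U) powr ?\<theta> \<le> 1 + 2 * U" using U by simp
      qed (use Mt M t in auto)
      also have "\<dots> \<le> (M / t) * (real k * (U / 2))"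
        using k(2) M t U by (intro mult_left_mono) (auto simp: field_simps)
      also have "\<dots> = real k * (M / t * (U / 2))" by simp
      also have "\<dots> \<le> real k * norm (cgrad F z)" using g by (intro mult_left_mono) auto
      finally show ?thesis using elim(1) by (simp add: Loj_def)
    qed
  qed
  then show ?thesis ..
qed

lemma norm_cgrad_compose:
  assumes "\<And>i. cdiff (\<lambda>z. \<phi> z $ i) z" "cdiff F (\<phi> z)"
  shows "norm (cgrad (\<lambda>z. F (\<phi> z)) z) \<le>
    norm (cgrad F (\<phi> z)) * (\<Sum>k\<in>UNIV. \<Sum>i\<in>UNIV. norm (cgrad (\<lambda>z. \<phi> z $ i) z $ k))"
proof -
  let ?g = "\<lambda>i k. cgrad (\<lambda>z. \<phi> z $ i) z $ k"
  have "norm (cgrad (\<lambda>z. F (\<phi> z)) z) \<le> (\<Sum>k\<in>UNIV. norm (cgrad (\<lambda>z. F (\<phi> z)) z $ k))"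
    unfolding norm_vec_def by (rule L2_set_le_sum) simp
  also have "\<dots> = (\<Sum>k\<in>UNIV. norm (\<Sum>i\<in>UNIV. cgrad F (\<phi> z) $ i * ?g i k))"
    by (simp add: has_derivative_cgrad[OF cdiff_compose_grad[OF assms]])
  also have "\<dots> \<le> (\<Sum>k\<in>UNIV. \<Sum>i\<in>UNIV. norm (cgrad F (\<phi> z)) * norm (?g i k))"
    by (intro sum_mono order.trans[OF norm_sum])
      (auto simp: norm_mult intro!: mult_right_mono Finite_Cartesian_Product.norm_nth_le)
  finally show ?thesis by (simp add: sum_distrib_left)
qed

text \<open>By the chain rule the gradient of the pullback is at most \<open>M\<close> times that of
  \<open>F\<close>, where \<open>M\<close> bounds the derivative of \<open>\<phi>\<close> near
  \<open>q\<close>. So the inequality for the pullback passes down with constant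
  \<open>k * M\<close>; the additional \<open>k\<close> keeps the new parameter above the old one in
  the exponent.\<close>

lemma Loj_pushforward:
  fixes \<phi> :: "complex ^ 'd \<Rightarrow> complex ^ 'd"
  assumes \<phi>: "vholo \<phi> q" and F: "holo F (\<phi> q)" and "ev (Loj k (\<lambda>z. F (\<phi> (q + z))))"
  shows "\<exists>k'. \<forall>\<^sub>F w in nhds q. Loj k' F (\<phi> w)"
proof -
  let ?D = "\<lambda>w. \<Sum>k\<in>UNIV. \<Sum>i\<in>UNIV. norm (cgrad (\<lambda>z. \<phi> z $ i) w $ k)"
  obtain M :: nat where M: "?D q < real M" using reals_Archimedean2 by blast
  have "(?D \<longlongrightarrow> ?D q) (nhds q)"
    by (intro tendsto_sum tendsto_norm holo_tendsto holo_cgrad) (use \<phi> in \<open>auto simp: vholo_def\<close>)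
  then have 1: "\<forall>\<^sub>F w in nhds q. ?D w < real M"
    using M by (rule order_tendstoD)
  have 2: "\<forall>\<^sub>F w in nhds q. \<forall>i. cdiff (\<lambda>z. \<phi> z $ i) w"
    using \<phi> by (auto simp: vholo_def holo_def eventually_all_finite)
  have 3: "\<forall>\<^sub>F w in nhds q. cdiff F (\<phi> w)"
    using vholo_tendsto[OF \<phi>] F unfolding holo_def filterlim_iff by blast
  have "((\<lambda>w. w - q) \<longlongrightarrow> q - q) (nhds q)"
    by (intro tendsto_diff tendsto_const filterlim_ident)
  then have "\<forall>\<^sub>F w in nhds q. Loj k (\<lambda>z. F (\<phi> (q + z))) (w - q)"
    using assms(3) unfolding filterlim_iff by simp
  then have "\<forall>\<^sub>F w in nhds q. Loj (k * M + k) F (\<phi> w)"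
    using 1 2 3
  proof eventually_elim
    case (elim w)
    have shift: "cgrad (\<lambda>z. F (\<phi> (q + z))) (w - q) = cgrad (\<lambda>z. F (\<phi> z)) w"
      by (simp add: cgrad_def add.assoc[symmetric])
    let ?N = "norm (F (\<phi> w))"
    have N1: "?N \<le> 1" using elim(1) by (simp add: Loj_def)
    have "?N powr (1 - 1 / (real (k * M + k) + 2)) \<le> ?N powr (1 - 1 / (real k + 2))"
      using N1 by (intro powr_mono') (auto intro!: divide_left_mono mult_pos_pos add_nonneg_pos)
    also have "\<dots> \<le> real k * norm (cgrad (\<lambda>z. F (\<phi> z)) w)"
      using elim(1) by (simp add: Loj_def shift)
    also have "\<dots> \<le> real k * (norm (cgrad F (\<phi> w)) * real M)"
      using norm_cgrad_compose[of \<phi> w F] elim(2-4)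
      by (intro mult_left_mono order.trans[OF norm_cgrad_compose[of \<phi> w F]]) auto
    also have "\<dots> \<le> real (k * M + k) * norm (cgrad F (\<phi> w))"
      by (simp add: algebra_simps)
    finally show ?case using N1 by (simp add: Loj_def)
  qed
  then show ?thesis ..
qed

text \<open>If no constant worked, there would be points \<open>q k\<close> of \<open>K\<close> with
  images tending to the origin at which the constant \<open>k\<close> fails. A limit point
  \<open>p\<close> of them lies over the origin, and near \<open>p\<close> a fixed constant holds, a
  contradiction once \<open>k\<close> exceeds it.\<close>

lemma chart_Loj:
  assumes K: "chart S \<phi> K" and F: "holo F 0"
    and Loj: "\<And>q. q \<in> K \<Longrightarrow> \<phi> q = 0 \<Longrightarrow> \<exists>k. ev (Loj k (\<lambda>z. F (\<phi> (q + z))))"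
  shows "\<exists>k. ev (\<lambda>x. x \<in> \<phi> ` K \<longrightarrow> Loj k F x)"
proof (rule ccontr)
  assume neg: "\<not> ?thesis"
  have "\<exists>q\<in>K. norm (\<phi> q) < 1 / (real k + 1) \<and> \<not> Loj k F (\<phi> q)" for k
  proof -
    have "\<not> ev (\<lambda>x. x \<in> \<phi> ` K \<longrightarrow> Loj k F x)" using neg by blast
    moreover have "(0::real) < 1 / (real k + 1)" by simp
    ultimately have "\<not> (\<forall>x. dist x 0 < 1 / (real k + 1) \<longrightarrow> x \<in> \<phi> ` K \<longrightarrow> Loj k F x)"
      unfolding eventually_nhds_metric by blast
    then show ?thesis by (simp only: dist_norm diff_0_right) blast
  qed
  then obtain q where q: "\<And>k. q k \<in> K" "\<And>k. norm (\<phi> (q k)) < 1 / (real k + 1)" "\<And>k. \<not> Loj k F (\<phi> (q k))"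
    by metis
  obtain p r where p: "p \<in> K" "strict_mono r" "(q \<circ> r) \<longlonglongrightarrow> p"
    using K q(1) unfolding chart_def compact_def by blast
  have "(\<lambda>k. \<phi> (q (r k))) \<longlonglongrightarrow> \<phi> p"
    using K p(1,3) q(1) unfolding chart_def continuous_on_sequentially by (auto simp: o_def)
  moreover have "(\<lambda>k. \<phi> (q (r k))) \<longlonglongrightarrow> 0"
  proof (rule Lim_null_comparison)
    show "(\<lambda>k. 1 / (real k + 1)) \<longlonglongrightarrow> 0"
      using LIMSEQ_Suc[OF lim_1_over_n[where 'a=real]] by (simp add: add.commute)
    show "\<forall>\<^sub>F k in sequentially. norm (\<phi> (q (r k))) \<le> 1 / (real k + 1)"
    proof (rule always_eventually, rule allI)
      fix k
      have "norm (\<phi> (q (r k))) \<le> 1 / (real (r k) + 1)" using q(2) less_imp_le by blast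
      also have "\<dots> \<le> 1 / (real k + 1)"
        using seq_suble[OF p(2), of k] by (intro divide_left_mono) auto
      finally show "norm (\<phi> (q (r k))) \<le> 1 / (real k + 1)" .
    qed
  qed
  ultimately have p0: "\<phi> p = 0" by (rule LIMSEQ_unique)
  obtain k where "ev (Loj k (\<lambda>z. F (\<phi> (p + z))))" using Loj p(1) p0 by blast
  then obtain k' where "\<forall>\<^sub>F w in nhds p. Loj k' F (\<phi> w)"
    using Loj_pushforward[of \<phi> p F k] K F p(1) p0 unfolding chart_def by auto
  then have "\<forall>\<^sub>F n in sequentially. Loj k' F (\<phi> (q (r n)))"
    using p(3) unfolding filterlim_iff o_def by blast
  moreover have "\<forall>\<^sub>F n in sequentially. k' \<le> n" by (rule eventually_ge_at_top)
  ultimately have "\<forall>\<^sub>F n in sequentially. False"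
  proof eventually_elim
    case (elim n)
    then have "Loj (r n) F (\<phi> (q (r n)))"
      using Loj_mono seq_suble[OF p(2), of n] le_trans by blast
    with q(3) show False by blast
  qed
  then show False by simp
qed

lemma resolvable_Loj:
  fixes S :: "'d::finite set"
  assumes "resolvable S F" "holo F 0" "F 0 = 0"
  shows "\<exists>k. ev (Loj k F)"
  using assms
proof (induction rule: resolvable.induct)
  case (MU F)
  then show ?case by (intro MU_Loj)
next
  case (cover \<Phi> F)
  have "\<forall>c\<in>\<Phi>. \<exists>k. ev (\<lambda>x. x \<in> fst c ` snd c \<longrightarrow> Loj k F x)"
  proof
    fix c assume c: "c \<in> \<Phi>"
    obtain \<phi> K where [simp]: "c = (\<phi>, K)" by (cases c)
    have "\<exists>k. ev (\<lambda>x. x \<in> \<phi> ` K \<longrightarrow> Loj k F x)"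
    proof (rule chart_Loj[OF _ cover.prems(1)])
      show ch: "chart S \<phi> K" using cover c by simp
      fix q assume q: "q \<in> K" "\<phi> q = 0"
      have \<phi>: "vholo \<phi> q" using ch q by (simp add: chart_def)
      have "vholo (\<lambda>z. q + z) 0" by (simp add: vholo_def holo_add)
      moreover have "holo (\<lambda>z. F (\<phi> z)) q"
        using holo_compose[OF \<phi>, of F] q cover.prems by simp
      ultimately have "holo (\<lambda>z. F (\<phi> (q + z))) 0"
        using holo_compose[of "\<lambda>z. q + z" 0 "\<lambda>z. F (\<phi> z)"] by simp
      then show "\<exists>k. ev (Loj k (\<lambda>z. F (\<phi> (q + z))))"
        using cover.IH[of \<phi> K q] c q cover.prems by simp
    qed
    then show "\<exists>k. ev (\<lambda>x. x \<in> fst c ` snd c \<longrightarrow> Loj k F x)" by simp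
  qed
  then obtain k where k: "\<And>c. c \<in> \<Phi> \<Longrightarrow> ev (\<lambda>x. x \<in> fst c ` snd c \<longrightarrow> Loj (k c) F x)"
    by metis
  then have "ev (\<lambda>x. \<forall>c\<in>\<Phi>. x \<in> fst c ` snd c \<longrightarrow> Loj (k c) F x)"
    by (intro eventually_ball_finite cover.hyps(1) ballI)
  with cover.hyps(3) have "ev (Loj (\<Sum>c\<in>\<Phi>. k c) F)"
  proof eventually_elim
    case (elim x)
    from elim(1) obtain c where "c \<in> \<Phi>" "case c of (\<phi>, K) \<Rightarrow> x \<in> \<phi> ` K" by (rule bexE)
    then obtain \<phi> K where c: "(\<phi>, K) \<in> \<Phi>" "x \<in> \<phi> ` K" by (cases c) simp
    have "Loj (k (\<phi>, K)) F x"
      using bspec[OF elim(2) c(1)] c(2) by simp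
    then show ?case
      by (rule Loj_mono) (rule member_le_sum[OF c(1) _ cover.hyps(1)], simp)
  qed
  then show ?case ..
qed

section \<open>Germs in some of the variables\<close>

lemma dep_const [intro, simp]: "dep S (\<lambda>_. c)"
  by (simp add: dep_def)

lemma dep_nth [intro]: "i \<in> S \<Longrightarrow> dep S (\<lambda>z. z $ i)"
  by (simp add: dep_def)

lemma dep_add [intro]: "dep S F \<Longrightarrow> dep S G \<Longrightarrow> dep S (\<lambda>z. F z + G z)"
  unfolding dep_def by metis

lemma dep_diff [intro]: "dep S F \<Longrightarrow> dep S G \<Longrightarrow> dep S (\<lambda>z. F z - G z)"
  unfolding dep_def by metis

lemma dep_mult [intro]: "dep S F \<Longrightarrow> dep S G \<Longrightarrow> dep S (\<lambda>z. F z * G z)"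
  unfolding dep_def by metis

lemma dep_power [intro]: "dep S F \<Longrightarrow> dep S (\<lambda>z. F z ^ n)"
  unfolding dep_def by metis

lemma dep_sum [intro]: "(\<And>i. i \<in> I \<Longrightarrow> dep S (F i)) \<Longrightarrow> dep S (\<lambda>z. \<Sum>i\<in>I. F i z)"
  by (induction I rule: infinite_finite_induct) auto

lemma dep_prod [intro]: "(\<And>i. i \<in> I \<Longrightarrow> dep S (F i)) \<Longrightarrow> dep S (\<lambda>z. \<Prod>i\<in>I. F i z)"
  by (induction I rule: infinite_finite_induct) auto

lemma dep_mono: "dep S F \<Longrightarrow> S \<subseteq> T \<Longrightarrow> dep T F"
  unfolding dep_def by blast

lemma dep_mon [intro]: "dep S (mon S a)"
  unfolding mon_def[abs_def] by (intro dep_prod dep_power dep_nth)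

lemma dep_eq: "dep S F \<Longrightarrow> (\<And>i. i \<in> S \<Longrightarrow> z $ i = w $ i) \<Longrightarrow> F z = F w"
  unfolding dep_def by blast

lemma dep_compose:
  fixes F :: "complex ^ 'd \<Rightarrow> complex" and \<phi> :: "complex ^ 'd \<Rightarrow> complex ^ 'd"
  assumes "dep S F" "\<And>i. i \<in> S \<Longrightarrow> dep T (\<lambda>z. \<phi> z $ i)"
  shows "dep T (\<lambda>z. F (\<phi> z))"
  unfolding dep_def
proof (intro allI impI)
  fix z w :: "complex ^ 'd" assume eq: "\<forall>i\<in>T. z $ i = w $ i"
  show "F (\<phi> z) = F (\<phi> w)"
    by (rule dep_eq[OF assms(1)]) (use assms(2) eq in \<open>simp add: dep_def\<close>)
qed

lemma dep_shift: "dep S F \<Longrightarrow> dep S (\<lambda>z. F (q + z))"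
  by (rule dep_compose[of S F S "\<lambda>z. q + z"]) (auto simp: dep_def)

definition proj :: "'d set \<Rightarrow> complex ^ 'd \<Rightarrow> complex ^ 'd" where
  "proj S z = (\<chi> i. if i \<in> S then z $ i else 0)"

lemma proj_nth: "proj S z $ i = (if i \<in> S then z $ i else 0)"
  by (simp add: proj_def)

lemma proj_0 [simp]: "proj S 0 = 0"
  by (simp add: proj_def vec_eq_iff)

lemma vholo_proj [intro, simp]: "vholo (proj S) p"
  unfolding vholo_def proj_def
proof
  fix i show "holo (\<lambda>z. (\<chi> i. if i \<in> S then z $ i else 0) $ i) p"
    by (cases "i \<in> S") auto
qed

lemma dep_proj [intro]: "dep S (\<lambda>z. F (proj S z))"
  unfolding dep_def
proof (intro allI impI)
  fix z w :: "complex ^ 'a" assume "\<forall>i\<in>S. z $ i = w $ i"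
  then have "proj S z = proj S w" by (simp add: proj_def vec_eq_iff)
  then show "F (proj S z) = F (proj S w)" by simp
qed

lemma dep_projD: "dep S F \<Longrightarrow> F (proj S z) = F z"
  by (rule dep_eq) (auto simp: proj_nth)

lemma holo_proj: "holo F 0 \<Longrightarrow> holo (\<lambda>z. F (proj S z)) 0"
  by (rule holo_compose) auto

lemma ev_proj: "ev P \<Longrightarrow> ev (\<lambda>z. P (proj S z))"
  by (rule ev_compose) auto

section \<open>Regular germs in a distinguished variable\<close>

lemma hdiv:
  fixes G :: "complex ^ 'd \<Rightarrow> complex"
  assumes n: "n \<notin> S" and G: "holo G 0" "dep (insert n S) G"
  shows "\<exists>c H. holo c 0 \<and> dep S c \<and> holo H 0 \<and> dep (insert n S) H \<and>
    ev (\<lambda>z. G z = c z + z $ n * H z)"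
proof (intro exI conjI)
  show "holo (\<lambda>z. G (proj S z)) 0" "dep S (\<lambda>z. G (proj S z))"
    using G holo_proj dep_proj by blast+
  show "holo (\<lambda>z. hquot n G (proj (insert n S) z)) 0"
    by (rule holo_proj) (rule hquot(1)[OF G(1)])
  show "dep (insert n S) (\<lambda>z. hquot n G (proj (insert n S) z))"
    by (rule dep_proj)
  have zap: "zap n (proj (insert n S) z) = proj S z" for z
    using n by (auto simp: zap_def proj_def vec_eq_iff)
  show "ev (\<lambda>z. G z = G (proj S z) + z $ n * hquot n G (proj (insert n S) z))"
    using ev_proj[OF hquot(2)[OF G(1), of n], of "insert n S"]
    by eventually_elim (simp add: zap dep_projD[OF G(2)] proj_nth)
qed

lemma taylor:
  fixes G :: "complex ^ 'd \<Rightarrow> complex"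
  assumes n: "n \<notin> S" and G: "holo G 0" "dep (insert n S) G"
  shows "\<exists>c u. (\<forall>i<d. holo (c i) 0 \<and> dep S (c i)) \<and> holo u 0 \<and> dep (insert n S) u \<and>
    ev (\<lambda>z. G z = (\<Sum>i<d. c i z * z $ n ^ i) + z $ n ^ d * u z)"
proof (induction d)
  case 0
  show ?case by (intro exI[of _ "\<lambda>_ _. 0"] exI[of _ G]) (use G in auto)
next
  case (Suc d)
  then obtain c u where c: "\<And>i. i < d \<Longrightarrow> holo (c i) 0 \<and> dep S (c i)"
    and u: "holo u 0" "dep (insert n S) u"
    and eq: "ev (\<lambda>z. G z = (\<Sum>i<d. c i z * z $ n ^ i) + z $ n ^ d * u z)"
    by blast
  obtain b H where b: "holo b 0" "dep S b" and H: "holo H 0" "dep (insert n S) H"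
    and u_eq: "ev (\<lambda>z. u z = b z + z $ n * H z)"
    using hdiv[OF n u] by blast
  have "ev (\<lambda>z. G z = (\<Sum>i<Suc d. (c(d := b)) i z * z $ n ^ i) + z $ n ^ Suc d * H z)"
    using eq u_eq
  proof eventually_elim
    case (elim z)
    have "(\<Sum>i<d. (c(d := b)) i z * z $ n ^ i) = (\<Sum>i<d. c i z * z $ n ^ i)"
      by (rule sum.cong) auto
    with elim show ?case by (simp add: algebra_simps)
  qed
  moreover have "\<forall>i<Suc d. holo ((c(d := b)) i) 0 \<and> dep S ((c(d := b)) i)"
    using c b by (auto simp: less_Suc_eq)
  ultimately show ?case using H by blast
qed

text \<open>Order exactly \<open>d\<close> in \<open>z $ n\<close>; unlike in the Weierstrass preparation theorem the leading
  coefficient \<open>u\<close> may depend on \<open>z $ n\<close>, so that Taylor's formula suffices.\<close>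

definition Reg :: "'d \<Rightarrow> 'd set \<Rightarrow> nat \<Rightarrow> (complex ^ 'd \<Rightarrow> complex) \<Rightarrow> bool" where
  "Reg n S d G \<longleftrightarrow> (\<exists>c u. (\<forall>i<d. holo (c i) 0 \<and> dep S (c i) \<and> c i 0 = 0) \<and>
     holo u 0 \<and> dep (insert n S) u \<and> u 0 \<noteq> 0 \<and>
     ev (\<lambda>z. G z = (\<Sum>i<d. c i z * z $ n ^ i) + z $ n ^ d * u z))"

text \<open>Multiplying by \<open>s ^ (d - i)\<close> turns the finite limit into 0; as the
  coefficients below \<open>i\<close> vanish by induction, what remains tends to
  \<open>a i\<close>.\<close>

lemma poly_small_coeffs:
  fixes a :: "nat \<Rightarrow> complex"
  assumes "((\<lambda>s. (\<Sum>i<d. a i * s ^ i) / s ^ d) \<longlongrightarrow> L) (at 0)" "i < d"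
  shows "a i = 0"
  using assms(2)
proof (induction i rule: less_induct)
  case (less i)
  have z: "(0::complex) ^ (d - i) = 0" using less.prems by simp
  have "((\<lambda>s. (\<Sum>j<d. a j * s ^ j) / s ^ d * s ^ (d - i)) \<longlongrightarrow> L * 0 ^ (d - i)) (at 0)"
    by (intro tendsto_intros assms(1))
  then have "((\<lambda>s. (\<Sum>j<d. a j * s ^ j) / s ^ d * s ^ (d - i)) \<longlongrightarrow> 0) (at 0)"
    by (simp only: z mult_zero_right)
  moreover have "\<forall>\<^sub>F s in at (0::complex). (\<Sum>j<d. a j * s ^ j) / s ^ d * s ^ (d - i) =
      (\<Sum>j\<in>{i..<d}. a j * s ^ (j - i))"
    using eventually_neq_at_within[of 0]
  proof eventually_elim
    case (elim s)
    have "(\<Sum>j<d. a j * s ^ j) = (\<Sum>j\<in>{i..<d}. a j * s ^ j)"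
      by (rule sum.mono_neutral_right) (use less in auto)
    also have "\<dots> = (\<Sum>j\<in>{i..<d}. a j * s ^ (j - i)) * s ^ i"
      by (simp add: sum_distrib_right mult.assoc flip: power_add)
    finally have "(\<Sum>j<d. a j * s ^ j) / s ^ d * s ^ (d - i) =
       (\<Sum>j\<in>{i..<d}. a j * s ^ (j - i)) * (s ^ i * s ^ (d - i)) / s ^ d" by simp
    also have "s ^ i * s ^ (d - i) = s ^ d"
      using less.prems by (simp flip: power_add)
    finally show ?case using elim by simp
  qed
  ultimately have "((\<lambda>s. \<Sum>j\<in>{i..<d}. a j * s ^ (j - i)) \<longlongrightarrow> 0) (at 0)"
    by (rule Lim_transform_eventually)
  moreover have "((\<lambda>s. \<Sum>j\<in>{i..<d}. a j * s ^ (j - i)) \<longlongrightarrow> (\<Sum>j\<in>{i..<d}. a j * 0 ^ (j - i))) (at 0)"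
    by (intro tendsto_intros)
  ultimately have "(\<Sum>j\<in>{i..<d}. a j * 0 ^ (j - i)) = 0"
    by (intro tendsto_unique[OF at_neq_bot])
  moreover have "(\<Sum>j\<in>{i..<d}. a j * 0 ^ (j - i)) = (\<Sum>j\<in>{i..<d}. if j = i then a i else 0)"
    by (rule sum.cong) auto
  ultimately show ?case using less.prems by simp
qed

lemma axis_tendsto: "((\<lambda>s::complex. axis n s) \<longlongrightarrow> 0) (at 0)"
  using bounded_linear.tendsto[OF bounded_linear_axis[of n] tendsto_ident_at[of 0 UNIV]]
  by (simp add: axis_zero)

text \<open>Regularity can be read off on the \<open>n\<close>-axis. There the Taylor coefficients
  are constant, as they do not see \<open>z $ n\<close>, so the lower part is a polynomial whose
  quotient by \<open>s ^ d\<close> has a finite limit. This forces \<open>c i 0 = 0\<close> and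
  \<open>u 0 = L\<close>.\<close>

lemma Reg_axis:
  fixes G :: "complex ^ 'd \<Rightarrow> complex"
  assumes n: "n \<notin> S" and G: "holo G 0" "dep (insert n S) G"
    and lim: "((\<lambda>s. G (axis n s) / s ^ d) \<longlongrightarrow> L) (at 0)" and "L \<noteq> 0"
  shows "Reg n S d G"
proof -
  obtain c u where c: "\<And>i. i < d \<Longrightarrow> holo (c i) 0 \<and> dep S (c i)"
    and u: "holo u 0" "dep (insert n S) u"
    and eq: "ev (\<lambda>z. G z = (\<Sum>i<d. c i z * z $ n ^ i) + z $ n ^ d * u z)"
    using taylor[OF n G, of d] by blast
  have "\<forall>\<^sub>F s in at 0. G (axis n s) = (\<Sum>i<d. c i (axis n s) * axis n s $ n ^ i) + axis n s $ n ^ d * u (axis n s)"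
    using axis_tendsto[of n] eq unfolding filterlim_iff by blast
  then have eq': "\<forall>\<^sub>F s in at 0. G (axis n s) / s ^ d - u (axis n s) = (\<Sum>i<d. c i 0 * s ^ i) / s ^ d"
    using eventually_neq_at_within[of 0]
  proof eventually_elim
    case (elim s)
    have "(\<Sum>i<d. c i (axis n s) * axis n s $ n ^ i) = (\<Sum>i<d. c i 0 * s ^ i)"
    proof (rule sum.cong)
      fix i assume "i \<in> {..<d}"
      then have "c i (axis n s) = c i 0"
        using c n by (intro dep_eq[of S "c i"]) (auto simp: axis_def)
      then show "c i (axis n s) * axis n s $ n ^ i = c i 0 * s ^ i" by simp
    qed simp
    with elim show ?case by (simp add: field_simps)
  qed
  have "((\<lambda>s. u (axis n s)) \<longlongrightarrow> u 0) (at 0)"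
    using filterlim_compose[OF holo_tendsto[OF u(1)] axis_tendsto[of n]] .
  from tendsto_diff[OF lim this]
  have lim': "((\<lambda>s. (\<Sum>i<d. c i 0 * s ^ i) / s ^ d) \<longlongrightarrow> L - u 0) (at 0)"
    using eq' by (rule Lim_transform_eventually)
  then have c0: "c i 0 = 0" if "i < d" for i
    by (rule poly_small_coeffs[where a="\<lambda>i. c i 0"]) (rule that)
  then have "(\<lambda>s. (\<Sum>i<d. c i 0 * s ^ i) / s ^ d) = (\<lambda>s. 0)"
    by simp
  with lim' have "L - u 0 = 0"
    using tendsto_unique[OF at_neq_bot, of "\<lambda>_. 0" "L - u 0" "0::complex" 0] by simp
  then have "u 0 \<noteq> 0" using \<open>L \<noteq> 0\<close> by simp
  then show ?thesis
    unfolding Reg_def using c c0 u eq by blast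
qed

section \<open>Elimination of the subleading coefficient\<close>

definition pd :: "'d \<Rightarrow> (complex ^ 'd \<Rightarrow> complex) \<Rightarrow> complex ^ 'd \<Rightarrow> complex" where
  "pd n F z = cgrad F z $ n"

lemma holo_pd [intro]: "holo F p \<Longrightarrow> holo (pd n F) p"
  unfolding pd_def[abs_def] by (rule holo_cgrad)

lemma pd_cong: "ev (\<lambda>z. F z = G z) \<Longrightarrow> ev (\<lambda>z. pd n F z = pd n G z)"
proof -
  assume "ev (\<lambda>z. F z = G z)"
  then have "ev (\<lambda>z. \<forall>\<^sub>F w in nhds z. F w = G w)"
    by (simp add: eventually_eventually)
  then show ?thesis
    by eventually_elim (metis pd_def cgrad_cong)
qed

lemma holo_pd_power: "holo F p \<Longrightarrow> holo ((pd n ^^ k) F) p"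
  by (induction k) (auto simp del: funpow.simps simp: funpow.simps(1) funpow.simps(2))

lemma cdiff_axis: "cdiff F z \<Longrightarrow> ((\<lambda>s. F (z + axis n s)) has_field_derivative pd n F z) (at 0)"
  unfolding pd_def by (rule has_derivative_cdot_axis) (simp add: axis_zero cdiffD)

lemma pd_expansion_step:
  assumes n: "n \<notin> S" and c: "\<And>i. i \<le> Suc k \<Longrightarrow> dep S (c i)" and u: "cdiff u z"
  shows "pd n (\<lambda>z. (\<Sum>i\<le>Suc k. c i z * z $ n ^ i) + z $ n ^ (k + 2) * u z) z =
    (\<Sum>i\<le>k. (of_nat (Suc i) * c (Suc i) z) * z $ n ^ i) +
      z $ n ^ (k + 1) * (of_nat (k + 2) * u z + z $ n * pd n u z)"
proof -
  have "(\<lambda>s. (\<Sum>i\<le>Suc k. c i (z + axis n s) * (z + axis n s) $ n ^ i) + (z + axis n s) $ n ^ (k + 2) * u (z + axis n s))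
     = (\<lambda>s. (\<Sum>i\<le>Suc k. c i z * (z $ n + s) ^ i) + (z $ n + s) ^ (k + 2) * u (z + axis n s))"
  proof
    fix s
    have "c i (z + axis n s) = c i z" if "i \<le> Suc k" for i
      by (rule dep_eq[OF c[OF that]]) (use n in \<open>auto simp: axis_def\<close>)
    then show "(\<Sum>i\<le>Suc k. c i (z + axis n s) * (z + axis n s) $ n ^ i) + (z + axis n s) $ n ^ (k + 2) * u (z + axis n s)
     = (\<Sum>i\<le>Suc k. c i z * (z $ n + s) ^ i) + (z $ n + s) ^ (k + 2) * u (z + axis n s)"
      by (simp add: algebra_simps)
  qed
  moreover have pow: "((\<lambda>s. (z $ n + s) ^ i) has_field_derivative of_nat i * z $ n ^ (i - 1)) (at 0)" for i
    by (auto intro!: derivative_eq_intros)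
  have "((\<lambda>s. (z $ n + s) ^ (k + 2) * u (z + axis n s)) has_field_derivative
       (of_nat (k + 2) * z $ n ^ (k + 1) * u z + z $ n ^ (k + 2) * pd n u z)) (at 0)"
    using DERIV_mult[OF pow[of "k + 2"] cdiff_axis[OF u, of n]]
    by (simp add: axis_zero algebra_simps)
  then have "((\<lambda>s. (\<Sum>i\<le>Suc k. c i z * (z $ n + s) ^ i) + (z $ n + s) ^ (k + 2) * u (z + axis n s))
     has_field_derivative
       (\<Sum>i\<le>Suc k. c i z * (of_nat i * z $ n ^ (i - 1))) +
       (of_nat (k + 2) * z $ n ^ (k + 1) * u z + z $ n ^ (k + 2) * pd n u z)) (at 0)"
    by (intro DERIV_add DERIV_sum DERIV_cmult pow)
  ultimately have "pd n (\<lambda>z. (\<Sum>i\<le>Suc k. c i z * z $ n ^ i) + z $ n ^ (k + 2) * u z) z =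
     (\<Sum>i\<le>Suc k. c i z * (of_nat i * z $ n ^ (i - 1))) +
       (of_nat (k + 2) * z $ n ^ (k + 1) * u z + z $ n ^ (k + 2) * pd n u z)"
    by (simp add: pd_def cgrad_def DERIV_imp_deriv)
  also have "(\<Sum>i\<le>Suc k. c i z * (of_nat i * z $ n ^ (i - 1))) =
     (\<Sum>i\<le>k. (of_nat (Suc i) * c (Suc i) z) * z $ n ^ i)"
    by (subst sum.atMost_Suc_shift) (simp add: mult_ac)
  finally show ?thesis by (simp add: algebra_simps)
qed

text \<open>After \<open>k\<close> differentiations the terms below degree \<open>k\<close> are
  gone, and modulo \<open>z $ n\<close> only \<open>c k\<close> is left. The value of
  \<open>v 0\<close> shows that one more derivative at the origin recovers the leading
  coefficient.\<close>

lemma pd_power_expansion: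
  fixes u :: "complex ^ 'd \<Rightarrow> complex"
  assumes n: "n \<notin> S" and "\<And>i. i \<le> k \<Longrightarrow> dep S (c i)" "holo u 0"
    and "ev (\<lambda>z. G z = (\<Sum>i\<le>k. c i z * z $ n ^ i) + z $ n ^ (k + 1) * u z)"
  shows "\<exists>v. holo v 0 \<and> v 0 = fact (k + 1) * u 0 \<and>
     ev (\<lambda>z. (pd n ^^ k) G z = fact k * c k z + z $ n * v z)"
  using assms(2-)
proof (induction k arbitrary: G c u)
  case 0
  then show ?case by (intro exI[of _ u]) auto
next
  case (Suc k)
  define c' where "c' i z = of_nat (Suc i) * c (Suc i) z" for i z
  define u' where "u' z = of_nat (k + 2) * u z + z $ n * pd n u z" for z
  have "ev (\<lambda>z. pd n G z = (\<Sum>i\<le>k. c' i z * z $ n ^ i) + z $ n ^ (k + 1) * u' z)"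
    using pd_cong[OF Suc.prems(3), of n] Suc.prems(2)[unfolded holo_def]
  proof eventually_elim
    case (elim z)
    then show ?case
      using pd_expansion_step[OF n Suc.prems(1) elim(2)] unfolding c'_def u'_def by simp
  qed
  moreover have "dep S (c' i)" if "i \<le> k" for i
    unfolding c'_def[abs_def] using that Suc.prems(1) by (intro dep_mult) auto
  moreover have "holo u' 0"
    unfolding u'_def[abs_def] using Suc.prems(2) by (intro holo_add holo_mult holo_pd holo_const holo_nth)
  ultimately obtain v where v: "holo v 0" "v 0 = fact (k + 1) * u' 0"
    "ev (\<lambda>z. (pd n ^^ k) (pd n G) z = fact k * c' k z + z $ n * v z)"
    using Suc.IH[of c' u' "pd n G"] by blast
  have "fact k * c' k z = fact (Suc k) * c (Suc k) z" for z
    by (simp add: c'_def algebra_simps)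
  then have "ev (\<lambda>z. (pd n ^^ Suc k) G z = fact (Suc k) * c (Suc k) z + z $ n * v z)"
    using v(3) by (simp only: funpow_Suc_right o_apply)
  moreover have "v 0 = fact (Suc k + 1) * u 0"
    using v(2) by (simp add: u'_def algebra_simps)
  ultimately show ?case
    using v(1) by (intro exI[of _ v]) simp
qed

lemma complex_linear_cdot:
  fixes L :: "complex ^ 'd \<Rightarrow> complex"
  assumes "linear L" "\<And>c h. L (c *s h) = c * L h"
  shows "L h = cdot (\<chi> i. L (axis i 1)) h"
proof -
  have "L h = L (\<Sum>i\<in>UNIV. h $ i *s axis i 1)" by (simp add: basis_expansion)
  also have "\<dots> = (\<Sum>i\<in>UNIV. L (h $ i *s axis i 1))" by (rule linear_sum[OF assms(1)])
  finally show ?thesis by (simp add: assms(2) cdot_def mult.commute)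
qed

lemma cdot_smult: "cdot D (c *s h) = c * cdot D h"
  by (simp add: cdot_def sum_distrib_left mult_ac)

text \<open>The map \<open>T\<close> replaces the \<open>n\<close>-th coordinate by \<open>K\<close>
  and has invertible derivative at the origin. \<open>\<psi>\<close> is the \<open>n\<close>-th
  coordinate of its inverse at \<open>proj S z\<close>, that is, where \<open>K = 0\<close>. The
  inverse function theorem gives real differentiability; complex linearity follows because the
  inverse of a complex-linear bijection is complex linear.\<close>

lemma implicit_function:
  fixes K :: "complex ^ 'd \<Rightarrow> complex"
  assumes n: "n \<notin> S" and K: "holo K 0" "K 0 = 0" "pd n K 0 \<noteq> 0"
  shows "\<exists>\<psi>. holo \<psi> 0 \<and> dep S \<psi> \<and> \<psi> 0 = 0 \<and> ev (\<lambda>z. K (proj S z + axis n (\<psi> z)) = 0)"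
proof -
  obtain r where r: "r > 0" and cd: "\<And>z. z \<in> ball 0 r \<Longrightarrow> cdiff K z"
    using holo_open K(1) by blast
  define T where "T z = (\<chi> i. if i = n then K z else z $ i)" for z
  define T' where "T' z h = (\<chi> i. if i = n then cdot (cgrad K z) h else h $ i)" for z h
  have T': "(T has_derivative T' z) (at z)" if "z \<in> ball 0 r" for z
    unfolding T_def T'_def
  proof (rule has_derivative_vecI)
    fix i
    show "((\<lambda>x. (\<chi> i. if i = n then K x else x $ i) $ i) has_derivative
        (\<lambda>h. (\<chi> i. if i = n then cdot (cgrad K z) h else h $ i) $ i)) (at z)"
      using cdiffD[OF cd[OF that]]
      by (cases "i = n") (auto intro!: bounded_linear_imp_has_derivative bounded_linear_vec_nth)
  qed
  have blT': "bounded_linear (T' z)" for z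
  proof -
    have "linear (T' z)"
      by (rule linearI) (auto simp: T'_def vec_eq_iff cdot.add_right cdot.scaleR_right)
    then show ?thesis by (simp add: linear_conv_bounded_linear)
  qed
  define f' where "f' z = Blinfun (T' z)" for z
  have f': "blinfun_apply (f' z) = T' z" for z
    unfolding f'_def by (rule bounded_linear_Blinfun_apply[OF blT'])
  have contf': "continuous_on (ball 0 r) f'"
  proof (rule continuous_on_blinfun_componentwise)
    fix b :: "complex ^ 'd"
    have "continuous_on (ball 0 r) (\<lambda>z. cdot (cgrad K z) b)"
      using continuous_on_cgrad[of "ball 0 r" K] cd
      by (intro bounded_linear.continuous_on[OF cdot.bounded_linear_left]) auto
    then show "continuous_on (ball 0 r) (\<lambda>z. blinfun_apply (f' z) b)"
      unfolding f' T'_def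
      by (intro continuous_on_vec_lambda continuous_on_if_const continuous_on_const)
  qed
  define D where "D = cgrad K 0"
  have Dn: "D $ n \<noteq> 0" using K(3) by (simp add: D_def pd_def)
  \<comment> \<open>The inverse of \<open>T' 0\<close>: solve \<open>cdot D h = y\<close> for
    \<open>h $ n\<close> by subtracting the contributions of the other coordinates and dividing by
    \<open>D $ n\<close>.\<close>
  define W where "W h = (\<chi> i. if i = n then (h $ n - cdot D h + D $ n * h $ n) / D $ n else h $ i)" for h
  have "linear W"
    by (rule linearI)
      (auto simp: W_def vec_eq_iff cdot.add_right cdot.scaleR_right add_divide_distrib diff_divide_distrib
        algebra_simps scaleR_conv_of_real[where 'a=complex])
  then have blW: "bounded_linear W" by (simp add: linear_conv_bounded_linear)
  have WT: "W (T' 0 h) = h" for h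
  proof -
    have T'h: "T' 0 h = h + axis n (cdot D h - h $ n)"
      by (auto simp: T'_def vec_eq_iff D_def axis_def)
    have dot: "cdot D (T' 0 h) = cdot D h + D $ n * (cdot D h - h $ n)"
      unfolding T'h cdot.add_right by simp
    have comp: "T' 0 h $ n = cdot D h" by (simp add: T'_def D_def)
    have "W (T' 0 h) $ n = h $ n"
      unfolding W_def using Dn by (simp add: dot comp right_diff_distrib)
    have "W (T' 0 h) $ i = h $ i" if "i \<noteq> n" for i
      using that by (simp add: W_def T'_def)
    then show ?thesis using \<open>W (T' 0 h) $ n = h $ n\<close> by (metis vec_eq_iff)
  qed
  have inv: "Blinfun W o\<^sub>L f' 0 = id_blinfun"
    by (rule blinfun_eqI) (simp add: bounded_linear_Blinfun_apply[OF blW] f' WT)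
  obtain U' V g g' where U': "open U'" "U' \<subseteq> ball 0 r" "0 \<in> U'"
    and V: "open V" "T 0 \<in> V" and hom: "homeomorphism U' V T g"
    and g: "\<And>y. y \<in> V \<Longrightarrow> (g has_derivative (g' y)) (at y)"
    and g': "\<And>y. y \<in> V \<Longrightarrow> g' y = inv (blinfun_apply (f' (g y)))"
    and bij: "\<And>y. y \<in> V \<Longrightarrow> bij (blinfun_apply (f' (g y)))"
  proof (rule inverse_function_theorem[OF open_ball _ contf' _ inv, where f=T])
    show "\<And>x. x \<in> ball 0 r \<Longrightarrow> (T has_derivative blinfun_apply (f' x)) (at x)"
      using T' f' by simp
    show "0 \<in> ball (0 :: complex ^ 'd) r" using r by simp
  qed blast
  have T0: "T 0 = 0" using K(2) by (simp add: T_def vec_eq_iff)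
  have g0: "g 0 = 0" using hom U'(3) T0 unfolding homeomorphism_def by force
  have Tg: "T (g y) = y" if "y \<in> V" for y
    using hom that unfolding homeomorphism_def by blast
  have "cdiff (\<lambda>y. g y $ n) y" if y: "y \<in> V" for y
  proof -
    let ?A = "T' (g y)"
    have bijA: "bij ?A" and g'A: "g' y = inv ?A" using bij[OF y] g'[OF y] by (simp_all add: f')
    have A: "?A (c *s h) = c *s ?A h" for c h
      by (auto simp: T'_def vec_eq_iff cdot_smult)
    have homog: "g' y (c *s h) = c *s g' y h" for c h
    proof -
      have "?A (c *s g' y h) = c *s h"
        unfolding A g'A using bijA by (simp add: bij_is_surj surj_f_inv_f)
      then show ?thesis
        unfolding g'A using bijA by (metis bij_inv_eq_iff)
    qed
    have der: "((\<lambda>y. g y $ n) has_derivative (\<lambda>h. g' y h $ n)) (at y)"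
      using bounded_linear.has_derivative[OF bounded_linear_vec_nth g[OF y]] .
    have lin: "linear (\<lambda>h. g' y h $ n)"
      using has_derivative_bounded_linear[OF der] by (rule bounded_linear.linear)
    show ?thesis
      by (rule cdiffI[OF der]) (rule complex_linear_cdot[OF lin], simp add: homog)
  qed
  then have gn: "holo (\<lambda>y. g y $ n) 0"
    unfolding holo_def using V T0 eventually_nhds_in_open[of V 0] by (auto elim: eventually_mono)
  define \<psi> where "\<psi> z = g (proj S z) $ n" for z
  have "ev (\<lambda>z. proj S z \<in> V)"
    using ev_proj[OF eventually_nhds_in_open[of V 0]] V T0 by simp
  then have "ev (\<lambda>z. K (proj S z + axis n (\<psi> z)) = 0)"
  proof eventually_elim
    case (elim z)
    have Ti: "T (g (proj S z)) $ i = proj S z $ i" for i using Tg[OF elim] by simp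
    have "g (proj S z) = proj S z + axis n (\<psi> z)"
      unfolding vec_eq_iff
    proof
      fix i show "g (proj S z) $ i = (proj S z + axis n (\<psi> z)) $ i"
        using Ti[of i] n by (cases "i = n") (auto simp: T_def \<psi>_def proj_nth axis_def)
    qed
    moreover have "K (g (proj S z)) = 0"
      using Ti[of n] n by (simp add: T_def proj_nth)
    ultimately show ?case by simp
  qed
  moreover have "holo \<psi> 0" unfolding \<psi>_def[abs_def] by (rule holo_proj[OF gn])
  moreover have "dep S \<psi>" unfolding \<psi>_def[abs_def] by (rule dep_proj)
  moreover have "\<psi> 0 = 0" by (simp add: \<psi>_def g0)
  ultimately show ?thesis by blast
qed

definition shear :: "'d \<Rightarrow> (complex ^ 'd \<Rightarrow> complex) \<Rightarrow> complex ^ 'd \<Rightarrow> complex ^ 'd" where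
  "shear n \<psi> z = z + axis n (\<psi> z)"

lemma shear_nth: "shear n \<psi> z $ i = (if i = n then z $ n + \<psi> z else z $ i)"
  by (auto simp: shear_def axis_def)

lemma vholo_shear: "holo \<psi> p \<Longrightarrow> vholo (shear n \<psi>) p"
  unfolding vholo_def shear_nth
proof
  fix i assume "holo \<psi> p"
  then show "holo (\<lambda>z. if i = n then z $ n + \<psi> z else z $ i) p"
    by (cases "i = n") auto
qed

lemma dep_shear: "dep (insert n S) F \<Longrightarrow> dep S \<psi> \<Longrightarrow> dep (insert n S) (\<lambda>z. F (shear n \<psi> z))"
proof (rule dep_compose[of "insert n S" F])
  fix i assume "dep S \<psi>" "i \<in> insert n S"
  then show "dep (insert n S) (\<lambda>z. shear n \<psi> z $ i)"
    unfolding shear_nth by (cases "i = n") (auto intro: dep_mono)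
qed

text \<open>As \<open>\<psi>\<close> does not see \<open>z $ n\<close>, the shear commutes with
  translations along the \<open>n\<close>-axis and hence with derivatives in that direction.\<close>

lemma pd_shear:
  assumes "n \<notin> S" "dep S \<psi>"
  shows "(pd n ^^ k) (\<lambda>z. F (shear n \<psi> z)) = (\<lambda>z. (pd n ^^ k) F (shear n \<psi> z))"
proof (induction k)
  case (Suc k)
  have \<psi>: "\<psi> (z + axis n s) = \<psi> z" for z s
    by (rule dep_eq[OF assms(2)]) (use assms(1) in \<open>auto simp: axis_def\<close>)
  have "shear n \<psi> (z + axis n s) = shear n \<psi> z + axis n s" for z s
    by (simp add: shear_def \<psi>)
  then have "pd n (\<lambda>z. H (shear n \<psi> z)) z = pd n H (shear n \<psi> z)" for H z
    by (simp add: pd_def cgrad_def)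
  with Suc show ?case by simp
qed simp

text \<open>The Tschirnhausen transformation: the zero of the \<open>(d - 1)\<close>-st derivative is moved to
  \<open>z $ n = 0\<close>.\<close>

lemma Reg_shear:
  fixes G :: "complex ^ 'd \<Rightarrow> complex"
  assumes n: "n \<notin> S" and G: "holo G 0" "dep (insert n S) G" and Reg: "Reg n S (Suc k) G"
  shows "\<exists>\<psi> c u. holo \<psi> 0 \<and> dep S \<psi> \<and> \<psi> 0 = 0 \<and> (\<forall>i<k. holo (c i) 0 \<and> dep S (c i)) \<and>
     holo u 0 \<and> dep (insert n S) u \<and> u 0 \<noteq> 0 \<and>
     ev (\<lambda>z. G (shear n \<psi> z) = (\<Sum>i<k. c i z * z $ n ^ i) + z $ n ^ Suc k * u z)"
proof -
  obtain c u where c: "\<And>i. i < Suc k \<Longrightarrow> holo (c i) 0 \<and> dep S (c i) \<and> c i 0 = 0"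
    and u: "holo u 0" "dep (insert n S) u" "u 0 \<noteq> 0"
    and eq: "ev (\<lambda>z. G z = (\<Sum>i<Suc k. c i z * z $ n ^ i) + z $ n ^ Suc k * u z)"
    using Reg unfolding Reg_def by blast
  define K where "K = (pd n ^^ k) G"
  have K: "holo K 0" unfolding K_def by (rule holo_pd_power[OF G(1)])
  obtain v where v: "holo v 0" "v 0 = fact (k + 1) * u 0" "ev (\<lambda>z. K z = fact k * c k z + z $ n * v z)"
    using pd_power_expansion[OF n _ u(1), of k c G] c eq unfolding K_def
    by (auto simp: lessThan_Suc_atMost less_Suc_eq_le)
  have K0: "K 0 = 0"
    using eventually_nhds_x_imp_x[OF v(3)] c[of k] by simp
  \<comment> \<open>The next derivative of \<open>K\<close> at the origin is the leading coefficient
    \<open>u 0\<close> times a factorial, so \<open>K = 0\<close> can be solved for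
    \<open>z $ n\<close>.\<close>
  have "pd n K 0 \<noteq> 0"
  proof -
    have "pd n K 0 = pd n (\<lambda>z. fact k * c k z + z $ n * v z) 0"
      using pd_cong[OF v(3), of n] by (rule eventually_nhds_x_imp_x)
    also have "\<dots> = v 0"
    proof -
      have "c k (axis n s) = c k 0" for s
        by (rule dep_eq[of S "c k"]) (use c[of k] n in \<open>auto simp: axis_def\<close>)
      then have "pd n (\<lambda>z. fact k * c k z + z $ n * v z) 0 = deriv (\<lambda>s. fact k * c k 0 + s * v (axis n s)) 0"
        by (simp add: pd_def cgrad_def)
      also have "\<dots> = v 0"
      proof (rule DERIV_imp_deriv)
        have "((\<lambda>s. v (0 + axis n s)) has_field_derivative pd n v 0) (at 0)"
          by (rule cdiff_axis) (use v(1) eventually_nhds_x_imp_x in \<open>auto simp: holo_def\<close>)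
        then have "((\<lambda>s. fact k * c k 0 + s * v (axis n s)) has_field_derivative
            0 + (1 * v (axis n 0) + pd n v 0 * 0)) (at 0)"
          by (intro DERIV_add DERIV_const DERIV_mult DERIV_ident) simp
        then show "((\<lambda>s. fact k * c k 0 + s * v (axis n s)) has_field_derivative v 0) (at 0)"
          by (simp add: axis_zero)
      qed
      finally show ?thesis .
    qed
    finally have "pd n K 0 = fact (k + 1) * u 0" using v(2) by simp
    then show ?thesis using u(3) by (metis fact_nonzero mult_eq_0_iff)
  qed
  then obtain \<psi> where \<psi>: "holo \<psi> 0" "dep S \<psi>" "\<psi> 0 = 0" "ev (\<lambda>z. K (proj S z + axis n (\<psi> z)) = 0)"
    using implicit_function[OF n K K0] by blast
  let ?G = "\<lambda>z. G (shear n \<psi> z)"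
  have shear0: "shear n \<psi> 0 = 0" by (simp add: shear_def \<psi>(3) axis_zero)
  have hG: "holo ?G 0"
    by (rule holo_compose[OF vholo_shear[OF \<psi>(1)]]) (simp add: shear0 G(1))
  have dG: "dep (insert n S) ?G" by (rule dep_shear[OF G(2) \<psi>(2)])
  have "\<psi> (axis n s) = \<psi> 0" for s
    by (rule dep_eq[OF \<psi>(2)]) (use n in \<open>auto simp: axis_def\<close>)
  then have axis: "shear n \<psi> (axis n s) = axis n s" for s
    by (simp add: shear_def \<psi>(3) axis_zero)
  \<comment> \<open>The shear fixes the \<open>n\<close>-axis pointwise, as \<open>\<psi>\<close> is
    constantly \<open>\<psi> 0 = 0\<close> there; so the order of \<open>G\<close> along the axis
    survives.\<close>
  have "((\<lambda>s. G (axis n s) / s ^ Suc k) \<longlongrightarrow> u 0) (at 0)"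
  proof (rule Lim_transform_eventually)
    show "((\<lambda>s. u (axis n s)) \<longlongrightarrow> u 0) (at 0)"
      using filterlim_compose[OF holo_tendsto[OF u(1)] axis_tendsto[of n]] .
    have "\<forall>\<^sub>F s in at 0. G (axis n s) = (\<Sum>i<Suc k. c i (axis n s) * axis n s $ n ^ i) + axis n s $ n ^ Suc k * u (axis n s)"
      using axis_tendsto[of n] eq unfolding filterlim_iff by blast
    then show "\<forall>\<^sub>F s in at 0. u (axis n s) = G (axis n s) / s ^ Suc k"
      using eventually_neq_at_within[of 0]
    proof eventually_elim
      case (elim s)
      have "(\<Sum>i<Suc k. c i (axis n s) * axis n s $ n ^ i) = 0"
      proof (rule sum.neutral, rule ballI)
        fix i assume i: "i \<in> {..<Suc k}"
        then have "c i (axis n s) = c i 0"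
          using c n by (intro dep_eq[of S "c i"]) (auto simp: axis_def)
        then show "c i (axis n s) * axis n s $ n ^ i = 0" using c i by simp
      qed
      with elim show ?case by simp
    qed
  qed
  then have "Reg n S (Suc k) ?G"
    using Reg_axis[OF n hG dG, of "Suc k" "u 0"] u(3) by (simp add: axis)
  then obtain b w where b: "\<And>i. i < Suc k \<Longrightarrow> holo (b i) 0 \<and> dep S (b i) \<and> b i 0 = 0"
    and w: "holo w 0" "dep (insert n S) w" "w 0 \<noteq> 0"
    and eqb: "ev (\<lambda>z. ?G z = (\<Sum>i<Suc k. b i z * z $ n ^ i) + z $ n ^ Suc k * w z)"
    unfolding Reg_def by blast
  obtain v' where v': "holo v' 0" "ev (\<lambda>z. (pd n ^^ k) ?G z = fact k * b k z + z $ n * v' z)"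
    using pd_power_expansion[OF n _ w(1), of k b ?G] b eqb
    by (auto simp: lessThan_Suc_atMost less_Suc_eq_le)
  \<comment> \<open>At \<open>z $ n = 0\<close> the \<open>k\<close>-th derivative of the sheared
    germ is \<open>fact k * b k\<close>, but also the value of \<open>K\<close> on its zero
    set.\<close>
  have bk: "ev (\<lambda>z. b k z = 0)"
    using ev_proj[OF v'(2), of S] \<psi>(4)
  proof eventually_elim
    case (elim z)
    have "shear n \<psi> (proj S z) = proj S z + axis n (\<psi> z)"
      by (simp add: shear_def dep_projD[OF \<psi>(2)])
    then have "fact k * b k (proj S z) = 0"
      using elim n by (simp add: pd_shear[OF n \<psi>(2)] K_def proj_nth)
    then show ?case
      using b[of k] dep_projD[of S "b k" z] by simp
  qed
  have "ev (\<lambda>z. ?G z = (\<Sum>i<k. b i z * z $ n ^ i) + z $ n ^ Suc k * w z)"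
    using eqb bk by eventually_elim simp
  then show ?thesis
    using \<psi> b w less_Suc_eq by (intro exI[of _ \<psi>] exI[of _ b] exI[of _ w]) auto
qed

section \<open>Local monomialization\<close>

lemma chart_pull:
  assumes "chart S \<phi> K" "q \<in> K" "\<phi> q = 0"
  shows "vholo (\<lambda>z. \<phi> (q + z)) 0"
proof -
  have "vholo \<phi> q" using assms by (simp add: chart_def)
  then have 1: "holo (\<lambda>z. \<phi> z $ i) (q + 0)" for i by (simp add: vholo_def)
  have 2: "vholo (\<lambda>z. q + z) 0" by (simp add: vholo_def holo_add)
  show ?thesis
    unfolding vholo_def by (intro allI holo_compose[OF 2 1])
qed

lemma chart_holo:
  assumes "chart S \<phi> K" "q \<in> K" "\<phi> q = 0" "holo F 0"
  shows "holo (\<lambda>z. F (\<phi> (q + z))) 0"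
  by (rule holo_compose[OF chart_pull[OF assms(1-3)]]) (simp add: assms)

lemma chart_ev:
  assumes "chart S \<phi> K" "q \<in> K" "\<phi> q = 0" "ev P"
  shows "ev (\<lambda>z. P (\<phi> (q + z)))"
  by (rule ev_compose[OF assms(4) chart_pull[OF assms(1-3)]]) (simp add: assms)

lemma chart_zero:
  assumes "chart S \<phi> K" "\<phi> q = 0" "i \<notin> S"
  shows "q $ i = 0"
proof -
  have "\<phi> q $ i = q $ i" using assms(1,3) unfolding chart_def by blast
  with assms(2) show ?thesis by simp
qed

lemma chart_fix:
  assumes "chart S \<phi> K" "\<phi> q = 0" "i \<notin> S"
  shows "\<phi> (q + z) $ i = z $ i"
proof -
  have "\<phi> (q + z) $ i = (q + z) $ i" using assms(1,3) unfolding chart_def by blast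
  then show ?thesis using chart_zero[OF assms] by simp
qed

lemma chart_dep:
  fixes F :: "complex ^ 'd \<Rightarrow> complex"
  assumes "chart S \<phi> K" "dep T F" "S \<subseteq> T"
  shows "dep T (\<lambda>z. F (\<phi> (q + z)))"
proof (rule dep_compose[OF assms(2)])
  fix i assume "i \<in> T"
  show "dep T (\<lambda>z. \<phi> (q + z) $ i)"
  proof (cases "i \<in> S")
    case True
    then have "dep S (\<lambda>z. \<phi> z $ i)" using assms(1) by (simp add: chart_def)
    then show ?thesis using dep_shift dep_mono assms(3) by blast
  next
    case False
    then have "\<phi> (q + z) $ i = q $ i + z $ i" for z
      using assms(1) by (simp add: chart_def)
    then show ?thesis using \<open>i \<in> T\<close> by (auto intro!: dep_add)
  qed
qed

lemma chart_mono:
  fixes \<phi> :: "complex ^ 'd \<Rightarrow> complex ^ 'd"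
  assumes "chart S \<phi> K" "S \<subseteq> T"
  shows "chart T \<phi> K"
  unfolding chart_def
proof (intro conjI ballI)
  fix i assume "i \<in> T"
  then have "dep T (\<lambda>z. \<phi> (0 + z) $ i)"
    using chart_dep[OF assms(1), of T "\<lambda>z. z $ i" 0] assms(2) by (simp add: dep_nth)
  then show "dep T (\<lambda>z. \<phi> z $ i)" by simp
qed (use assms in \<open>auto simp: chart_def\<close>)

lemma vholo_isCont: "vholo \<phi> p \<Longrightarrow> isCont \<phi> p"
  unfolding isCont_def tendsto_at_iff_tendsto_nhds by (rule vholo_tendsto)

lemma chartI:
  assumes "compact K" "\<And>p. vholo \<phi> p" "\<And>i z. i \<notin> S \<Longrightarrow> \<phi> z $ i = z $ i"
    "\<And>i. i \<in> S \<Longrightarrow> dep S (\<lambda>z. \<phi> z $ i)"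
  shows "chart S \<phi> K"
  unfolding chart_def using assms
  by (auto intro!: continuous_at_imp_continuous_on vholo_isCont)

lemma resolvable_cong:
  fixes S :: "'d::finite set"
  assumes "resolvable S F" "ev (\<lambda>z. F z = G z)"
  shows "resolvable S G"
  using assms
proof (induction arbitrary: G rule: resolvable.induct)
  case (MU F)
  then show ?case using MU_cong resolvable.MU by blast
next
  case (cover \<Phi> F)
  show ?case
  proof (rule resolvable.cover[OF cover.hyps(1-3)])
    fix \<phi> K q assume *: "(\<phi>, K) \<in> \<Phi>" "q \<in> K" "\<phi> q = 0"
    show "resolvable S (\<lambda>z. G (\<phi> (q + z)))"
      by (rule cover.IH[OF *]) (rule chart_ev[OF cover.hyps(2)[OF *(1)] *(2,3) cover.prems])
  qed
qed

lemma resolvable_chart: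
  assumes "chart S \<phi> K" "ev (\<lambda>x. x \<in> \<phi> ` K)"
    and "\<And>q. q \<in> K \<Longrightarrow> \<phi> q = 0 \<Longrightarrow> resolvable S (\<lambda>z. F (\<phi> (q + z)))"
  shows "resolvable S F"
  by (rule resolvable.cover[of "{(\<phi>, K)}"]) (use assms in auto)

lemma compact_polydisc: "compact {z :: complex ^ 'd. \<forall>i. norm (z $ i) \<le> r i}"
  unfolding compact_eq_bounded_closed
proof
  show "bounded {z :: complex ^ 'd. \<forall>i. norm (z $ i) \<le> r i}"
  proof (rule boundedI)
    fix z :: "complex ^ 'd" assume "z \<in> {z. \<forall>i. norm (z $ i) \<le> r i}"
    then have "(\<Sum>i\<in>UNIV. norm (z $ i)) \<le> (\<Sum>i\<in>UNIV. r i)" by (intro sum_mono) auto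
    moreover have "norm z \<le> (\<Sum>i\<in>UNIV. norm (z $ i))"
      unfolding norm_vec_def by (rule L2_set_le_sum) simp
    ultimately show "norm z \<le> (\<Sum>i\<in>UNIV. r i)" by simp
  qed
  show "closed {z :: complex ^ 'd. \<forall>i. norm (z $ i) \<le> r i}"
    by (intro closed_Collect_all closed_Collect_le continuous_on_norm continuous_on_component
        continuous_on_id continuous_on_const)
qed

lemma ev_small: "e > 0 \<Longrightarrow> ev (\<lambda>z :: complex ^ 'd. \<forall>i. norm (z $ i) < e)"
proof -
  assume e: "e > 0"
  have "((\<lambda>z :: complex ^ 'd. norm (z $ i)) \<longlongrightarrow> norm ((0 :: complex ^ 'd) $ i)) (nhds 0)" for i
    by (intro tendsto_norm holo_tendsto holo_nth)
  then have "ev (\<lambda>z :: complex ^ 'd. norm (z $ i) < e)" for i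
    by (rule order_tendstoD) (use e in simp)
  then show ?thesis by (simp add: eventually_all_finite)
qed

lemma mon_superset:
  fixes S T :: "'d::finite set"
  assumes "S \<subseteq> T" shows "mon S a z = mon T (\<lambda>i. if i \<in> S then a i else 0) z"
proof -
  have "mon T (\<lambda>i. if i \<in> S then a i else 0) z = (\<Prod>i\<in>T. if i \<in> S then z $ i ^ a i else 1)"
    unfolding mon_def by (rule prod.cong) auto
  also have "\<dots> = mon S a z"
    unfolding mon_def using assms by (subst prod.inter_restrict[symmetric]) (auto simp: Int_absorb1)
  finally show ?thesis by simp
qed

lemma MU_superset:
  fixes S T :: "'d::finite set"
  assumes "MU S F" "S \<subseteq> T" shows "MU T F"
proof -
  obtain a u where "holo u 0" "u 0 \<noteq> 0" "ev (\<lambda>z. F z = mon S a z * u z)"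
    using assms(1) unfolding MU_def by blast
  then show ?thesis
    unfolding MU_def mon_superset[OF assms(2)] by blast
qed

lemma MU_prod:
  "(\<And>i. i \<in> I \<Longrightarrow> MU S (F i)) \<Longrightarrow> MU S (\<lambda>z. \<Prod>i\<in>I. F i z)"
  by (induction I rule: infinite_finite_induct) (auto intro: MU_mult MU_unit[of "\<lambda>_. 1", simplified])

lemma mon_nonzero_germ:
  fixes S :: "'d::finite set"
  shows "\<not> ev (\<lambda>z. mon S a z = 0)"
proof
  assume zero: "ev (\<lambda>z. mon S a z = 0)"
  obtain p where "mon S a p = 0" "mon S a p = 0 \<longleftrightarrow> (\<exists>i\<in>S \<inter> {}. a i > 0)"
    by (rule ev_test_monomials[OF zero, where S=S and Z="{}"]) metis
  then show False by simp
qed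

text \<open>At a root of multiplicity \<open>d\<close> the polynomial would be \<open>u0 * (y - y0) ^ d\<close>; as the term of
  degree \<open>d - 1\<close> is missing, \<open>y0\<close> would vanish.\<close>

lemma order_drop:
  fixes b :: "nat \<Rightarrow> complex"
  assumes i0: "i0 < d - 1" "b i0 \<noteq> 0" and u0: "u0 \<noteq> 0"
  shows "\<exists>m<d. \<exists>L. L \<noteq> 0 \<and>
    ((\<lambda>s. ((\<Sum>i<d - 1. b i * (y0 + s) ^ i) + (y0 + s) ^ d * u0) / s ^ m) \<longlongrightarrow> L) (at 0)"
proof -
  define p where "p = (\<Sum>i<d - 1. monom (b i) i) + monom u0 d"
  have coeff: "coeff p k = (if k < d - 1 then b k else 0) + (if k = d then u0 else 0)" for k
    unfolding p_def by (simp add: coeff_sum)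
  have d: "d \<ge> 2" using i0 by simp
  have "coeff p d = u0" using coeff[of d] d by (simp split: if_splits)
  then have p0: "p \<noteq> 0" using u0 by auto
  have deg: "degree p = d"
    by (rule antisym[OF degree_le le_degree]) (use u0 d in \<open>auto simp: coeff\<close>)
  have poly: "poly p y = (\<Sum>i<d - 1. b i * y ^ i) + y ^ d * u0" for y
    by (simp add: p_def poly_sum poly_monom mult.commute)
  define m where "m = order y0 p"
  obtain r where r: "p = [:-y0, 1:] ^ m * r" "\<not> [:-y0, 1:] dvd r"
    using order_decomp[OF p0, of y0] unfolding m_def by blast
  have r0: "poly r y0 \<noteq> 0" using r(2) by (simp add: poly_eq_0_iff_dvd)
  have "m \<le> d" using order_degree[OF p0, of y0] deg by (simp add: m_def)
  moreover have "m \<noteq> d"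
  proof
    assume md: "m = d"
    have "r \<noteq> 0" using r(1) p0 by auto
    then have "degree p = d + degree r"
      unfolding r(1) md by (subst degree_mult_eq) (auto simp: degree_linear_power)
    then have "degree r = 0" using deg by simp
    then obtain c where c: "r = [:c:]" by (metis degree_eq_zeroE)
    have pc: "p = smult c ([:-y0, 1:] ^ d)" using r(1) md c by simp
    have "c = u0"
      using coeff[of d] d unfolding pc by (simp add: coeff_linear_power)
    have "coeff p (d - 1) = 0" using coeff[of "d - 1"] d by simp
    moreover have "coeff p (d - 1) = u0 * (of_nat d * (- y0))"
      using d unfolding pc \<open>c = u0\<close>
      using binomial_symmetric[of 1 d] by (simp add: coeff_linear_poly_power)
    \<comment> \<open>The root 0 would leave the pure power \<open>monom u0 d\<close>, against
      \<open>b i0 \<noteq> 0\<close>.\<close>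
    ultimately have "y0 = 0" using u0 d by simp
    then have "p = monom u0 d" using pc \<open>c = u0\<close>
      by (simp add: monom_altdef)
    then have "coeff p i0 = 0" using i0(1) by simp
    then show False using coeff[of i0] i0 by (simp split: if_splits)
  qed
  ultimately have "m < d" by simp
  moreover have "((\<lambda>s. ((\<Sum>i<d - 1. b i * (y0 + s) ^ i) + (y0 + s) ^ d * u0) / s ^ m) \<longlongrightarrow> poly r y0) (at 0)"
  proof (rule Lim_transform_eventually)
    have "((\<lambda>s. poly r (y0 + s)) \<longlongrightarrow> poly r (y0 + 0)) (at 0)"
      by (intro tendsto_intros)
    then show "((\<lambda>s. poly r (y0 + s)) \<longlongrightarrow> poly r y0) (at 0)" by simp
    show "\<forall>\<^sub>F s in at 0. poly r (y0 + s) = ((\<Sum>i<d - 1. b i * (y0 + s) ^ i) + (y0 + s) ^ d * u0) / s ^ m"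
      using eventually_neq_at_within[of 0]
    proof eventually_elim
      case (elim s)
      have "poly p (y0 + s) = s ^ m * poly r (y0 + s)"
        unfolding r(1) by simp
      with elim show ?case by (simp add: poly)
    qed
  qed
  ultimately show ?thesis using r0 by blast
qed

text \<open>The two charts of the blow-up of \<open>z $ n = z $ j = 0\<close> are \<open>blowup n j\<close> and \<open>blowup j n\<close>.\<close>

definition blowup :: "'d \<Rightarrow> 'd \<Rightarrow> complex ^ 'd \<Rightarrow> complex ^ 'd" where
  "blowup n j z = (\<chi> i. if i = n then z $ j * z $ n else z $ i)"

lemma blowup_nth: "blowup n j z $ i = (if i = n then z $ j * z $ n else z $ i)"
  by (simp add: blowup_def)

lemma chart_blowup:
  fixes S :: "'d::finite set"
  assumes "n \<in> S" "j \<in> S" "compact K"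
  shows "chart S (blowup n j) K"
proof (rule chartI[OF assms(3)])
  fix p :: "complex ^ 'd"
  show "vholo (blowup n j) p"
    unfolding vholo_def blowup_nth
  proof
    fix i show "holo (\<lambda>z. if i = n then z $ j * z $ n else z $ i) p"
      by (cases "i = n") auto
  qed
next
  fix i :: 'd and z assume "i \<notin> S" then show "blowup n j z $ i = z $ i"
    using assms by (auto simp: blowup_nth)
next
  fix i assume "i \<in> S"
  then show "dep S (\<lambda>z. blowup n j z $ i)"
    unfolding blowup_nth using assms by (cases "i = n") auto
qed

text \<open>The points are divided by the ratio of \<open>x $ n\<close> to \<open>x $ j\<close>.
  With a large \<open>R\<close>, the second chart is needed only where its new coordinate is at most
  \<open>1 / R\<close>, and this smallness will produce a unit there.\<close>

lemma bl_cover: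
  fixes x :: "complex ^ 'd"
  assumes nj: "n \<noteq> j" and R: "R \<ge> 1" and x: "\<forall>i. norm (x $ i) < 1"
  shows "x \<in> blowup n j ` {z. \<forall>i. norm (z $ i) \<le> (if i = n then R else 1)} \<or>
    x \<in> blowup j n ` {z. \<forall>i. norm (z $ i) \<le> (if i = j then 1 / R else 1)}"
proof (cases "norm (x $ n) \<le> R * norm (x $ j)")
  case True
  \<comment> \<open>If \<open>x $ j = 0\<close> then \<open>x $ n = 0\<close> as well, and the
    convention \<open>0 / 0 = 0\<close> yields a correct preimage.\<close>
  define q where "q = (\<chi> i. if i = n then x $ n / x $ j else x $ i)"
  have "norm (x $ n / x $ j) \<le> R"
    using True R by (cases "x $ j = 0") (auto simp: norm_divide divide_le_eq)
  then have "\<forall>i. norm (q $ i) \<le> (if i = n then R else 1)"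
    using x less_imp_le by (auto simp: q_def)
  moreover have "blowup n j q = x"
    using nj True by (auto simp: blowup_def q_def vec_eq_iff)
  ultimately show ?thesis by blast
next
  case False
  then have xn: "x $ n \<noteq> 0" using R by (auto simp: not_le) (meson le_less_trans mult_nonneg_nonneg norm_ge_zero not_less zero_le_one order.trans)
  define q where "q = (\<chi> i. if i = j then x $ j / x $ n else x $ i)"
  have "norm (x $ j / x $ n) \<le> 1 / R"
    using False xn R by (simp add: norm_divide field_simps)
  then have "\<forall>i. norm (q $ i) \<le> (if i = j then 1 / R else 1)"
    using x less_imp_le by (auto simp: q_def)
  moreover have "blowup j n q = x"
    using nj xn by (auto simp: blowup_def q_def vec_eq_iff)
  ultimately show ?thesis by blast
qed

section \<open>Lowering the order by blow-ups\<close>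

text \<open>The \<open>i\<close>-th coefficient carries the \<open>(d - i)\<close>-th power of one
  monomial, so all terms have weight \<open>d\<close> jointly in that monomial and
  \<open>z $ n\<close>: replacing \<open>z $ n\<close> by \<open>z $ j * z $ n\<close> splits off
  \<open>z $ j ^ d\<close> whenever \<open>z $ j\<close> divides the monomial. The range
  \<open>i < d - 1\<close> reflects that the term of degree \<open>d - 1\<close> was
  eliminated.\<close>

definition bracket where
  "bracket S n d w \<delta> u z =
     (\<Sum>i<d - 1. mon S \<delta> z ^ (d - i) * w i z * z $ n ^ i) + z $ n ^ d * u z"

lemma mon_zero:
  fixes S :: "'d::finite set"
  shows "mon S a 0 = (if \<exists>i\<in>S. a i > 0 then 0 else 1)"
  by (auto simp: mon_def intro!: prod.neutral)

lemma norm_mon_zero_le: "norm (mon (S :: 'd::finite set) a 0) \<le> 1"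
  by (simp add: mon_zero)

text \<open>Induction on the degree of \<open>\<delta>\<close>. If \<open>\<delta>\<close> is
  trivial, the coefficient \<open>w i0\<close> is a unit and the order in \<open>z $ n\<close> is
  below \<open>d\<close>. Otherwise blow up \<open>z $ n = z $ j = 0\<close> for a \<open>j\<close>
  in \<open>\<delta>\<close>. In the first chart \<open>\<delta>\<close> loses a factor
  \<open>z $ j\<close> at the origin, while at the other points over it the bracket is a unit up to
  a monomial or has smaller order. In the second chart the bracket is \<open>z $ n ^ d\<close> times
  a unit.\<close>

lemma resolvable_bracket:
  fixes S :: "'d::finite set" and w :: "nat \<Rightarrow> complex ^ 'd \<Rightarrow> complex"
  assumes n: "n \<notin> S"
    and IH: "\<And>m M G. m < d \<Longrightarrow> holo M 0 \<Longrightarrow> dep S M \<Longrightarrow> \<not> ev (\<lambda>z. M z = 0) \<Longrightarrow>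
      holo G 0 \<Longrightarrow> dep (insert n S) G \<Longrightarrow> Reg n S m G \<Longrightarrow> resolvable (insert n S) (\<lambda>z. M z * G z)"
    and w: "\<And>i. i < d - 1 \<Longrightarrow> holo (w i) 0 \<and> dep S (w i)"
    and i0: "i0 < d - 1" "w i0 0 \<noteq> 0"
    and u: "holo u 0" "dep (insert n S) u" "u 0 \<noteq> 0"
  shows "resolvable (insert n S) (\<lambda>z. mon S a z * bracket S n d w \<delta> u z)"
  using u
proof (induction "\<Sum>i\<in>S. \<delta> i" arbitrary: \<delta> a u rule: less_induct)
  case less
  let ?T = "insert n S"
  have nS: "\<And>i. i \<in> S \<Longrightarrow> i \<noteq> n" using n by auto
  have dep_w_axis: "w i (axis n s) = w i 0" if "i < d - 1" for i s
    by (rule dep_eq[of S "w i"]) (use w[OF that] n in \<open>auto simp: axis_def\<close>)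
  have holo_br: "holo (bracket S n d w \<delta> u) 0"
    unfolding bracket_def[abs_def] using w less.prems
    by (intro holo_add holo_sum holo_mult holo_power holo_mon holo_nth) auto
  have dep_br: "dep ?T (bracket S n d w \<delta> u)"
    unfolding bracket_def[abs_def] using w less.prems
    by (intro dep_add dep_sum dep_mult dep_power dep_nth dep_mono[OF dep_mon]) (auto intro: dep_mono)
  show ?case
  proof (cases "\<exists>j\<in>S. \<delta> j > 0")
    case False
    then have mon1: "mon S \<delta> z = 1" for z by (simp add: mon_def)
    \<comment> \<open>The first coefficient that does not vanish at the origin determines the order
      along the \<open>n\<close>-axis.\<close>
    define m where "m = (LEAST i. i < d - 1 \<and> w i 0 \<noteq> 0)"
    have m: "m < d - 1" "w m 0 \<noteq> 0"
      using LeastI[of "\<lambda>i. i < d - 1 \<and> w i 0 \<noteq> 0" i0] i0 by (auto simp: m_def)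
    have m_min: "w i 0 = 0" if "i < m" for i
      using not_less_Least[of i "\<lambda>i. i < d - 1 \<and> w i 0 \<noteq> 0"] that m(1) by (auto simp: m_def)
    have "((\<lambda>s. bracket S n d w \<delta> u (axis n s) / s ^ m) \<longlongrightarrow> w m 0) (at 0)"
    proof (rule Lim_transform_eventually)
      have u_lim: "((\<lambda>s. u (axis n s)) \<longlongrightarrow> u 0) (at 0)"
        using filterlim_compose[OF holo_tendsto[OF less.prems(1)] axis_tendsto[of n]] .
      have "((\<lambda>s. (\<Sum>i\<in>{m..<d - 1}. w i 0 * s ^ (i - m)) + s ^ (d - m) * u (axis n s)) \<longlongrightarrow>
          (\<Sum>i\<in>{m..<d - 1}. w i 0 * 0 ^ (i - m)) + 0 ^ (d - m) * u 0) (at 0)"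
        by (intro tendsto_intros u_lim)
      moreover have "(\<Sum>i\<in>{m..<d - 1}. w i 0 * 0 ^ (i - m)) = (\<Sum>i\<in>{m..<d - 1}. if i = m then w m 0 else 0)"
        by (rule sum.cong) auto
      moreover have "(0::complex) ^ (d - m) = 0" using m by simp
      ultimately show "((\<lambda>s. (\<Sum>i\<in>{m..<d - 1}. w i 0 * s ^ (i - m)) + s ^ (d - m) * u (axis n s)) \<longlongrightarrow> w m 0) (at 0)"
        using m(1) by simp
      show "\<forall>\<^sub>F s in at 0. (\<Sum>i\<in>{m..<d - 1}. w i 0 * s ^ (i - m)) + s ^ (d - m) * u (axis n s) =
          bracket S n d w \<delta> u (axis n s) / s ^ m"
        using eventually_neq_at_within[of 0]
      proof eventually_elim
        case (elim s)
        have "bracket S n d w \<delta> u (axis n s) = (\<Sum>i<d - 1. w i 0 * s ^ i) + s ^ d * u (axis n s)"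
          unfolding bracket_def mon1 by (simp add: dep_w_axis)
        also have "(\<Sum>i<d - 1. w i 0 * s ^ i) = (\<Sum>i\<in>{m..<d - 1}. w i 0 * s ^ i)"
          by (rule sum.mono_neutral_right) (use m_min in auto)
        also have "\<dots> = (\<Sum>i\<in>{m..<d - 1}. w i 0 * s ^ (i - m)) * s ^ m"
          by (simp add: sum_distrib_right mult.assoc flip: power_add)
        also have "s ^ d = s ^ (d - m) * s ^ m" using m by (simp flip: power_add)
        finally have "bracket S n d w \<delta> u (axis n s) =
            ((\<Sum>i\<in>{m..<d - 1}. w i 0 * s ^ (i - m)) + s ^ (d - m) * u (axis n s)) * s ^ m"
          by (simp add: algebra_simps)
        with elim show ?case by simp
      qed
    qed
    then have "Reg n S m (bracket S n d w \<delta> u)"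
      using Reg_axis[OF n holo_br dep_br] m(2) by blast
    then show ?thesis
      using m(1) by (intro IH[of m "mon S a"] holo_mon dep_mon mon_nonzero_germ holo_br dep_br) auto
  next
    case True
    then obtain j where j: "j \<in> S" "\<delta> j > 0" by blast
    have nj: "n \<noteq> j" using n j by auto
    define \<delta>' where "\<delta>' = \<delta>(j := \<delta> j - 1)"
    have mon_d: "mon S \<delta> z = z $ j * mon S \<delta>' z" for z
      unfolding \<delta>'_def by (rule mon_dec) (use j in auto)
    have less': "(\<Sum>i\<in>S. \<delta>' i) < (\<Sum>i\<in>S. \<delta> i)"
      unfolding \<delta>'_def using j by (intro sum_strict_mono_ex1) auto
    \<comment> \<open>\<open>R\<close> exceeds \<open>W / norm (u 0)\<close>. In the second chart
      the terms below the leading one total at most \<open>(W - 1) / R\<close>, less than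
      \<open>norm (u 0)\<close>. The 1 in \<open>W\<close> makes \<open>R > 1\<close>.\<close>
    define W where "W = 1 + (\<Sum>i<d - 1. norm (w i 0))"
    define R where "R = 1 + W / norm (u 0)"
    have W: "W > 0" unfolding W_def by (intro add_pos_nonneg sum_nonneg) auto
    have R: "R > 1" using W less.prems(3) by (simp add: R_def)
    define K1 where "K1 = {z :: complex ^ 'd. \<forall>i. norm (z $ i) \<le> (if i = n then R else 1)}"
    define K2 where "K2 = {z :: complex ^ 'd. \<forall>i. norm (z $ i) \<le> (if i = j then 1 / R else 1)}"
    let ?F = "\<lambda>z. mon S a z * bracket S n d w \<delta> u z"
    have ch1: "chart ?T (blowup n j) K1" and ch2: "chart ?T (blowup j n) K2"
      unfolding K1_def K2_def using j by (intro chart_blowup compact_polydisc; simp)+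
    have case1: "resolvable ?T (\<lambda>z. ?F (blowup n j (q + z)))" if q: "q \<in> K1" "blowup n j q = 0" for q
    proof -
      \<comment> \<open>The points over the origin form the \<open>n\<close>-axis, and
        \<open>y0\<close> is the position on it; locally \<open>z $ n\<close> becomes
        \<open>z $ j * (y0 + z $ n)\<close>.\<close>
      define y0 where "y0 = q $ n"
      have q0: "q $ i = 0" if "i \<noteq> n" for i
        using arg_cong[OF q(2), of "\<lambda>v. v $ i"] that by (simp add: blowup_nth)
      have \<phi>: "blowup n j (q + z) $ i = (if i = n then z $ j * (y0 + z $ n) else z $ i)" for z i
        using nj by (simp add: blowup_nth q0 y0_def)
      have inv: "F (blowup n j (q + z)) = F z" if "dep S F" for F z
        by (rule dep_eq[OF that]) (use nS in \<open>auto simp: \<phi>\<close>)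
      define u' where "u' z = u (blowup n j (q + z))" for z
      have u': "holo u' 0" "dep ?T u'" "u' 0 \<noteq> 0"
        unfolding u'_def[abs_def]
        using chart_holo[OF ch1 q less.prems(1)] chart_dep[OF ch1 less.prems(2)] less.prems(3) q(2)
        by auto
      \<comment> \<open>The power \<open>z $ j ^ d\<close> that the blow-up splits off joins the
        monomial.\<close>
      define a' where "a' i = a i + (if i = j then d else 0)" for i
      have mon_a': "mon S a' z = mon S a z * z $ j ^ d" for z
        unfolding a'_def mon_add mon_single[OF j(1)] ..
      define G where "G z = (\<Sum>i<d - 1. mon S \<delta>' z ^ (d - i) * w i z * (y0 + z $ n) ^ i) +
        (y0 + z $ n) ^ d * u' z" for z
      have G: "holo G 0" "dep ?T G"
        unfolding G_def[abs_def] using w u'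
        by (intro holo_add holo_sum holo_mult holo_power holo_mon holo_nth holo_const; simp)
          (use w u' in \<open>intro dep_add dep_sum dep_mult dep_power dep_nth dep_const dep_mono[OF dep_mon]; auto intro: dep_mono\<close>)
      have eq: "?F (blowup n j (q + z)) = mon S a' z * G z" for z
      proof -
        have "bracket S n d w \<delta> u (blowup n j (q + z)) = z $ j ^ d * G z"
        proof -
          have "mon S \<delta> (blowup n j (q + z)) ^ (d - i) * w i (blowup n j (q + z)) * blowup n j (q + z) $ n ^ i =
              z $ j ^ d * (mon S \<delta>' z ^ (d - i) * w i z * (y0 + z $ n) ^ i)" if i: "i < d - 1" for i
          proof -
            have "z $ j ^ d = z $ j ^ (d - i) * z $ j ^ i"
              using i by (simp flip: power_add)
            then show ?thesis
              using i w inv[of "mon S \<delta>"] inv[of "w i"] by (simp add: dep_mon mon_d \<phi> power_mult_distrib mult_ac)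
          qed
          then have s: "(\<Sum>i<d - 1. mon S \<delta> (blowup n j (q + z)) ^ (d - i) * w i (blowup n j (q + z)) * blowup n j (q + z) $ n ^ i) =
              z $ j ^ d * (\<Sum>i<d - 1. mon S \<delta>' z ^ (d - i) * w i z * (y0 + z $ n) ^ i)"
            unfolding sum_distrib_left by (intro sum.cong) auto
          have "blowup n j (q + z) $ n ^ d = z $ j ^ d * (y0 + z $ n) ^ d"
            unfolding \<phi> by (simp add: power_mult_distrib)
          then show ?thesis
            unfolding bracket_def G_def s u'_def by (simp only: distrib_left mult.assoc)
        qed
        then show ?thesis
          using inv[of "mon S a" z] by (simp add: dep_mon mon_a' mult_ac)
      qed
      have "resolvable ?T (\<lambda>z. mon S a' z * G z)"
      proof (cases "y0 = 0")
        case True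
        then have "G = bracket S n d w \<delta>' u'"
          by (simp add: G_def bracket_def fun_eq_iff)
        then show ?thesis using less.hyps[OF less' u'] by simp
      next
        case y0: False
        show ?thesis
        \<comment> \<open>While \<open>\<delta>'\<close> is nontrivial, only the leading term
          survives at the origin and \<open>G\<close> is a unit. Otherwise \<open>G\<close>
          restricts on the \<open>n\<close>-axis to a polynomial in \<open>y0 + s\<close> with
          constant coefficients and no term of degree \<open>d - 1\<close>; its roots have
          multiplicity below \<open>d\<close>.\<close>
        proof (cases "\<exists>i\<in>S. \<delta>' i > 0")
          case True
          then have "mon S \<delta>' 0 = 0" by (simp add: mon_zero)
          then have "(\<Sum>i<d - 1. mon S \<delta>' 0 ^ (d - i) * w i 0 * (y0 + (0 :: complex ^ 'd) $ n) ^ i) = 0"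
            by (intro sum.neutral) (auto simp: power_0_left)
          then have "G 0 = y0 ^ d * u' 0" unfolding G_def by simp
          then have "MU ?T G" using y0 u' G by (intro MU_unit) auto
          moreover have "MU ?T (mon S a')"
            by (rule MU_superset[OF MU_mon]) blast
          ultimately show ?thesis by (intro resolvable.MU MU_mult)
        next
          case False
          then have mon1: "mon S \<delta>' z = 1" for z by (simp add: mon_def)
          obtain m L where m: "m < d" "L \<noteq> 0"
            and lim: "((\<lambda>s. ((\<Sum>i<d - 1. w i 0 * (y0 + s) ^ i) + (y0 + s) ^ d * u 0) / s ^ m) \<longlongrightarrow> L) (at 0)"
            using order_drop[of i0 d "\<lambda>i. w i 0" "u 0" y0] i0 less.prems(3) by blast
          have "G (axis n s) = (\<Sum>i<d - 1. w i 0 * (y0 + s) ^ i) + (y0 + s) ^ d * u 0" for s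
          proof -
            \<comment> \<open>The blow-up collapses the \<open>n\<close>-axis to the origin, so the
              leading coefficient is constant along it.\<close>
            have "blowup n j (q + axis n s) = 0"
              using nj by (simp add: vec_eq_iff \<phi> axis_def)
            then have "u' (axis n s) = u 0" by (simp add: u'_def)
            then show ?thesis unfolding G_def mon1 by (simp add: dep_w_axis)
          qed
          then have "Reg n S m G"
            using Reg_axis[OF n G, of m L] lim m(2) by simp
          then show ?thesis
            using m(1) G by (intro IH[of m "mon S a'"] holo_mon dep_mon mon_nonzero_germ) auto
        qed
      qed
      then show ?thesis by (simp add: eq)
    qed
    have case2: "resolvable ?T (\<lambda>z. ?F (blowup j n (q + z)))" if q: "q \<in> K2" "blowup j n q = 0" for q
    proof -
      define w0 where "w0 = q $ j"
      have w0: "norm w0 \<le> 1 / R" using q(1) unfolding w0_def K2_def by (auto dest: spec[of _ j])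
      have q0: "q $ i = 0" if "i \<noteq> j" for i
        using arg_cong[OF q(2), of "\<lambda>v. v $ i"] that by (simp add: blowup_nth)
      have \<phi>: "blowup j n (q + z) $ i = (if i = j then z $ n * (w0 + z $ j) else z $ i)" for z i
        using nj by (simp add: blowup_nth q0 w0_def)
      have MUw: "MU ?T (\<lambda>z. w0 + z $ j)"
      proof (cases "w0 = 0")
        case True then show ?thesis using j by (simp add: MU_coord)
      next
        case False then show ?thesis by (intro MU_unit holo_add holo_const holo_nth) simp
      qed
      have "MU ?T (\<lambda>z. blowup j n (q + z) $ i)" if "i \<in> S" for i
        unfolding \<phi> using that by (cases "i = j") (auto intro!: MU_mult MU_coord MUw)
      then have MUa: "MU ?T (\<lambda>z. mon S a (blowup j n (q + z)))"
        unfolding mon_def by (intro MU_prod MU_power)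
      \<comment> \<open>Every term has weight \<open>d\<close>: the factor \<open>z $ j\<close> of
        the monomial becomes \<open>z $ n * (w0 + z $ j)\<close>, so \<open>z $ n ^ d\<close> splits
        off and \<open>B\<close> remains.\<close>
      define B where "B z = (\<Sum>i<d - 1. ((w0 + z $ j) * mon S \<delta>' (blowup j n (q + z))) ^ (d - i) * w i (blowup j n (q + z)))
        + u (blowup j n (q + z))" for z
      have B: "holo B 0"
        unfolding B_def[abs_def] using w less.prems(1)
        by (intro holo_add holo_sum holo_mult holo_power holo_nth holo_const chart_holo[OF ch2 q] holo_mon; simp)
      have eq: "bracket S n d w \<delta> u (blowup j n (q + z)) = z $ n ^ d * B z" for z
      proof -
        have "mon S \<delta> (blowup j n (q + z)) ^ (d - i) * w i (blowup j n (q + z)) * blowup j n (q + z) $ n ^ i =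
            z $ n ^ d * (((w0 + z $ j) * mon S \<delta>' (blowup j n (q + z))) ^ (d - i) * w i (blowup j n (q + z)))"
          if i: "i < d - 1" for i
        proof -
          have "z $ n ^ d = z $ n ^ (d - i) * z $ n ^ i"
            using i by (simp flip: power_add)
          then show ?thesis
            using nj by (simp add: mon_d \<phi> power_mult_distrib mult_ac)
        qed
        then have s: "(\<Sum>i<d - 1. mon S \<delta> (blowup j n (q + z)) ^ (d - i) * w i (blowup j n (q + z)) * blowup j n (q + z) $ n ^ i) =
            z $ n ^ d * (\<Sum>i<d - 1. ((w0 + z $ j) * mon S \<delta>' (blowup j n (q + z))) ^ (d - i) * w i (blowup j n (q + z)))"
          unfolding sum_distrib_left by (intro sum.cong) auto
        have "blowup j n (q + z) $ n = z $ n" using nj by (simp add: \<phi>)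
        then show ?thesis
          unfolding bracket_def B_def s by (simp only: distrib_left)
      qed
      \<comment> \<open>Each term of the sum contains a positive power of \<open>w0\<close>, which
        is at most \<open>1 / R\<close> in norm; the choice of \<open>R\<close> prevents
        cancellation against \<open>u 0\<close>.\<close>
      have "B 0 \<noteq> 0"
      proof
        assume "B 0 = 0"
        then have "u 0 = - (\<Sum>i<d - 1. (w0 * mon S \<delta>' 0) ^ (d - i) * w i 0)"
          using q(2) by (simp add: B_def eq_neg_iff_add_eq_0 add.commute)
        then have "norm (u 0) \<le> (\<Sum>i<d - 1. norm ((w0 * mon S \<delta>' 0) ^ (d - i) * w i 0))"
          by (simp add: norm_sum)
        also have "\<dots> \<le> (\<Sum>i<d - 1. 1 / R * norm (w i 0))"
        proof (rule sum_mono)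
          fix i assume i: "i \<in> {..<d - 1}"
          define t where "t = norm (w0 * mon S \<delta>' 0)"
          have "t \<le> 1 / R * 1"
            unfolding t_def norm_mult using w0 R by (intro mult_mono norm_mon_zero_le) auto
          moreover have "1 / R \<le> 1" using R by simp
          ultimately have t: "t \<le> 1 / R" "t \<le> 1" by linarith+
          have "t ^ (d - i) \<le> t ^ 1"
            using t i by (intro power_decreasing) (auto simp: t_def)
          then have "t ^ (d - i) \<le> 1 / R" using t by simp
          then show "norm ((w0 * mon S \<delta>' 0) ^ (d - i) * w i 0) \<le> 1 / R * norm (w i 0)"
            unfolding norm_mult[of "(w0 * mon S \<delta>' 0) ^ (d - i)"] norm_power t_def[symmetric]
            by (rule mult_right_mono) simp
        qed
        also have "\<dots> = (W - 1) / R" by (simp add: W_def sum_distrib_left[symmetric] sum_divide_distrib)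
        finally have "R * norm (u 0) \<le> W - 1" using R by (simp add: field_simps)
        moreover have "R * norm (u 0) = norm (u 0) + W"
          unfolding R_def using less.prems(3) by (simp add: field_simps)
        ultimately show False using norm_ge_zero[of "u 0"] by linarith
      qed
      then have "MU ?T B" using B by (rule MU_unit[rotated])
      then have "MU ?T (\<lambda>z. mon S a (blowup j n (q + z)) * (z $ n ^ d * B z))"
        by (intro MU_mult MUa MU_power MU_coord) auto
      then show ?thesis unfolding eq by (rule resolvable.MU)
    qed
    have cov: "ev (\<lambda>x. \<exists>(\<phi>, K)\<in>{(blowup n j, K1), (blowup j n, K2)}. x \<in> \<phi> ` K)"
      using ev_small[of 1, OF zero_less_one]
    proof eventually_elim
      case (elim x)
      then show ?case
        using bl_cover[OF nj, of R x] R by (auto simp: K1_def K2_def)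
    qed
    show ?thesis
    proof (rule resolvable.cover[OF _ _ cov])
      fix \<phi> K assume "(\<phi>, K) \<in> {(blowup n j, K1), (blowup j n, K2)}"
      then show "chart ?T \<phi> K" using ch1 ch2 by auto
    next
      fix \<phi> K q assume "(\<phi>, K) \<in> {(blowup n j, K1), (blowup j n, K2)}" "q \<in> K" "\<phi> q = 0"
      then show "resolvable ?T (\<lambda>z. ?F (\<phi> (q + z)))" using case1 case2 by auto
    qed simp
  qed
qed

section \<open>Ramification and comparison of coefficients\<close>

text \<open>A ramified covering: it multiplies the exponents of all monomials by \<open>N\<close>
  and so clears the denominators \<open>d - i\<close> in the weights. Complex roots make it
  surjective.\<close>

definition coord_power :: "'d set \<Rightarrow> nat \<Rightarrow> complex ^ 'd \<Rightarrow> complex ^ 'd" where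
  "coord_power S N z = (\<chi> i. if i \<in> S then z $ i ^ N else z $ i)"

lemma coord_power_nth: "coord_power S N z $ i = (if i \<in> S then z $ i ^ N else z $ i)"
  by (simp add: coord_power_def)

lemma chart_coord_power:
  fixes S :: "'d::finite set"
  assumes "compact K" shows "chart S (coord_power S N) K"
proof (rule chartI[OF assms])
  fix p :: "complex ^ 'd"
  show "vholo (coord_power S N) p"
    unfolding vholo_def coord_power_nth
  proof
    fix i show "holo (\<lambda>z. if i \<in> S then z $ i ^ N else z $ i) p"
      by (cases "i \<in> S") auto
  qed
next
  fix i assume "i \<in> S"
  then show "dep S (\<lambda>z. coord_power S N z $ i)"
    unfolding coord_power_nth by (auto intro: dep_power dep_nth)
qed (simp add: coord_power_nth)

lemma coord_power_cover:
  fixes x :: "complex ^ 'd"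
  assumes N: "N > 0" and x: "\<forall>i. norm (x $ i) < 1"
  shows "x \<in> coord_power S N ` {z. \<forall>i. norm (z $ i) \<le> 1}"
proof -
  have "\<exists>w. w ^ N = x $ i" for i
  proof -
    obtain w where "x $ i = w ^ N"
      by (rule exists_complex_root[of N "x $ i"]) (use N in simp)
    then show ?thesis by metis
  qed
  then obtain r where r: "\<And>i. r i ^ N = x $ i" by metis
  define q where "q = (\<chi> i. if i \<in> S then r i else x $ i)"
  have "norm (r i) \<le> 1" for i
  proof -
    have "norm (r i) ^ N \<le> 1" using r[of i] x by (metis norm_power less_imp_le)
    then show ?thesis using N by (simp add: power_le_one_iff)
  qed
  then have "\<forall>i. norm (q $ i) \<le> 1" using x less_imp_le by (auto simp: q_def)
  moreover have "coord_power S N q = x" by (auto simp: coord_power_def q_def r vec_eq_iff)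
  ultimately show ?thesis by blast
qed

lemma mon_coord_power: "mon S a (coord_power S N z) = mon S (\<lambda>i. N * a i) z"
  unfolding mon_def coord_power_nth by (rule prod.cong) (auto simp: power_mult)

lemma mon_power: "mon S a z ^ k = mon S (\<lambda>i. k * a i) z"
  unfolding mon_def by (simp add: prod_power_distrib power_mult mult.commute[of k])

lemma mon_cong: "(\<And>i. i \<in> S \<Longrightarrow> a i = b i) \<Longrightarrow> mon S a z = mon S b z"
  unfolding mon_def by (rule prod.cong) auto

lemma MU_dep:
  fixes S :: "'d::finite set"
  assumes "MU S F" "dep S F"
  obtains a v where "holo v 0" "dep S v" "v 0 \<noteq> 0" "ev (\<lambda>z. F z = mon S a z * v z)"
proof -
  obtain a u where u: "holo u 0" "u 0 \<noteq> 0" "ev (\<lambda>z. F z = mon S a z * u z)"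
    using assms(1) unfolding MU_def by blast
  have "ev (\<lambda>z. F z = mon S a z * u (proj S z))"
    using ev_proj[OF u(3), of S]
    by eventually_elim (simp add: dep_projD[OF assms(2)] dep_projD[OF dep_mon])
  then show ?thesis
    using that[of "\<lambda>z. u (proj S z)" a] u holo_proj dep_proj by auto
qed

text \<open>Once the product \<open>g\<close> is a monomial times a unit, so are \<open>M\<close>, all nonzero coefficients \<open>c i\<close> and all
  nonzero differences of the powers \<open>c i ^ (fact d div (d - i))\<close>; hence these powers are totally ordered
  by divisibility.\<close>

definition coeff_data where
  "coeff_data S n d I J g M c u \<longleftrightarrow>
     holo M 0 \<and> dep S M \<and> (\<forall>i<d - 1. holo (c i) 0 \<and> dep S (c i)) \<and>
     (\<forall>i<d - 1. i \<notin> I \<longrightarrow> ev (\<lambda>z. c i z = 0)) \<and>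
     (\<forall>i\<in>I. \<forall>k\<in>I. (i, k) \<notin> J \<longrightarrow> ev (\<lambda>z. c i z ^ (fact d div (d - i)) - c k z ^ (fact d div (d - k)) = 0)) \<and>
     holo u 0 \<and> dep (insert n S) u \<and> u 0 \<noteq> 0 \<and>
     ev (\<lambda>z. g z = M z * ((\<Prod>i\<in>I. c i z) *
       (\<Prod>p\<in>J. c (fst p) z ^ (fact d div (d - fst p)) - c (snd p) z ^ (fact d div (d - snd p)))))"

text \<open>The bracket requires that the \<open>i\<close>-th coefficient be divisible by the
  \<open>(d - i)\<close>-th power of one monomial, with a unit quotient for some \<open>i\<close>.
  This monomial should be the smallest of the \<open>c i\<close> to the power
  \<open>1 / (d - i)\<close>. Minimality for divisibility comes from \<open>mon_compare\<close>, and
  ramification with \<open>N = fact d\<close> makes the fractional powers monomials.\<close>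

lemma resolvable_monomial_coeffs:
  fixes S :: "'d::finite set"
  assumes n: "n \<notin> S"
    and IH: "\<And>m M G. m < d \<Longrightarrow> holo M 0 \<Longrightarrow> dep S M \<Longrightarrow> \<not> ev (\<lambda>z. M z = 0) \<Longrightarrow>
      holo G 0 \<Longrightarrow> dep (insert n S) G \<Longrightarrow> Reg n S m G \<Longrightarrow> resolvable (insert n S) (\<lambda>z. M z * G z)"
    and I: "I \<subseteq> {..<d - 1}" "J \<subseteq> I \<times> I"
    and g: "MU S g" and data: "coeff_data S n d I J g M c u"
  shows "resolvable (insert n S) (\<lambda>z. M z * ((\<Sum>i<d - 1. c i z * z $ n ^ i) + z $ n ^ d * u z))"
proof -
  let ?T = "insert n S"
  let ?e = "\<lambda>i. fact d div (d - i) :: nat"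
  let ?PI = "\<lambda>z. \<Prod>i\<in>I. c i z"
  let ?D = "\<lambda>p z. c (fst p) z ^ ?e (fst p) - c (snd p) z ^ ?e (snd p)"
  let ?PJ = "\<lambda>z. \<Prod>p\<in>J. ?D p z"
  have M: "holo M 0" "dep S M" and c: "\<And>i. i < d - 1 \<Longrightarrow> holo (c i) 0 \<and> dep S (c i)"
    and c0: "\<And>i. i < d - 1 \<Longrightarrow> i \<notin> I \<Longrightarrow> ev (\<lambda>z. c i z = 0)"
    and D0: "\<And>i k. i \<in> I \<Longrightarrow> k \<in> I \<Longrightarrow> (i, k) \<notin> J \<Longrightarrow> ev (\<lambda>z. c i z ^ ?e i - c k z ^ ?e k = 0)"
    and u: "holo u 0" "dep ?T u" "u 0 \<noteq> 0" and g_eq: "ev (\<lambda>z. g z = M z * (?PI z * ?PJ z))"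
    using data unfolding coeff_data_def by auto
  have fin: "finite I" "finite J"
    using finite_subset[OF I(1)] finite_subset[OF I(2)] by auto
  have cI: "holo (c i) 0" "dep S (c i)" if "i \<in> I" for i using c I(1) that by auto
  have hPI: "holo ?PI 0" by (intro holo_prod cI)
  have hD: "holo (?D p) 0" if "p \<in> J" for p
    using that I(2) by (intro holo_diff holo_power cI) auto
  then have hPJ: "holo ?PJ 0" by (intro holo_prod)
  have MUall: "MU S (\<lambda>z. M z * (?PI z * ?PJ z))" by (rule MU_cong[OF g_eq g])
  have MUM: "MU S M"
    by (rule MU_factor[OF M(1) holo_mult[OF hPI hPJ] MUall])
  have MUIJ: "MU S (\<lambda>z. ?PI z * ?PJ z)"
    by (rule MU_factor[OF holo_mult[OF hPI hPJ] M(1)]) (use MUall in \<open>simp add: mult.commute\<close>)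
  have "MU S ?PI" by (rule MU_factor[OF hPI hPJ MUIJ])
  then have MUc: "MU S (c i)" if "i \<in> I" for i
    using MU_prod_factor[of I c S i] fin cI that by blast
  have "MU S ?PJ" by (rule MU_factor[OF hPJ hPI]) (use MUIJ in \<open>simp add: mult.commute\<close>)
  then have MUD: "MU S (?D p)" if "p \<in> J" for p
    using MU_prod_factor[of J ?D S p] fin hD that by blast
  obtain a v where v: "holo v 0" "dep S v" "v 0 \<noteq> 0" and Mv: "ev (\<lambda>z. M z = mon S a z * v z)"
    using MU_dep[OF MUM M(2)] by blast
  show ?thesis
  proof (cases "I = {}")
    case True
    have "ev (\<lambda>z. \<forall>i\<in>{..<d - 1}. c i z = 0)"
      using c0 True by (intro eventually_ball_finite) auto
    then have "ev (\<lambda>z. M z * (z $ n ^ d * u z) = M z * ((\<Sum>i<d - 1. c i z * z $ n ^ i) + z $ n ^ d * u z))"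
      by eventually_elim simp
    moreover have "MU ?T (\<lambda>z. M z * (z $ n ^ d * u z))"
      by (rule MU_mult[OF MU_superset[OF MUM] MU_mult[OF MU_power[OF MU_coord] MU_unit[OF u(1,3)]]]) auto
    ultimately show ?thesis by (intro resolvable.MU) (rule MU_cong)
  next
    case False
    have "\<forall>i\<in>I. \<exists>\<gamma> w. holo w 0 \<and> dep S w \<and> w 0 \<noteq> 0 \<and> ev (\<lambda>z. c i z = mon S \<gamma> z * w z)"
      using MU_dep[OF MUc cI(2)] by metis
    then obtain \<gamma> w where w: "\<And>i. i \<in> I \<Longrightarrow> holo (w i) 0 \<and> dep S (w i) \<and> w i 0 \<noteq> 0"
      and cw: "\<And>i. i \<in> I \<Longrightarrow> ev (\<lambda>z. c i z = mon S (\<gamma> i) z * w i z)"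
      by metis
    \<comment> \<open>The exponents of \<open>c i ^ (fact d div (d - i))\<close>, that is, of the
      \<open>(d - i)\<close>-th root of \<open>c i\<close> scaled by \<open>fact d\<close>.\<close>
    define \<delta> where "\<delta> i k = ?e i * \<gamma> i k" for i k
    have compare: "(\<forall>s\<in>S. \<delta> i s \<le> \<delta> k s) \<or> (\<forall>s\<in>S. \<delta> k s \<le> \<delta> i s)" if ik: "i \<in> I" "k \<in> I" for i k
    proof -
      have diff: "ev (\<lambda>z. c i z ^ ?e i - c k z ^ ?e k =
          mon S (\<delta> i) z * w i z ^ ?e i - mon S (\<delta> k) z * w k z ^ ?e k)"
        using cw[OF ik(1)] cw[OF ik(2)]
        by eventually_elim (simp add: power_mult_distrib mon_power \<delta>_def[abs_def])
      obtain b r x where r: "holo r 0" "r 0 \<noteq> 0"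
        and eq: "ev (\<lambda>z. c i z ^ ?e i - c k z ^ ?e k = of_bool x * (mon S b z * r z))"
      proof (cases "(i, k) \<in> J")
        case True
        then obtain b r where "holo r 0" "r 0 \<noteq> 0" "ev (\<lambda>z. c i z ^ ?e i - c k z ^ ?e k = mon S b z * r z)"
          using MUD[OF True] unfolding MU_def by auto
        then show ?thesis using that[of r True b] by simp
      next
        case False
        show ?thesis
          using that[of "\<lambda>_. 1" False "\<lambda>_. 0"] D0[OF ik False] by simp
      qed
      have "ev (\<lambda>z. mon S (\<delta> i) z * w i z ^ ?e i - mon S (\<delta> k) z * w k z ^ ?e k = of_bool x * (mon S b z * r z))"
        using diff eq by eventually_elim simp
      then show ?thesis
        using w[OF ik(1)] w[OF ik(2)] r
        by (intro mon_compare[where u="\<lambda>z. w i z ^ ?e i" and v="\<lambda>z. w k z ^ ?e k" and w=r]) auto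
    qed
    obtain i0 where i0: "i0 \<in> I" "\<And>i. i \<in> I \<Longrightarrow> (\<Sum>s\<in>S. \<delta> i0 s) \<le> (\<Sum>s\<in>S. \<delta> i s)"
      using arg_min_if_finite[OF fin(1) False, of "\<lambda>i. \<Sum>s\<in>S. \<delta> i s"] by (metis not_le)
    \<comment> \<open>As divisibility is total, an element of least degree divides all the
      others.\<close>
    have min: "\<delta> i0 s \<le> \<delta> i s" if "i \<in> I" "s \<in> S" for i s
    proof (rule ccontr)
      assume neg: "\<not> \<delta> i0 s \<le> \<delta> i s"
      then have "\<forall>s\<in>S. \<delta> i s \<le> \<delta> i0 s" using compare[OF that(1) i0(1)] that(2) by blast
      then have "(\<Sum>s\<in>S. \<delta> i s) < (\<Sum>s\<in>S. \<delta> i0 s)"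
        using neg that(2) by (intro sum_strict_mono_ex1) (auto simp: not_le)
      then show False using i0(2)[OF that(1)] by simp
    qed
    define N :: nat where "N = fact d"
    have N: "N > 0" by (simp add: N_def)
    \<comment> \<open>After the ramification, the monomial of \<open>c i\<close> is the
      \<open>(d - i)\<close>-th power of the one with exponents \<open>\<delta> i\<close>.\<close>
    have Ne: "N * \<gamma> i s = (d - i) * \<delta> i s" if "i \<in> I" for i s
    proof -
      have "(d - i) dvd fact d" by (rule dvd_fact) (use that I(1) in auto)
      then show ?thesis by (simp add: N_def \<delta>_def)
    qed
    let ?\<phi> = "coord_power S N" and ?K = "{z :: complex ^ 'd. \<forall>i. norm (z $ i) \<le> 1}"
    have ch: "chart S ?\<phi> ?K" by (rule chart_coord_power[OF compact_polydisc])
    have \<phi>0: "?\<phi> 0 = 0" using N by (simp add: vec_eq_iff coord_power_nth)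
    have q0: "q = 0" if "?\<phi> q = 0" for q
    proof -
      have "q $ i = 0" for i
        using arg_cong[OF that, of "\<lambda>v. v $ i"] N by (auto simp: coord_power_nth split: if_splits)
      then show ?thesis by (simp add: vec_eq_iff)
    qed
    have K0: "0 \<in> ?K" by simp
    note hp = chart_holo[OF ch K0 \<phi>0, simplified add_0] and ep = chart_ev[OF ch K0 \<phi>0, simplified add_0]
    have dp: "dep T (\<lambda>z. F (?\<phi> z))" if "dep T F" "S \<subseteq> T" for T F
      using chart_dep[OF ch that, of 0] by simp
    \<comment> \<open>The quotient of the ramified \<open>c i\<close> by
      \<open>mon S (\<delta> i0) z ^ (d - i)\<close>, times the unit \<open>v\<close> of
      \<open>M\<close>. The natural-number difference is exact by \<open>min\<close>, and for
      \<open>i = i0\<close> it is 0, so \<open>w' i0\<close> is a unit. Coefficients outside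
      \<open>I\<close> are zero germs.\<close>
    define w' where "w' i z = (if i \<in> I then v (?\<phi> z) * mon S (\<lambda>s. \<delta> i s - \<delta> i0 s) z ^ (d - i) * w i (?\<phi> z) else 0)" for i z
    define u' where "u' z = v (?\<phi> z) * u (?\<phi> z)" for z
    have w': "holo (w' i) 0 \<and> dep S (w' i)" for i
    proof (cases "i \<in> I")
      case True
      then show ?thesis
        unfolding w'_def[abs_def] using w[OF True] v
        by (auto intro!: holo_mult holo_power holo_mon hp dep_mult dep_power dep_mon dp)
    qed (simp add: w'_def[abs_def])
    have u': "holo u' 0" "dep ?T u'" "u' 0 \<noteq> 0"
      unfolding u'_def[abs_def] using u v
      by (auto intro!: holo_mult hp dep_mult dp simp: \<phi>0 intro: dep_mono)
    have w'0: "w' i0 0 \<noteq> 0"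
      using i0(1) w[OF i0(1)] v by (simp add: w'_def \<phi>0)
    have Res': "resolvable ?T (\<lambda>z. mon S (\<lambda>s. N * a s) z * bracket S n d w' (\<delta> i0) u' z)"
      using i0(1) I(1) by (intro resolvable_bracket[where d=d and w=w' and ?i0.0=i0] n IH w' w'0 u') auto
    let ?F = "\<lambda>z. M z * ((\<Sum>i<d - 1. c i z * z $ n ^ i) + z $ n ^ d * u z)"
    have "ev (\<lambda>z. \<forall>i\<in>{..<d - 1}. c i z = (if i \<in> I then mon S (\<gamma> i) z * w i z else 0))"
    proof (intro eventually_ball_finite ballI)
      fix i assume "i \<in> {..<d - 1}"
      then show "ev (\<lambda>z. c i z = (if i \<in> I then mon S (\<gamma> i) z * w i z else 0))"
        using cw[of i] c0[of i] by (cases "i \<in> I") auto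
    qed simp
    from ep[OF this] ep[OF Mv]
    have "ev (\<lambda>z. mon S (\<lambda>s. N * a s) z * bracket S n d w' (\<delta> i0) u' z = ?F (?\<phi> z))"
    proof eventually_elim
      case (elim z)
      have \<phi>n: "?\<phi> z $ n = z $ n" using n by (simp add: coord_power_nth)
      have "v (?\<phi> z) * c i (?\<phi> z) = mon S (\<delta> i0) z ^ (d - i) * w' i z" if i: "i \<in> {..<d - 1}" for i
      proof (cases "i \<in> I")
        case True
        have "mon S (\<gamma> i) (?\<phi> z) = mon S (\<delta> i) z ^ (d - i)"
          unfolding mon_coord_power mon_power by (simp add: Ne[OF True])
        also have "mon S (\<delta> i) z = mon S (\<delta> i0) z * mon S (\<lambda>s. \<delta> i s - \<delta> i0 s) z"
          unfolding mon_add[symmetric] by (rule mon_cong) (use min[OF True] in simp)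
        finally show ?thesis
          using elim(1) i True by (simp add: w'_def power_mult_distrib mult_ac)
      next
        case False
        then show ?thesis using elim(1) i by (simp add: w'_def)
      qed
      then have "(\<Sum>i<d - 1. mon S (\<delta> i0) z ^ (d - i) * w' i z * z $ n ^ i) =
          v (?\<phi> z) * (\<Sum>i<d - 1. c i (?\<phi> z) * z $ n ^ i)"
        unfolding sum_distrib_left by (intro sum.cong) (auto simp: mult.assoc)
      then show ?case
        unfolding bracket_def u'_def \<phi>n elim(2) mon_coord_power by (simp add: algebra_simps)
    qed
    from resolvable_cong[OF Res' this] have ResF: "resolvable ?T (\<lambda>z. ?F (?\<phi> z))" .
    show ?thesis
    proof (rule resolvable_chart[OF chart_mono[OF ch]])
      show "ev (\<lambda>x. x \<in> ?\<phi> ` ?K)"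
        using ev_small[of 1, OF zero_less_one] by eventually_elim (rule coord_power_cover[OF N])
      fix q assume "?\<phi> q = 0"
      then have "q = 0" by (rule q0)
      then show "resolvable ?T (\<lambda>z. ?F (?\<phi> (q + z)))" using ResF by simp
    qed auto
  qed
qed

text \<open>Induction along the resolution of \<open>g\<close>. Its charts fix \<open>z $ n\<close>,
  so pulling back changes only the coefficients, and \<open>coeff_data\<close> is stable under
  pullback. The conclusion quantifies over \<open>M\<close>, \<open>c\<close> and \<open>u\<close>
  because every chart replaces them.\<close>

lemma resolvable_resolve_coeffs:
  fixes S :: "'d::finite set"
  assumes n: "n \<notin> S"
    and IH: "\<And>m M G. m < d \<Longrightarrow> holo M 0 \<Longrightarrow> dep S M \<Longrightarrow> \<not> ev (\<lambda>z. M z = 0) \<Longrightarrow>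
      holo G 0 \<Longrightarrow> dep (insert n S) G \<Longrightarrow> Reg n S m G \<Longrightarrow> resolvable (insert n S) (\<lambda>z. M z * G z)"
    and I: "I \<subseteq> {..<d - 1}" "J \<subseteq> I \<times> I"
    and g: "resolvable S g"
  shows "\<forall>M c u. coeff_data S n d I J g M c u \<longrightarrow>
    resolvable (insert n S) (\<lambda>z. M z * ((\<Sum>i<d - 1. c i z * z $ n ^ i) + z $ n ^ d * u z))"
  using g
proof (induction rule: resolvable.induct)
  case (MU g)
  show ?case
  proof (intro allI impI)
    fix M c u assume data: "coeff_data S n d I J g M c u"
    show "resolvable (insert n S) (\<lambda>z. M z * ((\<Sum>i<d - 1. c i z * z $ n ^ i) + z $ n ^ d * u z))"
      by (rule resolvable_monomial_coeffs[OF n _ I MU data]) (rule IH; assumption)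
  qed
next
  case (cover \<Phi> g)
  let ?T = "insert n S"
  show ?case
  proof (intro allI impI)
    fix M c u assume data: "coeff_data S n d I J g M c u"
    let ?F = "\<lambda>z. M z * ((\<Sum>i<d - 1. c i z * z $ n ^ i) + z $ n ^ d * u z)"
    show "resolvable ?T ?F"
    proof (rule resolvable.cover[OF cover.hyps(1) _ cover.hyps(3)])
      fix \<phi> K assume "(\<phi>, K) \<in> \<Phi>"
      then show "chart ?T \<phi> K" using chart_mono[OF cover.hyps(2)] by blast
    next
      fix \<phi> K q assume q: "(\<phi>, K) \<in> \<Phi>" "q \<in> K" "\<phi> q = 0"
      note ch = cover.hyps(2)[OF q(1)]
      note hp = chart_holo[OF ch q(2,3)] and ep = chart_ev[OF ch q(2,3)]
      have dp: "dep T (\<lambda>z. F (\<phi> (q + z)))" if "dep T F" "S \<subseteq> T" for T F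
        using chart_dep[OF ch that] .
      have "coeff_data S n d I J (\<lambda>z. g (\<phi> (q + z))) (\<lambda>z. M (\<phi> (q + z))) (\<lambda>i z. c i (\<phi> (q + z))) (\<lambda>z. u (\<phi> (q + z)))"
        unfolding coeff_data_def
      proof (intro conjI allI impI ballI)
        show "holo (\<lambda>z. M (\<phi> (q + z))) 0" "dep S (\<lambda>z. M (\<phi> (q + z)))"
          using data hp dp unfolding coeff_data_def by blast+
        show "holo (\<lambda>z. u (\<phi> (q + z))) 0" "dep ?T (\<lambda>z. u (\<phi> (q + z)))"
          using data hp dp unfolding coeff_data_def by blast+
        show "u (\<phi> (q + 0)) \<noteq> 0" using data q(3) by (simp add: coeff_data_def)
        fix i assume i: "i < d - 1"
        show "holo (\<lambda>z. c i (\<phi> (q + z))) 0" "dep S (\<lambda>z. c i (\<phi> (q + z)))"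
          using data hp dp i unfolding coeff_data_def by blast+
        assume iI: "i \<notin> I"
        have "ev (\<lambda>z. c i z = 0)" using data i iI unfolding coeff_data_def by blast
        then show "ev (\<lambda>z. c i (\<phi> (q + z)) = 0)" by (rule ep)
      next
        fix i k assume ik: "i \<in> I" "k \<in> I" "(i, k) \<notin> J"
        have "ev (\<lambda>z. c i z ^ (fact d div (d - i)) - c k z ^ (fact d div (d - k)) = 0)"
          using data ik unfolding coeff_data_def by blast
        then show "ev (\<lambda>z. c i (\<phi> (q + z)) ^ (fact d div (d - i)) - c k (\<phi> (q + z)) ^ (fact d div (d - k)) = 0)"
          by (rule ep)
      next
        have "ev (\<lambda>z. g z = M z * ((\<Prod>i\<in>I. c i z) *
          (\<Prod>p\<in>J. c (fst p) z ^ (fact d div (d - fst p)) - c (snd p) z ^ (fact d div (d - snd p)))))"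
          using data unfolding coeff_data_def by blast
        then show "ev (\<lambda>z. g (\<phi> (q + z)) = M (\<phi> (q + z)) * ((\<Prod>i\<in>I. c i (\<phi> (q + z))) *
          (\<Prod>p\<in>J. c (fst p) (\<phi> (q + z)) ^ (fact d div (d - fst p)) - c (snd p) (\<phi> (q + z)) ^ (fact d div (d - snd p)))))"
          by (rule ep)
      qed
      from cover.IH[OF q, rule_format, OF this]
      show "resolvable ?T (\<lambda>z. ?F (\<phi> (q + z)))"
        by (simp add: chart_fix[OF ch q(3) n])
    qed
  qed
qed

text \<open>\<open>\<psi>\<close> is known to be holomorphic near the origin only; this suffices
  since the origin is the only point over the origin. The shear by \<open>- \<psi>\<close> is a
  right inverse, as \<open>\<psi>\<close> does not see \<open>z $ n\<close>, and it maps a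
  neighbourhood of the origin into \<open>K\<close>.\<close>

lemma chart_shear:
  fixes \<psi> :: "complex ^ 'd \<Rightarrow> complex"
  assumes n: "n \<notin> S" and \<psi>: "holo \<psi> 0" "dep S \<psi>" "\<psi> 0 = 0"
  obtains K where "chart (insert n S) (shear n \<psi>) K" "ev (\<lambda>x. x \<in> shear n \<psi> ` K)"
    "\<And>q. shear n \<psi> q = 0 \<Longrightarrow> q = 0"
proof -
  obtain r where r: "r > 0" "\<And>z. z \<in> ball 0 r \<Longrightarrow> cdiff \<psi> z"
    using holo_open \<psi>(1) by blast
  define K where "K = cball (0 :: complex ^ 'd) (r / 2)"
  have inj: "q = 0" if "shear n \<psi> q = 0" for q
  proof -
    have qi: "q $ i = 0" if "i \<noteq> n" for i
      using arg_cong[OF \<open>shear n \<psi> q = 0\<close>, of "\<lambda>v. v $ i"] that by (simp add: shear_nth)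
    have "\<psi> q = \<psi> 0" proof (rule dep_eq[OF \<psi>(2)])
      fix i assume "i \<in> S"
      then have "i \<noteq> n" using n by blast
      then show "q $ i = 0 $ i" by (simp add: qi)
    qed
    then have "q $ n = 0"
      using arg_cong[OF \<open>shear n \<psi> q = 0\<close>, of "\<lambda>v. v $ n"] \<psi>(3) by (simp add: shear_nth)
    with qi show "q = 0" by (metis vec_eq_iff zero_index)
  qed
  have "chart (insert n S) (shear n \<psi>) K"
    unfolding chart_def
  proof (intro conjI ballI allI impI)
    show "compact K" by (simp add: K_def)
    have "continuous_on K \<psi>"
      by (rule continuous_on_cdiff) (use r in \<open>auto simp: K_def\<close>)
    then show "continuous_on K (shear n \<psi>)"
      unfolding shear_def[abs_def] by (intro continuous_on_add continuous_on_id axis_cont)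
  next
    fix q assume "shear n \<psi> q = 0"
    then show "vholo (shear n \<psi>) q" using inj vholo_shear[OF \<psi>(1)] by blast
  next
    fix i z assume "i \<notin> insert n S"
    then show "shear n \<psi> z $ i = z $ i" by (simp add: shear_nth)
  next
    fix i assume "i \<in> insert n S"
    then show "dep (insert n S) (\<lambda>z. shear n \<psi> z $ i)"
      by (intro dep_shear[OF _ \<psi>(2)] dep_nth)
  qed
  moreover have "ev (\<lambda>x. x \<in> shear n \<psi> ` K)"
  proof -
    let ?inv = "shear n (\<lambda>z. - \<psi> z)"
    have inv: "vholo ?inv 0" "?inv 0 = 0"
      using vholo_shear[OF holo_uminus[OF \<psi>(1)]] by (simp_all add: shear_def \<psi>(3) axis_zero)
    have "ev (\<lambda>z. z \<in> ball (0 :: complex ^ 'd) (r / 2))"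
      using r(1) by (intro eventually_nhds_in_open) auto
    from ev_compose[OF this inv]
    have "ev (\<lambda>x. ?inv x \<in> ball 0 (r / 2))" .
    then show ?thesis
    proof eventually_elim
      case (elim x)
      have "\<psi> (?inv x) = \<psi> x"
        by (rule dep_eq[OF \<psi>(2)]) (use n in \<open>auto simp: shear_nth\<close>)
      then have "shear n \<psi> (?inv x) = x" by (simp add: vec_eq_iff shear_nth)
      moreover have "?inv x \<in> K" using elim by (simp add: K_def)
      ultimately show ?case by (metis imageI)
    qed
  qed
  ultimately show ?thesis using that inj by blast
qed

lemma not_ev_prod:
  assumes "finite I" "\<And>i. i \<in> I \<Longrightarrow> holo (F i) 0" "\<And>i. i \<in> I \<Longrightarrow> \<not> ev (\<lambda>z. F i z = 0)"
  shows "\<not> ev (\<lambda>z. (\<Prod>i\<in>I. F i z) = 0)"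
  using assms
proof (induction I rule: finite_induct)
  case (insert x I)
  have "holo (\<lambda>z. \<Prod>i\<in>I. F i z) 0" using insert by (intro holo_prod) auto
  then show ?case
    using holo_domain[of "F x" "\<lambda>z. \<Prod>i\<in>I. F i z"] insert by auto
qed (auto dest: eventually_nhds_x_imp_x)

text \<open>Induction on the order \<open>d\<close>. After the shear, the coefficients, their
  comparison and \<open>M\<close> are resolved simultaneously by applying \<open>dim\<close>, the
  resolution in fewer variables, to their product \<open>g\<close>. The factor \<open>M\<close> is
  carried along because each drop of the order leaves a monomial behind.\<close>

lemma resolvable_regular:
  fixes S :: "'d::finite set"
  assumes n: "n \<notin> S"
    and dim: "\<And>F. holo F 0 \<Longrightarrow> dep S F \<Longrightarrow> \<not> ev (\<lambda>z. F z = 0) \<Longrightarrow> resolvable S F"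
    and M: "holo M 0" "dep S M" "\<not> ev (\<lambda>z. M z = 0)"
    and G: "holo G 0" "dep (insert n S) G" "Reg n S d G"
  shows "resolvable (insert n S) (\<lambda>z. M z * G z)"
  using M G
proof (induction d arbitrary: M G rule: less_induct)
  case (less d)
  let ?T = "insert n S"
  let ?e = "\<lambda>i. fact d div (d - i) :: nat"
  have main: "resolvable ?T (\<lambda>z. M z * ((\<Sum>i<d - 1. c i z * z $ n ^ i) + z $ n ^ d * u z))"
    if c: "\<And>i. i < d - 1 \<Longrightarrow> holo (c i) 0 \<and> dep S (c i)" and u: "holo u 0" "dep ?T u" "u 0 \<noteq> 0" for c u
  proof -
    \<comment> \<open>Zero coefficients, and in \<open>J\<close> zero differences, are left out so
      that \<open>g\<close> is not the zero germ and \<open>dim\<close> applies to it.\<close>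
    define I where "I = {i. i < d - 1 \<and> \<not> ev (\<lambda>z. c i z = 0)}"
    let ?D = "\<lambda>p z. c (fst p) z ^ ?e (fst p) - c (snd p) z ^ ?e (snd p)"
    define J where "J = {p \<in> I \<times> I. \<not> ev (\<lambda>z. ?D p z = 0)}"
    have I: "I \<subseteq> {..<d - 1}" "J \<subseteq> I \<times> I" by (auto simp: I_def J_def)
    have fin: "finite I" "finite J"
      using finite_subset[OF I(1)] finite_subset[OF I(2)] by auto
    define g where "g z = M z * ((\<Prod>i\<in>I. c i z) * (\<Prod>p\<in>J. ?D p z))" for z
    have cI: "holo (c i) 0" "dep S (c i)" if "i \<in> I" for i using c I(1) that by auto
    have hD: "holo (?D p) 0" "dep S (?D p)" if "p \<in> J" for p
      using that I(2) by (auto intro!: holo_diff holo_power cI dep_diff dep_power)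
    have hP: "holo (\<lambda>z. \<Prod>i\<in>I. c i z) 0" "holo (\<lambda>z. \<Prod>p\<in>J. ?D p z) 0"
      using cI hD by (auto intro: holo_prod)
    have g: "holo g 0" "dep S g"
      unfolding g_def[abs_def] using less.prems hP cI hD
      by (auto intro!: holo_mult dep_mult dep_prod)
    have "\<not> ev (\<lambda>z. (\<Prod>i\<in>I. c i z) = 0)"
      by (rule not_ev_prod[OF fin(1)]) (use cI in \<open>auto simp: I_def\<close>)
    moreover have "\<not> ev (\<lambda>z. (\<Prod>p\<in>J. ?D p z) = 0)"
      by (rule not_ev_prod[OF fin(2)]) (use hD in \<open>auto simp: J_def\<close>)
    ultimately have "\<not> ev (\<lambda>z. (\<Prod>i\<in>I. c i z) * (\<Prod>p\<in>J. ?D p z) = 0)"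
      using holo_domain[OF hP] by blast
    then have "\<not> ev (\<lambda>z. g z = 0)"
      unfolding g_def using holo_domain[OF less.prems(1) holo_mult[OF hP]] less.prems(3) by blast
    then have "resolvable S g" using dim g by blast
    moreover have "coeff_data S n d I J g M c u"
      unfolding coeff_data_def using less.prems c u
      by (auto simp: I_def J_def g_def)
    moreover have "\<forall>M c u. coeff_data S n d I J g M c u \<longrightarrow>
        resolvable ?T (\<lambda>z. M z * ((\<Sum>i<d - 1. c i z * z $ n ^ i) + z $ n ^ d * u z))"
      if "resolvable S g"
      by (rule resolvable_resolve_coeffs[OF n _ I that]) (rule less.IH; assumption)
    ultimately show ?thesis by blast
  qed
  show ?case
  proof (cases d)
    case 0
    obtain u where u: "holo u 0" "dep ?T u" "u 0 \<noteq> 0" "ev (\<lambda>z. G z = u z)"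
      using less.prems(6) unfolding Reg_def 0 by auto
    have "resolvable ?T (\<lambda>z. M z * ((\<Sum>i<d - 1. 0 * z $ n ^ i) + z $ n ^ d * u z))"
      by (rule main[of "\<lambda>_ _. 0"]) (use u in auto)
    moreover have "ev (\<lambda>z. M z * ((\<Sum>i<d - 1. 0 * z $ n ^ i) + z $ n ^ d * u z) = M z * G z)"
      using u(4) by eventually_elim (simp add: 0)
    ultimately show ?thesis by (rule resolvable_cong)
  next
    case (Suc k)
    obtain \<psi> c u where \<psi>: "holo \<psi> 0" "dep S \<psi>" "\<psi> 0 = 0"
      and c: "\<And>i. i < k \<Longrightarrow> holo (c i) 0 \<and> dep S (c i)"
      and u: "holo u 0" "dep ?T u" "u 0 \<noteq> 0"
      and eq: "ev (\<lambda>z. G (shear n \<psi> z) = (\<Sum>i<k. c i z * z $ n ^ i) + z $ n ^ Suc k * u z)"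
      using Reg_shear[OF n less.prems(4,5)] less.prems(6) unfolding Suc by blast
    have "resolvable ?T (\<lambda>z. M z * ((\<Sum>i<d - 1. c i z * z $ n ^ i) + z $ n ^ d * u z))"
      by (rule main) (use c u Suc in auto)
    moreover have "ev (\<lambda>z. M z * ((\<Sum>i<d - 1. c i z * z $ n ^ i) + z $ n ^ d * u z) = M (shear n \<psi> z) * G (shear n \<psi> z))"
      using eq
    proof eventually_elim
      case (elim z)
      have "M (shear n \<psi> z) = M z"
        by (rule dep_eq[OF less.prems(2)]) (use n in \<open>auto simp: shear_nth\<close>)
      with elim show ?case by (simp add: Suc)
    qed
    ultimately have *: "resolvable ?T (\<lambda>z. M (shear n \<psi> z) * G (shear n \<psi> z))" by (rule resolvable_cong)
    obtain K where K: "chart ?T (shear n \<psi>) K" "ev (\<lambda>x. x \<in> shear n \<psi> ` K)"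
      "\<And>q. shear n \<psi> q = 0 \<Longrightarrow> q = 0"
      using chart_shear[OF n \<psi>] by blast
    show ?thesis
    proof (rule resolvable_chart[OF K(1,2)])
      fix q assume "shear n \<psi> q = 0"
      then have "q = 0" by (rule K(3))
      with * show "resolvable ?T (\<lambda>z. M (shear n \<psi> (q + z)) * G (shear n \<psi> (q + z)))" by simp
    qed
  qed
qed

section \<open>Induction on the number of variables\<close>

lemma line_order:
  fixes f :: "complex \<Rightarrow> complex"
  assumes "f holomorphic_on T" "open T" "connected T" "0 \<in> T" "1 \<in> T" "f 0 = 0" "f 1 \<noteq> 0"
  shows "\<exists>d L. L \<noteq> 0 \<and> ((\<lambda>s. f s / s ^ d) \<longlongrightarrow> L) (at 0)"
proof -
  have "\<not> f constant_on T"
  proof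
    assume "f constant_on T"
    then have "f 0 = f 1" using assms(4,5) by (auto simp: constant_on_def)
    with assms(6,7) show False by simp
  qed
  note factor = holomorphic_factor_zero_nonconstant[OF assms(1-4,6) this]
  obtain g r d where *: "0 < d" "0 < r" "ball 0 r \<subseteq> T" "g holomorphic_on ball 0 r"
    and fg: "\<And>w. w \<in> ball 0 r \<Longrightarrow> f w = (w - 0) ^ d * g w" and g0: "\<And>w. w \<in> ball 0 r \<Longrightarrow> g w \<noteq> 0"
    by (rule factor) blast
  have "((\<lambda>s. f s / s ^ d) \<longlongrightarrow> g 0) (at 0)"
  proof (rule Lim_transform_eventually)
    have "continuous_on (ball 0 r) g" by (rule holomorphic_on_imp_continuous_on[OF *(4)])
    then show "(g \<longlongrightarrow> g 0) (at 0)"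
      using *(2) unfolding continuous_on_eq_continuous_at[OF open_ball] isCont_def by simp
    have "\<forall>\<^sub>F s in at 0. s \<in> ball (0::complex) r"
      using *(2) by (intro eventually_at_in_open') auto
    then show "\<forall>\<^sub>F s in at 0. g s = f s / s ^ d"
      using eventually_neq_at_within[of 0] by eventually_elim (simp add: fg)
  qed
  then show ?thesis using g0[of 0] *(2) by auto
qed

text \<open>The linear map with \<open>axis n 1 \<mapsto> v\<close> that fixes the other basis
  vectors; it is invertible when \<open>v $ n \<noteq> 0\<close>.\<close>

definition lin :: "'d \<Rightarrow> complex ^ 'd \<Rightarrow> complex ^ 'd \<Rightarrow> complex ^ 'd" where
  "lin n v z = (\<chi> i. if i = n then v $ n * z $ n else z $ i + z $ n * v $ i)"

lemma lin_nth: "lin n v z $ i = (if i = n then v $ n * z $ n else z $ i + z $ n * v $ i)"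
  by (simp add: lin_def)

lemma vholo_lin: "vholo (lin n v) p"
  unfolding vholo_def lin_nth
proof
  fix i show "holo (\<lambda>z. if i = n then v $ n * z $ n else z $ i + z $ n * v $ i) p"
    by (cases "i = n") (auto intro!: holo_mult holo_add)
qed

text \<open>A nonzero germ that vanishes at the origin has finite order along some line through it.
  A linear change of coordinates moves this line to the \<open>n\<close>-axis, where
  \<open>Reg_axis\<close> makes the germ regular, and \<open>resolvable_regular\<close> reduces to
  the variables \<open>S - {n}\<close>.\<close>

lemma resolvable_germ:
  fixes S :: "'d::finite set" and F :: "complex ^ 'd \<Rightarrow> complex"
  assumes "holo F 0" "dep S F" "\<not> ev (\<lambda>z. F z = 0)"
  shows "resolvable S F"
  using assms
proof (induction "card S" arbitrary: S F rule: less_induct)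
  case less
  show ?case
  proof (cases "F 0 = 0")
    case False
    then show ?thesis using less.prems(1) by (intro resolvable.MU MU_unit)
  next
    case True
    obtain r where r: "r > 0" "\<And>z. z \<in> ball 0 r \<Longrightarrow> cdiff F z"
      using holo_open less.prems(1) by blast
    have "\<exists>z\<in>ball 0 r. F z \<noteq> 0"
    proof (rule ccontr)
      assume "\<not> ?thesis"
      then have "\<And>z. z \<in> ball 0 r \<Longrightarrow> F z = 0" by blast
      moreover have "ev (\<lambda>z. z \<in> ball (0 :: complex ^ 'd) r)"
        using r by (intro eventually_nhds_in_open) auto
      ultimately have "ev (\<lambda>z. F z = 0)" by (rule eventually_mono[rotated])
      then show False using less.prems(3) by blast
    qed
    then obtain z0 where z0: "z0 \<in> ball 0 r" "F z0 \<noteq> 0" by blast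
    \<comment> \<open>Projecting to \<open>S\<close> does not change \<open>F\<close>, and it
      ensures that \<open>lin n v\<close> moves only coordinates in \<open>S\<close>, as a chart
      must.\<close>
    define v where "v = proj S z0"
    have "norm v \<le> norm z0"
      by (rule norm_le_componentwise_cart) (auto simp: v_def proj_nth)
    then have v: "v \<in> ball 0 r" using z0 by simp
    have Fv: "F v \<noteq> 0" using z0(2) by (simp add: v_def dep_projD[OF less.prems(2)])
    then have "v \<noteq> 0" using True by auto
    then obtain n where n: "v $ n \<noteq> 0" by (metis vec_eq_iff zero_index)
    then have nS: "n \<in> S" by (auto simp: v_def proj_nth split: if_splits)
    define S' where "S' = S - {n}"
    have S: "S = insert n S'" "n \<notin> S'" using nS by (auto simp: S'_def)
    have vS: "v $ i = 0" if "i \<notin> S" for i using that by (simp add: v_def proj_nth)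
    let ?A = "lin n v"
    let ?K = "{z :: complex ^ 'd. \<forall>i. norm (z $ i) \<le> 1}"
    have ch: "chart S ?A ?K"
    proof (rule chartI[OF compact_polydisc vholo_lin])
      fix i z assume "i \<notin> S" then show "?A z $ i = z $ i"
        using vS nS by (auto simp: lin_nth)
    next
      fix i assume "i \<in> S" then show "dep S (\<lambda>z. ?A z $ i)"
        unfolding lin_nth using nS by (cases "i = n") (auto intro!: dep_mult dep_add dep_nth)
    qed
    define inv where "inv x = (\<chi> i. if i = n then x $ n / v $ n else x $ i - x $ n / v $ n * v $ i)" for x
    have A_inv: "?A (inv x) = x" for x
      using n by (auto simp: lin_def inv_def vec_eq_iff)
    have "vholo inv 0"
      unfolding vholo_def inv_def vec_lambda_beta
    proof
      fix i show "holo (\<lambda>x. if i = n then x $ n / v $ n else x $ i - x $ n / v $ n * v $ i) 0"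
        unfolding divide_inverse by (cases "i = n") (auto intro!: holo_mult holo_diff)
    qed
    moreover have "inv 0 = 0" by (simp add: inv_def vec_eq_iff)
    ultimately have "ev (\<lambda>x. \<forall>i. norm (inv x $ i) < 1)"
      by (rule ev_compose[OF ev_small[OF zero_less_one]])
    then have cov: "ev (\<lambda>x. x \<in> ?A ` ?K)"
    proof eventually_elim
      case (elim x)
      then have "inv x \<in> ?K" using less_imp_le by blast
      then show ?case using A_inv[of x] by (metis imageI)
    qed
    have A0: "q = 0" if "?A q = 0" for q
    proof -
      have qn: "q $ n = 0" using arg_cong[OF that, of "\<lambda>v. v $ n"] n by (simp add: lin_nth)
      have "q $ i = 0" for i
        using arg_cong[OF that, of "\<lambda>v. v $ i"] qn by (auto simp: lin_nth split: if_splits)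
      then show ?thesis by (simp add: vec_eq_iff)
    qed
    have A00: "?A 0 = 0" by (simp add: lin_def vec_eq_iff)
    let ?G = "\<lambda>z. F (?A z)"
    have hG: "holo ?G 0" using holo_compose[OF vholo_lin, of F n v 0] A00 less.prems(1) by simp
    have dG: "dep (insert n S') ?G"
      using chart_dep[OF ch less.prems(2) subset_refl, of 0] S(1) by simp
    have "\<exists>d L. L \<noteq> 0 \<and> ((\<lambda>s. F (0 + s *s v) / s ^ d) \<longlongrightarrow> L) (at 0)"
    proof (rule line_order[where T="ball 0 (r / norm v)"])
      have nv: "norm v > 0" using \<open>v \<noteq> 0\<close> by simp
      have norm_sv: "norm (s *s v) = norm s * norm v" for s :: complex
      proof -
        have "norm (s *s v) = L2_set (\<lambda>i. norm s * norm (v $ i)) UNIV"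
          by (simp add: norm_vec_def norm_mult)
        also have "\<dots> = norm s * L2_set (\<lambda>i. norm (v $ i)) UNIV"
          by (simp add: L2_set_right_distrib)
        finally show ?thesis by (simp add: norm_vec_def)
      qed
      show "(\<lambda>s. F (0 + s *s v)) holomorphic_on ball 0 (r / norm v)"
        by (rule holomorphic_on_line, rule r(2)) (use nv in \<open>simp add: norm_sv field_simps\<close>)
      show "0 \<in> ball (0::complex) (r / norm v)" "1 \<in> ball (0::complex) (r / norm v)"
        using nv r v by (simp_all add: field_simps)
      show "F (0 + 0 *s v) = 0" "F (0 + 1 *s v) \<noteq> 0" using True Fv by simp_all
    qed auto
    then obtain d L where L: "L \<noteq> 0" "((\<lambda>s. F (s *s v) / s ^ d) \<longlongrightarrow> L) (at 0)" by auto
    have "?A (axis n s) = s *s v" for s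
      by (auto simp: lin_def axis_def vec_eq_iff)
    then have Reg: "Reg n S' d ?G"
      using Reg_axis[OF S(2) hG dG, of d L] L by simp
    have "resolvable S' G" if "holo G 0" "dep S' G" "\<not> ev (\<lambda>z. G z = 0)" for G
      by (rule less.hyps[OF _ that]) (unfold S'_def, rule card_Diff1_less[OF finite nS])
    then have "resolvable (insert n S') (\<lambda>z. 1 * ?G z)"
      by (rule resolvable_regular[OF S(2) _ holo_const dep_const _ hG dG Reg]) (auto dest: eventually_nhds_x_imp_x)
    then have "resolvable S ?G" using S(1) by simp
    then have "resolvable S (\<lambda>z. F (?A (q + z)))" if "?A q = 0" for q
      using A0[OF that] by simp
    then show ?thesis by (rule resolvable_chart[OF ch cov])
  qed
qed

theorem Lojasiewicz_complex:
  fixes F :: "complex ^ 'd \<Rightarrow> complex"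
  assumes "holo F 0" "F 0 = 0"
  shows "\<exists>k. ev (Loj k F)"
proof (cases "ev (\<lambda>z. F z = 0)")
  case True
  then have "ev (Loj 0 F)" by eventually_elim (simp add: Loj_def)
  then show ?thesis ..
next
  case False
  have "dep UNIV F" unfolding dep_def by (metis UNIV_I vec_eq_iff)
  then have "resolvable UNIV F" using resolvable_germ assms(1) False by blast
  then show ?thesis using resolvable_Loj assms by blast
qed

section \<open>Complexification of real power series\<close>

text \<open>Weierstrass' theorem: Cauchy's formula bounds the error of the gradients by that of the
  functions over the radius, so the gradients converge uniformly too, and the derivative of the
  limit is the limit of the derivatives.\<close>

lemma cdiff_uniform_limit:
  fixes F :: "complex ^ 'd \<Rightarrow> complex" and Fn :: "nat \<Rightarrow> complex ^ 'd \<Rightarrow> complex"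
  assumes \<rho>: "\<rho> > 0"
    and cd: "\<And>n z. cdiff (Fn n) z"
    and bound: "\<And>n z. \<forall>i. norm (z $ i) \<le> \<rho> \<Longrightarrow> norm (Fn n z - F z) \<le> \<epsilon> n"
    and \<epsilon>: "\<epsilon> \<longlonglongrightarrow> 0"
    and z: "\<forall>i. norm (z $ i) < \<rho> / 2"
  shows "cdiff F z"
proof -
  define U where "U = {z :: complex ^ 'd. \<forall>i. norm (z $ i) < \<rho> / 2}"
  define P where "P = {z :: complex ^ 'd. \<forall>i. norm (z $ i) \<le> \<rho>}"
  \<comment> \<open>Circles of radius \<open>\<rho> / 2\<close> around points of the half-sized
    polydisc \<open>U\<close> stay in the polydisc \<open>P\<close> of uniform convergence.\<close>
  define r where "r = \<rho> / 2"
  have r: "r > 0" using \<rho> by (simp add: r_def)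
  have openU: "open U"
  proof -
    have "U = (\<Inter>i. {z. norm (z $ i) < \<rho> / 2})" by (auto simp: U_def)
    then show ?thesis
      by (simp only:) (intro open_INT finite ballI open_Collect_less continuous_on_norm continuous_on_component
          continuous_on_id continuous_on_const)
  qed
  have "convex U"
  proof (rule convexI)
    fix x y :: "complex ^ 'd" and a b :: real
    assume xy: "x \<in> U" "y \<in> U" and ab: "0 \<le> a" "0 \<le> b" "a + b = 1"
    have "norm ((a *\<^sub>R x + b *\<^sub>R y) $ i) < \<rho> / 2" for i
    proof -
      have "a *\<^sub>R (x $ i) + b *\<^sub>R (y $ i) \<in> ball 0 (\<rho> / 2)"
        using xy ab by (intro convexD[OF convex_ball]) (auto simp: U_def)
      then show ?thesis by simp
    qed
    then show "a *\<^sub>R x + b *\<^sub>R y \<in> U" by (simp add: U_def)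
  qed
  have shift: "z + axis i s \<in> P" if "z \<in> U" "norm s \<le> r" for z i s
  proof -
    have "norm ((z + axis i s) $ j) \<le> \<rho>" for j
    proof -
      have "norm ((z + axis i s) $ j) \<le> norm (z $ j) + norm (axis i s $ j)"
        by (simp add: norm_triangle_ineq)
      also have "norm (axis i s $ j) \<le> norm s" by (simp add: axis_def)
      also have "norm (z $ j) + norm s \<le> \<rho>"
      proof -
        have "norm (z $ j) < \<rho> / 2" using that(1) by (simp add: U_def)
        then show ?thesis using that(2) by (simp add: r_def)
      qed
      finally show ?thesis by simp
    qed
    then show ?thesis by (simp add: P_def)
  qed
  have contF: "continuous_on P F"
  proof (rule uniform_limit_theorem[where f=Fn and F=sequentially])
    show "\<forall>\<^sub>F n in sequentially. continuous_on P (Fn n)"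
      by (intro always_eventually allI continuous_on_cdiff cd)
    show "uniform_limit P Fn F sequentially"
    proof (rule uniform_limitI)
      fix e :: real assume "e > 0"
      then have "\<forall>\<^sub>F n in sequentially. \<epsilon> n < e" using \<epsilon> by (auto intro: order_tendstoD)
      then show "\<forall>\<^sub>F n in sequentially. \<forall>x\<in>P. dist (Fn n x) (F x) < e"
      proof eventually_elim
        case (elim n)
        show ?case
        proof
          fix x assume "x \<in> P"
          then have "norm (Fn n x - F x) \<le> \<epsilon> n" by (intro bound) (simp add: P_def)
          then show "dist (Fn n x) (F x) < e" using elim by (simp add: dist_norm)
        qed
      qed
    qed
  qed simp
  define D where "D z = (\<chi> i. integral (cbox 0 1) (\<lambda>t. F (z + axis i (circ r t)) / circ r t))" for z
  have contI: "continuous_on (cbox 0 1) (\<lambda>t. H (z + axis i (circ r t)) / circ r t)"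
    if "continuous_on P H" "z \<in> U" for H :: "complex ^ 'd \<Rightarrow> complex" and z i
    by (intro continuous_on_divide continuous_on_compose2[OF that(1)] continuous_on_add continuous_on_const
        axis_cont circ_cont continuous_on_id) (use shift[OF that(2)] r in auto)
  have D: "norm (cgrad (Fn n) z $ i - D z $ i) \<le> \<epsilon> n / r" if z: "z \<in> U" for n z i
  proof -
    have eq: "cgrad (Fn n) z $ i - D z $ i =
        integral (cbox 0 1) (\<lambda>t. Fn n (z + axis i (circ r t)) / circ r t - F (z + axis i (circ r t)) / circ r t)"
      unfolding D_def vec_lambda_beta cgrad_Cauchy[OF r cd]
      by (rule integral_diff[symmetric]) (intro integrable_continuous contI contF continuous_on_cdiff cd z)+
    have "norm (integral (cbox 0 1) (\<lambda>t. Fn n (z + axis i (circ r t)) / circ r t - F (z + axis i (circ r t)) / circ r t))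
        \<le> \<epsilon> n / r * (1 - 0)"
      unfolding box_real
    proof (rule integral_bound)
      show "continuous_on {0..1} (\<lambda>t. Fn n (z + axis i (circ r t)) / circ r t - F (z + axis i (circ r t)) / circ r t)"
        using contI[OF contF z] contI[OF continuous_on_cdiff[of P "Fn n", OF cd] z]
        unfolding box_real by (intro continuous_on_diff)
      fix t :: real
      have "z + axis i (circ r t) \<in> P" by (rule shift[OF z]) (use r in simp)
      then have "norm (Fn n (z + axis i (circ r t)) - F (z + axis i (circ r t))) \<le> \<epsilon> n"
        using bound by (simp add: P_def)
      then show "norm (Fn n (z + axis i (circ r t)) / circ r t - F (z + axis i (circ r t)) / circ r t) \<le> \<epsilon> n / r"
        unfolding diff_divide_distrib[symmetric] norm_divide
        using r by (simp only: circ_norm[OF less_imp_le[OF r]] divide_right_mono less_imp_le[OF r])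
    qed simp
    then show ?thesis by (simp add: eq)
  qed
  have "\<exists>g. \<forall>x\<in>U. (\<lambda>n. Fn n x) \<longlonglongrightarrow> g x \<and> (g has_derivative cdot (D x)) (at x within U)"
  proof (rule has_derivative_sequence[OF \<open>convex U\<close>, where f'="\<lambda>n x. cdot (cgrad (Fn n) x)"])
    show "\<And>n x. x \<in> U \<Longrightarrow> (Fn n has_derivative cdot (cgrad (Fn n) x)) (at x within U)"
      by (rule has_derivative_at_withinI) (rule cdiffD[OF cd])
    show "z \<in> U" using z by (simp add: U_def)
    have zP: "\<forall>i. norm (z $ i) \<le> \<rho>"
    proof
      fix i have "norm (z $ i) < \<rho> / 2" using z by blast
      then show "norm (z $ i) \<le> \<rho>" using \<rho> by simp
    qed
    show "(\<lambda>n. Fn n z) \<longlonglongrightarrow> F z"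
      by (rule LIM_zero_cancel, rule Lim_null_comparison[OF _ \<epsilon>]) (use bound[OF zP] in auto)
    fix e :: real assume e: "e > 0"
    have "(\<lambda>n. real CARD('d) * (\<epsilon> n / r)) \<longlonglongrightarrow> real CARD('d) * (0 / r)"
      by (intro tendsto_intros \<epsilon>) (use r in simp)
    then have "\<forall>\<^sub>F n in sequentially. real CARD('d) * (\<epsilon> n / r) < e"
      using e by (auto intro: order_tendstoD)
    then show "\<forall>\<^sub>F n in sequentially. \<forall>x\<in>U. \<forall>h. norm (cdot (cgrad (Fn n) x) h - cdot (D x) h) \<le> e * norm h"
    proof eventually_elim
      case (elim n)
      show ?case
      proof (intro ballI allI)
        fix x h assume x: "x \<in> U"
        have "norm (cdot (cgrad (Fn n) x) h - cdot (D x) h) =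
            norm (\<Sum>i\<in>UNIV. (cgrad (Fn n) x $ i - D x $ i) * h $ i)"
          by (simp add: cdot_def sum_subtractf left_diff_distrib)
        also have "\<dots> \<le> (\<Sum>i\<in>(UNIV :: 'd set). \<epsilon> n / r * norm h)"
        proof (rule order.trans[OF norm_sum sum_mono])
          fix i
          show "norm ((cgrad (Fn n) x $ i - D x $ i) * h $ i) \<le> \<epsilon> n / r * norm h"
            unfolding norm_mult
            using D[OF x, of n i] order.trans[OF norm_ge_zero D[OF x, of n i]]
            by (intro mult_mono Finite_Cartesian_Product.norm_nth_le norm_ge_zero)
        qed
        also have "\<dots> = (real CARD('d) * (\<epsilon> n / r)) * norm h" by simp
        also have "\<dots> \<le> e * norm h" using elim by (intro mult_right_mono) auto
        finally show "norm (cdot (cgrad (Fn n) x) h - cdot (D x) h) \<le> e * norm h" .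
      qed
    qed
  qed
  then obtain g where g: "\<And>x. x \<in> U \<Longrightarrow> (\<lambda>n. Fn n x) \<longlonglongrightarrow> g x"
    "\<And>x. x \<in> U \<Longrightarrow> (g has_derivative cdot (D x)) (at x within U)" by blast
  have gF: "g x = F x" if x: "x \<in> U" for x
  proof -
    have xP: "\<forall>i. norm (x $ i) \<le> \<rho>"
    proof
      fix i have "norm (x $ i) < \<rho> / 2" using x by (simp add: U_def)
      then show "norm (x $ i) \<le> \<rho>" using \<rho> by simp
    qed
    have "(\<lambda>n. Fn n x) \<longlonglongrightarrow> F x"
      by (rule LIM_zero_cancel, rule Lim_null_comparison[OF _ \<epsilon>]) (use bound[OF xP] in auto)
    then show ?thesis using g(1)[OF x] LIMSEQ_unique by blast
  qed
  have zU: "z \<in> U" using z by (simp add: U_def)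
  have "(g has_derivative cdot (D z)) (at z)"
    using g(2)[OF zU] by (simp only: at_within_open[OF zU openU])
  then have "cdiff g z" unfolding cdiff_def by blast
  moreover have "\<forall>\<^sub>F x in nhds z. x \<in> U" by (rule eventually_nhds_in_open[OF openU zU])
  then have "\<forall>\<^sub>F x in nhds z. g x = F x" by eventually_elim (rule gF)
  ultimately show ?thesis using cdiff_cong_ev[of g F z] by simp
qed

definition mterm :: "(('d \<Rightarrow> nat) \<Rightarrow> real) \<Rightarrow> complex ^ 'd \<Rightarrow> ('d \<Rightarrow> nat) \<Rightarrow> complex" where
  "mterm c z \<alpha> = of_real (c \<alpha>) * (\<Prod>i\<in>UNIV. z $ i ^ \<alpha> i)"

text \<open>Abel's argument: convergence at the one real point with all coordinates
  \<open>\<rho>\<close> is absolute and dominates the series on the whole complex polydisc, which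
  makes the convergence uniform.\<close>

lemma power_series_cdiff:
  fixes c :: "('d::finite \<Rightarrow> nat) \<Rightarrow> real"
  assumes \<rho>: "\<rho> > 0" and sum: "(\<lambda>\<alpha>. c \<alpha> * (\<Prod>i\<in>UNIV. \<rho> ^ \<alpha> i)) summable_on UNIV"
    and z: "\<forall>i. norm (z $ i) < \<rho> / 2"
  shows "cdiff (\<lambda>z. infsum (mterm c z) UNIV) z"
proof -
  define b where "b \<alpha> = \<bar>c \<alpha>\<bar> * (\<Prod>i\<in>UNIV. \<rho> ^ \<alpha> i)" for \<alpha> :: "'d \<Rightarrow> nat"
  have "(\<lambda>\<alpha>. norm (c \<alpha> * (\<Prod>i\<in>UNIV. \<rho> ^ \<alpha> i))) summable_on UNIV"
    using sum by (rule summable_on_iff_abs_summable_on_real[THEN iffD1])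
  moreover have "norm (c \<alpha> * (\<Prod>i\<in>UNIV. \<rho> ^ \<alpha> i)) = b \<alpha>" for \<alpha>
    using \<rho> by (simp add: b_def abs_mult abs_prod)
  ultimately have b: "b summable_on UNIV" by simp
  have tb: "norm (mterm c z \<alpha>) \<le> b \<alpha>" if "\<forall>i. norm (z $ i) \<le> \<rho>" for z :: "complex ^ 'd" and \<alpha>
    unfolding mterm_def b_def norm_mult norm_of_real prod_norm[symmetric] norm_power
    using that by (intro mult_left_mono prod_mono) (auto intro: power_mono)
  have ts: "(\<lambda>\<alpha>. norm (mterm c z \<alpha>)) summable_on A" if "\<forall>i. norm (z $ i) \<le> \<rho>" for z :: "complex ^ 'd" and A
  proof (rule summable_on_comparison_test)
    show "b summable_on A" using summable_on_subset_banach[OF b] by blast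
  qed (use tb[OF that] in auto)
  \<comment> \<open>Boxes of multi-indices form a sequence cofinal in the finite sets, so unordered
    summation becomes a limit of a sequence of polynomials.\<close>
  define A where "A n = {\<alpha> :: 'd \<Rightarrow> nat. \<forall>i. \<alpha> i < n}" for n
  have finA: "finite (A n)" for n
  proof -
    have "A n = (PiE UNIV (\<lambda>_. {..<n}))" by (auto simp: A_def)
    then show ?thesis by (simp add: finite_PiE)
  qed
  have lim: "filterlim A (finite_subsets_at_top UNIV) sequentially"
    unfolding filterlim_finite_subsets_at_top
  proof (intro allI impI)
    fix X :: "('d \<Rightarrow> nat) set" assume X: "finite X \<and> X \<subseteq> UNIV"
    define m where "m = Max (insert 0 ((\<lambda>(\<alpha>, i). \<alpha> i) ` (X \<times> (UNIV :: 'd set))))"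
    have le: "\<alpha> i \<le> m" if "\<alpha> \<in> X" for \<alpha> i
    proof -
      have "\<alpha> i = (\<lambda>(\<alpha>, i). \<alpha> i) (\<alpha>, i)" by simp
      also have "\<dots> \<in> (\<lambda>(\<alpha>, i). \<alpha> i) ` (X \<times> (UNIV :: 'd set))" using that by blast
      finally show ?thesis unfolding m_def using X by (intro Max_ge) simp_all
    qed
    have "X \<subseteq> A n" if "n > m" for n
    proof
      fix \<alpha> assume "\<alpha> \<in> X"
      then have "\<alpha> i < n" for i using le_less_trans[OF le that] by blast
      then show "\<alpha> \<in> A n" by (simp add: A_def)
    qed
    then show "\<forall>\<^sub>F n in sequentially. finite (A n) \<and> X \<subseteq> A n \<and> A n \<subseteq> UNIV"
      using finA by (intro eventually_mono[OF eventually_gt_at_top[of m]]) auto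
  qed
  define \<epsilon> where "\<epsilon> n = infsum b UNIV - sum b (A n)" for n
  have "(sum b \<longlongrightarrow> infsum b UNIV) (finite_subsets_at_top UNIV)"
    using has_sum_infsum[OF b] by (simp add: has_sum_def)
  then have "(\<lambda>n. sum b (A n)) \<longlonglongrightarrow> infsum b UNIV"
    by (rule filterlim_compose[OF _ lim])
  then have \<epsilon>: "\<epsilon> \<longlonglongrightarrow> 0"
    unfolding \<epsilon>_def[abs_def]
    using tendsto_diff[OF tendsto_const[of "infsum b UNIV"], of "\<lambda>n. sum b (A n)" "infsum b UNIV"] by simp
  show ?thesis
  proof (rule cdiff_uniform_limit[OF \<rho> _ _ \<epsilon> z])
    show "cdiff (\<lambda>z. sum (mterm c z) (A n)) z" for n z
    proof -
      have "holo (\<lambda>z. sum (mterm c z) (A n)) z"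
        unfolding mterm_def by (intro holo_sum holo_mult holo_const holo_prod holo_power holo_nth)
      then show ?thesis unfolding holo_def by (rule eventually_nhds_x_imp_x)
    qed
  next
    fix n and z :: "complex ^ 'd" assume z: "\<forall>i. norm (z $ i) \<le> \<rho>"
    have s: "mterm c z summable_on B" for B by (rule abs_summable_summable[OF ts[OF z]])
    have "infsum (mterm c z) UNIV = infsum (mterm c z) (A n) + infsum (mterm c z) (- A n)"
      using infsum_Un_disjoint[OF s s, of "A n" "- A n"] by simp
    then have "norm (sum (mterm c z) (A n) - infsum (mterm c z) UNIV) = norm (infsum (mterm c z) (- A n))"
      using finA by (simp add: norm_minus_commute)
    also have "\<dots> \<le> infsum (\<lambda>\<alpha>. norm (mterm c z \<alpha>)) (- A n)"
      by (rule norm_infsum_bound[OF ts[OF z]])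
    also have "\<dots> \<le> infsum b (- A n)"
      by (rule infsum_mono[OF ts[OF z]]) (use tb[OF z] summable_on_subset_banach[OF b] in auto)
    also have "infsum b (- A n) = \<epsilon> n"
    proof -
      have sb: "b summable_on B" for B using summable_on_subset_banach[OF b] by blast
      have "infsum b UNIV = infsum b (A n) + infsum b (- A n)"
        using infsum_Un_disjoint[OF sb sb, of "A n" "- A n"] by simp
      then show ?thesis using finA by (simp add: \<epsilon>_def)
    qed
    finally show "norm (sum (mterm c z) (A n) - infsum (mterm c z) UNIV) \<le> \<epsilon> n" .
  qed
qed

text \<open>The same series in complex variables, centred at \<open>a\<close> and lowered by
  \<open>f a\<close>, is a germ \<open>F\<close> vanishing at the origin. At real points its value
  is \<open>f x - f a\<close> and its gradient is the real one, so the inequality for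
  \<open>F\<close> restricts.\<close>

lemma real_analytic_Lojasiewicz:
  fixes f :: "real ^ 'd \<Rightarrow> real" and g :: "real ^ 'd \<Rightarrow> real ^ 'd"
  assumes an: "real_analytic f" and grad: "\<And>x. GDERIV f x :> g x"
  shows "\<exists>k::nat. \<forall>\<^sub>F x in nhds a.
    \<bar>f x - f a\<bar> \<le> 1 \<and> \<bar>f x - f a\<bar> powr (1 - 1 / (real k + 2)) \<le> real k * norm (g x)"
proof -
  obtain coef r where r: "r > 0" and f: "\<And>x. x \<in> ball a r \<Longrightarrow>
      ((\<lambda>\<alpha>. coef \<alpha> * (\<Prod>i\<in>UNIV. (x $ i - a $ i) ^ \<alpha> i)) has_sum f x) UNIV"
    using an unfolding real_analytic_def by metis
  \<comment> \<open>The point with all offsets \<open>\<rho>\<close> is at distance at most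
    \<open>CARD('d) * \<rho> = r / 2\<close> from \<open>a\<close>, inside the ball of
    convergence.\<close>
  define \<rho> where "\<rho> = r / (2 * real CARD('d))"
  have \<rho>: "\<rho> > 0" using r by (simp add: \<rho>_def)
  define x\<rho> where "x\<rho> = a + (\<chi> i. \<rho>)"
  have "norm ((\<chi> i. \<rho>) :: real ^ 'd) \<le> (\<Sum>i\<in>(UNIV :: 'd set). norm \<rho>)"
    unfolding norm_vec_def by (rule order.trans[OF L2_set_le_sum]) auto
  also have "\<dots> < r" using r by (simp add: \<rho>_def)
  finally have "x\<rho> \<in> ball a r" by (simp add: x\<rho>_def dist_norm)
  from has_sum_imp_summable[OF f[OF this]]
  have sum: "(\<lambda>\<alpha>. coef \<alpha> * (\<Prod>i\<in>UNIV. \<rho> ^ \<alpha> i)) summable_on UNIV"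
    by (simp add: x\<rho>_def)
  define F where "F z = infsum (mterm coef z) UNIV - of_real (f a)" for z
  have cd: "cdiff F z" if "\<forall>i. norm (z $ i) < \<rho> / 2" for z
    unfolding F_def by (intro cdiff_diff power_series_cdiff[OF \<rho> sum that] cdiff_const)
  have evF: "ev (\<lambda>z. cdiff F z)"
    by (rule eventually_mono[OF ev_small[of "\<rho> / 2"]]) (use \<rho> in \<open>auto intro: cd simp del: less_divide_eq_numeral1\<close>)
  define cx where "cx x = (\<chi> i. complex_of_real (x $ i - a $ i))" for x :: "real ^ 'd"
  have Fcx: "F (cx x) = of_real (f x - f a)" if "x \<in> ball a r" for x
  proof -
    have "(\<lambda>\<alpha>. complex_of_real (coef \<alpha> * (\<Prod>i\<in>UNIV. (x $ i - a $ i) ^ \<alpha> i))) = mterm coef (cx x)"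
      by (simp add: mterm_def cx_def fun_eq_iff)
    then have "(mterm coef (cx x) has_sum of_real (f x)) UNIV"
      using has_sum_of_real[OF f[OF that], where 'a=complex] by simp
    then show ?thesis by (simp add: F_def infsumI)
  qed
  have cxa: "cx a = 0" by (simp add: cx_def vec_eq_iff)
  have F0: "F 0 = 0" using Fcx[of a] r cxa by simp
  obtain k where k: "ev (Loj k F)"
    using Lojasiewicz_complex[of F] evF F0 unfolding holo_def by blast
  have lim: "(cx \<longlongrightarrow> 0) (nhds a)"
  proof (rule vec_tendstoI)
    fix i
    have "((\<lambda>x :: real ^ 'd. complex_of_real (x $ i - a $ i)) \<longlongrightarrow> of_real (a $ i - a $ i)) (nhds a)"
      by (intro tendsto_of_real tendsto_diff tendsto_vec_nth filterlim_ident tendsto_const)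
    then show "((\<lambda>x. cx x $ i) \<longlongrightarrow> 0 $ i) (nhds a)" by (simp add: cx_def)
  qed
  have "\<forall>\<^sub>F x in nhds a. Loj k F (cx x)" "\<forall>\<^sub>F x in nhds a. cdiff F (cx x)"
    using lim k evF unfolding filterlim_iff by blast+
  moreover have "\<forall>\<^sub>F x in nhds a. x \<in> ball a r" using r by (intro eventually_nhds_in_open) auto
  ultimately have "\<forall>\<^sub>F x in nhds a. \<bar>f x - f a\<bar> \<le> 1 \<and>
      \<bar>f x - f a\<bar> powr (1 - 1 / (real k + 2)) \<le> real k * norm (g x)"
  proof eventually_elim
    case (elim x)
    \<comment> \<open>Along the \<open>i\<close>-th coordinate line, for real parameters,
      \<open>F\<close> is the complexified \<open>f\<close>; both partial derivatives are the
      derivative of this one curve.\<close>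
    have "cgrad F (cx x) $ i = of_real (g x $ i)" for i
    proof -
      have cx_shift: "cx (x + axis i s) = cx x + axis i (of_real s)" for s
        by (auto simp: cx_def vec_eq_iff axis_def)
      have "((\<lambda>s. F (cx x + axis i s)) has_field_derivative cgrad F (cx x) $ i) (at (of_real 0))"
        using has_derivative_cdot_axis[of F _ "cx x" i 0] cdiffD[OF elim(2)] by (simp add: axis_zero)
      then have 1: "((\<lambda>s. F (cx x + axis i (of_real s))) has_vector_derivative cgrad F (cx x) $ i) (at 0)"
        by (rule has_vector_derivative_real_field)
      have "((\<lambda>s. x + axis i s) has_derivative (\<lambda>h. axis i h)) (at (0::real))"
      proof (rule has_derivative_vecI)
        show "((\<lambda>s. (x + axis i s) $ j) has_derivative (\<lambda>h. axis i h $ j)) (at (0::real))" for j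
          by (cases "j = i") (auto simp: axis_def intro!: derivative_eq_intros)
      qed
      moreover have "(f has_derivative (\<lambda>h. h \<bullet> g x)) (at (x + axis i 0))"
        using grad[of x] by (simp add: gderiv_def axis_zero)
      ultimately have "((\<lambda>s. f (x + axis i s)) has_derivative (\<lambda>h. axis i h \<bullet> g x)) (at 0)"
        by (rule has_derivative_compose)
      then have "((\<lambda>s. f (x + axis i s)) has_vector_derivative g x $ i) (at 0)"
        by (simp add: has_vector_derivative_def inner_axis' mult.commute)
      then have "((\<lambda>s. f (x + axis i s) - f a) has_vector_derivative g x $ i - 0) (at 0)"
        by (intro has_vector_derivative_diff has_vector_derivative_const)
      then have 2: "((\<lambda>s. complex_of_real (f (x + axis i s) - f a)) has_vector_derivative of_real (g x $ i)) (at 0)"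
        using has_vector_derivative_of_real[of "\<lambda>s. f (x + axis i s) - f a" "g x $ i" "at 0"]
        by (simp add: has_real_derivative_iff_has_vector_derivative)
      have "((\<lambda>s. x + axis i s) \<longlongrightarrow> x + axis i 0) (nhds (0::real))"
      proof (intro tendsto_add tendsto_const vec_tendstoI)
        show "((\<lambda>s. axis i s $ j) \<longlongrightarrow> axis i 0 $ j) (nhds (0::real))" for j
          by (cases "j = i") (auto simp: axis_def filterlim_ident)
      qed
      then have "\<forall>\<^sub>F s in nhds 0. x + axis i s \<in> ball a r"
        by (rule topological_tendstoD) (use elim(3) in \<open>auto simp: axis_zero\<close>)
      then have "\<forall>\<^sub>F s in nhds 0. F (cx x + axis i (of_real s)) = of_real (f (x + axis i s) - f a)"
        by eventually_elim (simp only: Fcx cx_shift[symmetric])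
      then have "((\<lambda>s. complex_of_real (f (x + axis i s) - f a)) has_vector_derivative cgrad F (cx x) $ i) (at 0)"
        by (intro has_vector_derivative_cong_ev[THEN iffD1, OF _ _ 1])
          (auto dest: eventually_nhds_x_imp_x elim: eventually_mono)
      with 2 show ?thesis using vector_derivative_unique_at by blast
    qed
    then have "norm (cgrad F (cx x)) = norm (g x)"
      by (simp add: norm_vec_def)
    moreover have "norm (F (cx x)) = \<bar>f x - f a\<bar>"
      unfolding Fcx[OF elim(3)] by (simp only: norm_of_real)
    ultimately show ?case using elim(1) by (simp add: Loj_def)
  qed
  then show ?thesis ..
qed

section \<open>Convergence of the iterates\<close>

text \<open>Concavity of the power function: the tangent at \<open>u\<close> lies above the graph at
  \<open>v\<close>. After division by \<open>u powr q\<close> this is Young's inequality for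
  \<open>v / u\<close> and 1.\<close>

lemma powr_concave_diff:
  fixes u v q :: real
  assumes "0 < u" "0 \<le> v" "v \<le> u" "0 < q" "q < 1"
  shows "q * u powr (q - 1) * (u - v) \<le> u powr q - v powr q"
proof (cases "v = 0")
  case True
  have "q * u powr (q - 1) * u = q * u powr q"
    using assms(1) by (simp add: powr_diff)
  also have "\<dots> \<le> 1 * u powr q" using assms by (intro mult_right_mono) auto
  finally show ?thesis using True by simp
next
  case False
  then have v: "v > 0" using assms by simp
  have "(v / u) powr q * 1 powr (1 - q) \<le> q * (v / u) + (1 - q) * 1"
    using assms v by (intro Youngs_inequality_0) auto
  then have "v powr q / u powr q \<le> q * (v / u) + (1 - q)"
    using assms v by (simp add: powr_divide)
  then have "v powr q \<le> u powr q * (q * (v / u) + (1 - q))"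
    using assms by (simp add: field_simps)
  also have "\<dots> = u powr q - q * u powr (q - 1) * (u - v)"
    using assms(1) by (simp add: powr_diff field_simps)
  finally show ?thesis by simp
qed

text \<open>The argument of Lojasiewicz: \<open>F powr (1 - \<theta>)\<close> bounds the remaining path length.\<close>

lemma Lojasiewicz_descent:
  fixes x :: "nat \<Rightarrow> 'a::real_normed_vector" and s F :: "nat \<Rightarrow> real"
  assumes s: "\<And>n. s n \<ge> 0" and a: "a > 0" and desc: "\<And>n. a * (s n)\<^sup>2 \<le> F n - F (Suc n)"
    and b: "b > 0" and step: "\<And>n. norm (x (Suc n) - x n) \<le> b * s n"
    and F0: "\<And>n. F n \<ge> 0" and Flim: "F \<longlonglongrightarrow> 0"
    and freq: "\<And>e N. e > 0 \<Longrightarrow> \<exists>n\<ge>N. norm (x n - p) < e"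
    and \<theta>: "0 < \<theta>" "\<theta> < 1" and \<delta>: "\<delta> > 0" and C: "C > 0"
    and KL: "\<And>n. n \<ge> N \<Longrightarrow> norm (x n - p) < \<delta> \<Longrightarrow> F n powr \<theta> \<le> C * s n"
  shows "x \<longlonglongrightarrow> p"
proof -
  define A where "A = b * C / (a * (1 - \<theta>))"
  define \<phi> where "\<phi> n = A * F n powr (1 - \<theta>)" for n
  have A: "A > 0" using a b C \<theta> by (simp add: A_def)
  have \<phi>0: "\<phi> n \<ge> 0" for n using A by (simp add: \<phi>_def)
  have Fdec: "F (Suc n) \<le> F n" for n
    using desc[of n] a by (smt (verit) mult_nonneg_nonneg zero_le_power2)
  \<comment> \<open>Concavity bounds the drop of \<open>F powr (1 - \<theta>)\<close> below by
    \<open>(1 - \<theta>) * F powr (- \<theta>)\<close> times the drop of \<open>F\<close>, which is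
    at least \<open>a * s\<^sup>2\<close>. With \<open>F powr \<theta> \<le> C * s\<close> one
    factor \<open>s\<close> remains, and \<open>A\<close> normalises it to
    \<open>b * s\<close>.\<close>
  have key: "norm (x (Suc n) - x n) \<le> \<phi> n - \<phi> (Suc n)" if n: "n \<ge> N" "norm (x n - p) < \<delta>" for n
  proof (cases "F n = 0")
    case True
    then have F1: "F (Suc n) = 0" using F0[of "Suc n"] Fdec[of n] by simp
    then have "a * (s n)\<^sup>2 \<le> 0" using desc[of n] True by simp
    then have "s n = 0" using a by (simp add: mult_le_0_iff)
    then show ?thesis using step[of n] True F1 by (simp add: \<phi>_def)
  next
    case False
    then have Fn: "F n > 0" using F0[of n] by simp
    have FCs: "F n powr \<theta> \<le> C * s n" by (rule KL[OF n])
    moreover have "F n powr \<theta> > 0" using Fn by simp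
    ultimately have "C * s n > 0" by linarith
    then have sn: "s n > 0" using C by (simp add: zero_less_mult_iff)
    have "norm (x (Suc n) - x n) \<le> b * s n" by (rule step)
    also have "b * s n = A * ((1 - \<theta>) * (1 / (C * s n)) * (a * (s n)\<^sup>2))"
      using a C \<theta> sn by (simp add: A_def field_simps power2_eq_square)
    also have "\<dots> \<le> A * ((1 - \<theta>) * F n powr (1 - \<theta> - 1) * (F n - F (Suc n)))"
    proof (intro mult_left_mono mult_mono desc)
      have "F n powr (1 - \<theta> - 1) = 1 / F n powr \<theta>" using Fn by (simp add: powr_minus_divide)
      then show "1 / (C * s n) \<le> F n powr (1 - \<theta> - 1)"
        using FCs Fn by (simp add: frac_le)
    qed (use A a \<theta> C sn in auto)
    also have "\<dots> \<le> A * (F n powr (1 - \<theta>) - F (Suc n) powr (1 - \<theta>))"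
      using powr_concave_diff[OF Fn F0 Fdec, of "1 - \<theta>"] A \<theta> by (intro mult_left_mono) auto
    finally show ?thesis by (simp add: \<phi>_def algebra_simps)
  qed
  have \<phi>lim: "\<phi> \<longlonglongrightarrow> 0"
  proof -
    have "(\<lambda>n. A * F n powr (1 - \<theta>)) \<longlonglongrightarrow> A * 0 powr (1 - \<theta>)"
      using \<theta> F0 by (intro tendsto_mult tendsto_const tendsto_powr2 Flim) auto
    then show ?thesis using \<theta> by (simp add: \<phi>_def[abs_def])
  qed
  show ?thesis
  proof (rule LIMSEQ_I)
    fix e :: real assume e: "e > 0"
    define e' where "e' = min e \<delta> / 2"
    have e': "e' > 0" using e \<delta> by (simp add: e'_def)
    obtain N1 where N1: "\<And>n. n \<ge> N1 \<Longrightarrow> \<phi> n < e'"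
      using order_tendstoD(2)[OF \<phi>lim e'] unfolding eventually_sequentially by blast
    obtain m where m: "m \<ge> max N N1" "norm (x m - p) < e'"
      using freq[OF e'] by blast
    \<comment> \<open>The inequality is available only near \<open>p\<close>, but the length
      estimate itself keeps the iterates there: half of \<open>\<delta>\<close> for the start, half
      for the path.\<close>
    have path: "norm (x n - x m) \<le> \<phi> m - \<phi> n" if "n \<ge> m" for n
      using that
    proof (induction n rule: dec_induct)
      case (step n)
      have "norm (x n - p) \<le> norm (x n - x m) + norm (x m - p)"
        using norm_triangle_ineq[of "x n - x m" "x m - p"] by simp
      also have "\<dots> < e' + e'"
        using step.IH \<phi>0[of n] N1[of m] m by (intro add_strict_mono) auto
      finally have "norm (x n - p) < \<delta>" by (simp add: e'_def)
      then have "norm (x (Suc n) - x n) \<le> \<phi> n - \<phi> (Suc n)"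
        using step.hyps m by (intro key) auto
      then show ?case
        using step.IH norm_triangle_ineq[of "x (Suc n) - x n" "x n - x m"] by simp
    qed simp
    have "norm (x n - p) < e" if "n \<ge> m" for n
    proof -
      have "norm (x n - p) \<le> norm (x n - x m) + norm (x m - p)"
        using norm_triangle_ineq[of "x n - x m" "x m - p"] by simp
      also have "\<dots> < e' + e'"
        using path[OF that] \<phi>0[of n] N1[of m] m by (intro add_strict_mono) auto
      finally show ?thesis by (simp add: e'_def)
    qed
    then show "\<exists>no. \<forall>n\<ge>no. norm (x n - p) < e" by blast
  qed
qed

lemma geometric_decay_null:
  fixes h :: "nat \<Rightarrow> real"
  assumes \<kappa>: "0 \<le> \<kappa>" "\<kappa> < 1" and h: "\<And>n. \<bar>h (Suc n)\<bar> \<le> \<kappa> * \<bar>h n\<bar>"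
  shows "h \<longlonglongrightarrow> 0"
proof (rule Lim_null_comparison)
  have "\<bar>h n\<bar> \<le> \<kappa> ^ n * \<bar>h 0\<bar>" for n
  proof (induction n)
    case (Suc n)
    have "\<bar>h (Suc n)\<bar> \<le> \<kappa> * (\<kappa> ^ n * \<bar>h 0\<bar>)"
      using h[of n] mult_left_mono[OF Suc \<kappa>(1)] by simp
    then show ?case by (simp add: mult.assoc)
  qed simp
  then show "\<forall>\<^sub>F n in sequentially. norm (h n) \<le> \<kappa> ^ n * \<bar>h 0\<bar>" by simp
  show "(\<lambda>n. \<kappa> ^ n * \<bar>h 0\<bar>) \<longlonglongrightarrow> 0"
    using tendsto_mult[OF LIMSEQ_power_zero[of \<kappa>] tendsto_const[of "\<bar>h 0\<bar>"]] \<kappa> by simp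
qed

text \<open>\<open>d x h\<close> is the search direction, a gradient with error controlled by
  \<open>h\<close>, and \<open>\<kappa>\<close> is the contraction factor of
  \<open>h\<close>.\<close>

locale gradient_system =
  fixes f :: "real ^ 'd \<Rightarrow> real" and gr :: "real ^ 'd \<Rightarrow> real ^ 'd" and l c \<eta> \<kappa> :: real
    and d :: "real ^ 'd \<Rightarrow> real \<Rightarrow> real ^ 'd"
  assumes grad: "GDERIV f x :> gr x"
    and Lip: "norm (gr x - gr y) \<le> l * norm (x - y)"
    and analytic: "real_analytic f" and sublevel: "compact {x. f x \<le> t}"
    and \<eta>: "0 < \<eta>" and \<eta>l: "2 * (\<eta> * l) < 1" and l: "0 < l"
    and \<kappa>: "0 \<le> \<kappa>" "\<kappa> < 1"
    and approx: "norm (d x h - gr x) \<le> c * \<bar>h\<bar>"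
begin

lemma c_nonneg: "0 \<le> c"
  using order.trans[OF norm_ge_zero approx[of 0 1]] by simp

lemma f_cont: "continuous_on UNIV f"
  using grad unfolding gderiv_def
  by (intro continuous_at_imp_continuous_on ballI has_derivative_continuous) auto

lemma gr_cont: "continuous_on UNIV gr"
proof (rule continuous_onI)
  fix x e assume "(e::real) > 0"
  then show "\<exists>d>0. \<forall>x'\<in>UNIV. dist x' x < d \<longrightarrow> dist (gr x') (gr x) \<le> e"
  proof (intro exI[of _ "e / l"] conjI ballI impI)
    fix x' assume "dist x' x < e / l"
    then have "l * norm (x' - x) \<le> e" using l by (simp add: dist_norm field_simps)
    then show "dist (gr x') (gr x) \<le> e" using Lip[of x' x] by (simp add: dist_norm)
  qed (use l in simp)
qed

text \<open>By the mean value theorem the change of \<open>f\<close> is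
  \<open>- \<eta> * (D \<bullet> g)\<close> with the gradient \<open>g\<close> at an intermediate
  point. The step size keeps \<open>g\<close> within \<open>norm D / 2\<close> of the gradient at
  \<open>x\<close>. Absorbing the error \<open>e\<close> of the direction by \<open>norm D * norm e
  \<le> (norm D)\<^sup>2 / 4 + (norm e)\<^sup>2\<close> leaves the coefficient
  \<open>1 - 1/2 - 1/4\<close>.\<close>

lemma descent: "f (x - \<eta> *\<^sub>R d x h) \<le> f x - \<eta> / 4 * (norm (d x h))\<^sup>2 + \<eta> * c\<^sup>2 * h\<^sup>2"
proof -
  define D where "D = d x h"
  define e where "e = D - gr x"
  have "\<exists>t. 0 < t \<and> t < 1 \<and> f (x - \<eta> *\<^sub>R D) - f x = - \<eta> * (D \<bullet> gr (x - (t * \<eta>) *\<^sub>R D))"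
  proof -
    have "((\<lambda>t. f (x - (t * \<eta>) *\<^sub>R D)) has_real_derivative - \<eta> * (D \<bullet> gr (x - (t * \<eta>) *\<^sub>R D))) (at t)" for t
    proof -
      have "((\<lambda>t. x - (t * \<eta>) *\<^sub>R D) has_derivative (\<lambda>h. - (h * \<eta>) *\<^sub>R D)) (at t)"
        by (auto intro!: derivative_eq_intros)
      from has_derivative_compose[OF this grad[unfolded gderiv_def]]
      show ?thesis
        unfolding has_field_derivative_def by (rule has_derivative_eq_rhs) (simp add: fun_eq_iff mult_ac)
    qed
    then have "\<exists>z>0. z < 1 \<and> f (x - (1 * \<eta>) *\<^sub>R D) - f (x - (0 * \<eta>) *\<^sub>R D) =
        (1 - 0) * (- \<eta> * (D \<bullet> gr (x - (z * \<eta>) *\<^sub>R D)))"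
      by (intro MVT2) auto
    then show ?thesis by simp
  qed
  then obtain t where t: "0 < t" "t < 1"
    and mvt: "f (x - \<eta> *\<^sub>R D) - f x = - \<eta> * (D \<bullet> gr (x - (t * \<eta>) *\<^sub>R D))" by blast
  define g where "g = gr (x - (t * \<eta>) *\<^sub>R D)"
  have "norm (g - gr x) \<le> l * norm (x - (t * \<eta>) *\<^sub>R D - x)" unfolding g_def by (rule Lip)
  also have "\<dots> = t * (l * \<eta> * norm D)" using t \<eta> by (simp add: abs_mult)
  also have "\<dots> \<le> 1 * (l * \<eta> * norm D)" using t l \<eta> by (intro mult_right_mono) auto
  also have "\<dots> \<le> 1 / 2 * norm D"
    using \<eta>l mult_right_mono[of "l * \<eta>" "1 / 2" "norm D"] by (simp add: mult.commute[of l])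
  finally have g: "norm (g - gr x) \<le> norm D / 2" by simp
  have e: "norm e \<le> c * \<bar>h\<bar>" using approx by (simp add: e_def D_def)
  have "D \<bullet> g = D \<bullet> D - D \<bullet> e + D \<bullet> (g - gr x)" by (simp add: e_def inner_diff_right)
  moreover have "\<bar>D \<bullet> e\<bar> \<le> norm D * norm e" "\<bar>D \<bullet> (g - gr x)\<bar> \<le> norm D * (norm D / 2)"
    using Cauchy_Schwarz_ineq2[of D e] Cauchy_Schwarz_ineq2[of D "g - gr x"]
      mult_left_mono[OF g norm_ge_zero[of D]] by linarith+
  ultimately have "D \<bullet> g \<ge> (norm D)\<^sup>2 / 2 - norm D * norm e"
    unfolding dot_square_norm power2_eq_square by linarith
  moreover have "norm D * norm e \<le> (norm D)\<^sup>2 / 4 + (norm e)\<^sup>2"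
    using zero_le_power2[of "norm D / 2 - norm e"] by (simp add: power2_eq_square algebra_simps)
  moreover have "(norm e)\<^sup>2 \<le> c\<^sup>2 * h\<^sup>2"
    using power_mono[OF e norm_ge_zero, of 2] by (simp add: power_mult_distrib)
  ultimately have "D \<bullet> g \<ge> (norm D)\<^sup>2 / 4 - c\<^sup>2 * h\<^sup>2" by linarith
  then have "\<eta> * ((norm D)\<^sup>2 / 4 - c\<^sup>2 * h\<^sup>2) \<le> \<eta> * (D \<bullet> g)"
    using \<eta> by (intro mult_left_mono) auto
  then show ?thesis
    using mvt unfolding D_def[symmetric] g_def[symmetric] by (simp add: algebra_simps)
qed

theorem converges:
  fixes x :: "nat \<Rightarrow> real ^ 'd" and h :: "nat \<Rightarrow> real"
  assumes x: "\<And>n. x (Suc n) = x n - \<eta> *\<^sub>R d (x n) (h n)"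
    and h: "\<And>n. \<bar>h (Suc n)\<bar> \<le> \<kappa> * \<bar>h n\<bar>"
  shows "\<exists>p. gr p = 0 \<and> x \<longlonglongrightarrow> p"
proof -
  define s where "s n = norm (d (x n) (h n)) + \<bar>h n\<bar>" for n
  \<comment> \<open>Chosen so that the decay of \<open>K * (h n)\<^sup>2\<close> pays for the error
    term in \<open>descent\<close> and leaves \<open>\<eta> / 4 * (h n)\<^sup>2\<close>; the
    decrease of \<open>V\<close> then controls \<open>h\<close> along with the step, as the
    definition of \<open>s\<close> demands.\<close>
  define K where "K = (\<eta> * c\<^sup>2 + \<eta> / 4) / (1 - \<kappa>\<^sup>2)"
  have \<kappa>2: "\<kappa>\<^sup>2 < 1" using \<kappa> by (simp add: power_less_one_iff)
  have K: "K > 0" using \<eta> \<kappa>2 by (simp add: K_def divide_pos_pos add_nonneg_pos)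
  define V where "V n = f (x n) + K * (h n)\<^sup>2" for n
  have desc: "\<eta> / 8 * (s n)\<^sup>2 \<le> V n - V (Suc n)" for n
  proof -
    have "(h (Suc n))\<^sup>2 \<le> \<kappa>\<^sup>2 * (h n)\<^sup>2"
      using power_mono[OF h[of n] abs_ge_zero, of 2] by (simp add: power_mult_distrib)
    then have "K * (h (Suc n))\<^sup>2 \<le> K * (\<kappa>\<^sup>2 * (h n)\<^sup>2)" using K by (intro mult_left_mono) auto
    moreover have "K * (h n)\<^sup>2 - K * (\<kappa>\<^sup>2 * (h n)\<^sup>2) = \<eta> * c\<^sup>2 * (h n)\<^sup>2 + \<eta> / 4 * (h n)\<^sup>2"
    proof -
      have "K * (h n)\<^sup>2 - K * (\<kappa>\<^sup>2 * (h n)\<^sup>2) = K * (1 - \<kappa>\<^sup>2) * (h n)\<^sup>2"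
        by (simp add: algebra_simps)
      also have "K * (1 - \<kappa>\<^sup>2) = \<eta> * c\<^sup>2 + \<eta> / 4" using \<kappa>2 by (simp add: K_def)
      finally show ?thesis by (simp only: distrib_right)
    qed
    moreover have "f (x (Suc n)) \<le> f (x n) - \<eta> / 4 * (norm (d (x n) (h n)))\<^sup>2 + \<eta> * c\<^sup>2 * (h n)\<^sup>2"
      unfolding x by (rule descent)
    ultimately have "V n - V (Suc n) \<ge> \<eta> / 4 * (norm (d (x n) (h n)))\<^sup>2 + \<eta> / 4 * (h n)\<^sup>2"
      unfolding V_def by linarith
    moreover have "(s n)\<^sup>2 \<le> 2 * (norm (d (x n) (h n)))\<^sup>2 + 2 * (h n)\<^sup>2"
      using zero_le_power2[of "norm (d (x n) (h n)) - \<bar>h n\<bar>"]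
      unfolding s_def power2_sum power2_diff by simp
    then have "\<eta> / 8 * (s n)\<^sup>2 \<le> \<eta> / 8 * (2 * (norm (d (x n) (h n)))\<^sup>2 + 2 * (h n)\<^sup>2)"
      using \<eta> by (intro mult_left_mono) auto
    ultimately show ?thesis by (simp add: algebra_simps)
  qed
  have s0: "s n \<ge> 0" for n by (simp add: s_def)
  have Vdec: "V (Suc n) \<le> V n" for n
    using order.trans[OF _ desc[of n], of 0] \<eta> by simp
  then have "decseq V" by (simp add: decseq_Suc_iff)
  let ?S = "{y. f y \<le> V 0}"
  have xS: "x n \<in> ?S" for n
  proof -
    have "f (x n) \<le> V n" using K by (simp add: V_def)
    also have "V n \<le> V 0" using \<open>decseq V\<close> by (simp add: decseq_def)
    finally show ?thesis by simp
  qed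
  have "seq_compact ?S" using sublevel by (simp add: compact_imp_seq_compact)
  then obtain p r where r: "strict_mono (r :: nat \<Rightarrow> nat)" "(x \<circ> r) \<longlonglongrightarrow> p"
    using xS unfolding seq_compact_def by blast
  have hlim: "h \<longlonglongrightarrow> 0" using \<kappa> h by (rule geometric_decay_null)
  have "(\<lambda>n. f (x (r n))) \<longlonglongrightarrow> f p"
    using continuous_on_tendsto_compose[OF f_cont r(2)] by (simp add: o_def)
  moreover have hr: "(\<lambda>n. h (r n)) \<longlonglongrightarrow> 0"
    using LIMSEQ_subseq_LIMSEQ[OF hlim r(1)] by (simp add: o_def)
  ultimately have "(\<lambda>n. f (x (r n)) + K * (h (r n))\<^sup>2) \<longlonglongrightarrow> f p + K * 0\<^sup>2"
    by (intro tendsto_intros)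
  then have Vr: "(\<lambda>n. V (r n)) \<longlonglongrightarrow> f p" by (simp add: V_def)
  have Vge: "V n \<ge> f p" for n
  proof (rule LIMSEQ_le_const2[OF Vr])
    show "\<exists>N. \<forall>m\<ge>N. V (r m) \<le> V n"
      using seq_suble[OF r(1)] \<open>decseq V\<close> by (intro exI[of _ n]) (auto simp: decseq_def intro: order.trans)
  qed
  obtain V' where V': "V \<longlonglongrightarrow> V'"
    using decseq_convergent[OF \<open>decseq V\<close>, of "f p"] Vge by blast
  have "V' = f p"
    using LIMSEQ_subseq_LIMSEQ[OF V' r(1)] Vr LIMSEQ_unique by (auto simp: o_def)
  with V' have Vlim: "V \<longlonglongrightarrow> f p" by simp
  have slim: "s \<longlonglongrightarrow> 0"
  proof -
    have "(\<lambda>n. 8 / \<eta> * (V n - V (Suc n))) \<longlonglongrightarrow> 8 / \<eta> * (f p - f p)"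
      using Vlim by (intro tendsto_intros LIMSEQ_Suc)
    then have "(\<lambda>n. 8 / \<eta> * (V n - V (Suc n))) \<longlonglongrightarrow> 0" by simp
    moreover have "norm ((s n)\<^sup>2) \<le> 8 / \<eta> * (V n - V (Suc n))" for n
      using desc[of n] \<eta> by (simp add: field_simps)
    ultimately have "(\<lambda>n. (s n)\<^sup>2) \<longlonglongrightarrow> 0"
      by (intro Lim_null_comparison[of "\<lambda>n. (s n)\<^sup>2"]) auto
    then have "(\<lambda>n. sqrt ((s n)\<^sup>2)) \<longlonglongrightarrow> sqrt 0" by (rule tendsto_real_sqrt)
    then show ?thesis using s0 by simp
  qed
  have gr_s: "norm (gr (x n)) \<le> (1 + c) * s n" for n
  proof -
    have "norm (gr (x n)) \<le> norm (d (x n) (h n)) + norm (d (x n) (h n) - gr (x n))"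
      using norm_triangle_ineq4[of "d (x n) (h n)" "d (x n) (h n) - gr (x n)"] by simp
    also have "\<dots> \<le> norm (d (x n) (h n)) + c * \<bar>h n\<bar>" using approx by simp
    also have "\<dots> \<le> (1 + c) * s n" using c_nonneg by (simp add: s_def algebra_simps)
    finally show ?thesis .
  qed
  have "gr p = 0"
  proof -
    have "(\<lambda>n. gr (x (r n))) \<longlonglongrightarrow> gr p"
      using continuous_on_tendsto_compose[OF gr_cont r(2)] by (simp add: o_def)
    moreover have "(\<lambda>n. gr (x (r n))) \<longlonglongrightarrow> 0"
    proof (rule Lim_null_comparison)
      show "\<forall>\<^sub>F n in sequentially. norm (gr (x (r n))) \<le> (1 + c) * s (r n)" using gr_s by simp
      show "(\<lambda>n. (1 + c) * s (r n)) \<longlonglongrightarrow> 0"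
        using tendsto_mult[OF tendsto_const[of "1 + c"] LIMSEQ_subseq_LIMSEQ[OF slim r(1)]] by (simp add: o_def)
    qed
    ultimately show ?thesis by (rule LIMSEQ_unique)
  qed
  obtain k :: nat where k: "\<forall>\<^sub>F y in nhds p. \<bar>f y - f p\<bar> \<le> 1 \<and>
      \<bar>f y - f p\<bar> powr (1 - 1 / (real k + 2)) \<le> real k * norm (gr y)"
    using real_analytic_Lojasiewicz[OF analytic grad] by blast
  \<comment> \<open>\<open>1 / 2 \<le> \<theta>\<close> makes the additional term
    \<open>K * (h n)\<^sup>2\<close> harmless: to the power \<open>\<theta>\<close> it is at most a
    constant times \<open>\<bar>h n\<bar>\<close> once \<open>\<bar>h n\<bar> < 1\<close>.\<close>
  define \<theta> where "\<theta> = 1 - 1 / (real k + 2)"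
  have \<theta>: "0 < \<theta>" "\<theta> < 1" "1 / 2 \<le> \<theta>" by (auto simp: \<theta>_def field_simps)
  obtain \<delta> where \<delta>: "\<delta> > 0" and KL: "\<And>y. norm (y - p) < \<delta> \<Longrightarrow> \<bar>f y - f p\<bar> powr \<theta> \<le> real k * norm (gr y)"
    using k unfolding eventually_nhds_metric \<theta>_def[symmetric] by (auto simp: dist_norm)
  obtain N where N: "\<And>n. n \<ge> N \<Longrightarrow> \<bar>h n\<bar> < 1"
    using order_tendstoD(2)[OF tendsto_rabs_zero[OF hlim] zero_less_one] unfolding eventually_sequentially by blast
  \<comment> \<open>The factor 2 splits the power of the sum \<open>u + v\<close>; the two summands
    come from the gradient inequality for \<open>u\<close> and from the elementary bound for
    \<open>v\<close>.\<close>
  define C where "C = 2 * (real k * (1 + c) + (1 + K))"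
  have "x \<longlonglongrightarrow> p"
  proof (rule Lojasiewicz_descent[where s=s and a="\<eta> / 8" and b=\<eta> and F="\<lambda>n. V n - f p" and \<theta>=\<theta> and \<delta>=\<delta> and C=C and N=N])
    show "\<eta> / 8 * (s n)\<^sup>2 \<le> V n - f p - (V (Suc n) - f p)" for n using desc[of n] by simp
    show "norm (x (Suc n) - x n) \<le> \<eta> * s n" for n
      using \<eta> by (simp add: x s_def)
    show "(\<lambda>n. V n - f p) \<longlonglongrightarrow> 0" using tendsto_diff[OF Vlim tendsto_const[of "f p"]] by simp
    show "\<exists>n\<ge>N. norm (x n - p) < e" if "e > 0" for e N
    proof -
      obtain M where M: "\<And>n. n \<ge> M \<Longrightarrow> norm ((x \<circ> r) n - p) < e"
        using LIMSEQ_D[OF r(2) \<open>e > 0\<close>] by blast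
      then show ?thesis
        using seq_suble[OF r(1), of "max M N"] by (intro exI[of _ "r (max M N)"]) (auto simp: o_def)
    qed
    show "C > 0" using K c_nonneg by (auto simp: C_def intro!: add_nonneg_pos)
    fix n assume n: "n \<ge> N" "norm (x n - p) < \<delta>"
    define u where "u = \<bar>f (x n) - f p\<bar>"
    define v where "v = K * (h n)\<^sup>2"
    have v0: "v \<ge> 0" using K by (simp add: v_def)
    have h1: "\<bar>h n\<bar> < 1" by (rule N[OF n(1)])
    have "(V n - f p) powr \<theta> \<le> (2 * max u v) powr \<theta>"
    proof (intro powr_mono2)
      have "V n - f p \<le> u + v" by (simp add: V_def u_def v_def)
      then show "V n - f p \<le> 2 * max u v"
        using max.cobounded1[of u v] max.cobounded2[of v u] by linarith
    qed (use Vge[of n] \<theta> in auto)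
    also have "\<dots> = 2 powr \<theta> * (max u v) powr \<theta>"
      by (simp add: powr_mult u_def)
    also have "\<dots> \<le> 2 powr 1 * (u powr \<theta> + v powr \<theta>)"
      using \<theta> by (intro mult_mono powr_mono) (auto simp: max_def)
    also have "\<dots> = 2 * (u powr \<theta> + v powr \<theta>)" by simp
    also have "u powr \<theta> \<le> real k * ((1 + c) * s n)"
      using KL[OF n(2)] mult_left_mono[OF gr_s[of n], of "real k"] by (simp add: u_def)
    also have "v powr \<theta> \<le> (1 + K) * s n"
    proof -
      have "v powr \<theta> = K powr \<theta> * ((h n)\<^sup>2) powr \<theta>"
        using K by (simp add: v_def powr_mult)
      also have "\<dots> \<le> (1 + K) * \<bar>h n\<bar>"
      proof (rule mult_mono)
        have "K powr \<theta> \<le> (1 + K) powr \<theta>" using K \<theta> by (intro powr_mono2) auto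
        also have "\<dots> \<le> (1 + K) powr 1" using K \<theta> by (intro powr_mono) auto
        finally show "K powr \<theta> \<le> 1 + K" using K by simp
        have "(h n)\<^sup>2 \<le> 1" using h1 by (simp add: abs_square_le_1)
        then have "((h n)\<^sup>2) powr \<theta> \<le> ((h n)\<^sup>2) powr (1 / 2)"
          using \<theta> by (intro powr_mono') auto
        also have "\<dots> = \<bar>h n\<bar>" by (simp add: powr_half_sqrt)
        finally show "((h n)\<^sup>2) powr \<theta> \<le> \<bar>h n\<bar>" .
      qed (use K in auto)
      also have "\<dots> \<le> (1 + K) * s n" using K by (intro mult_left_mono) (auto simp: s_def)
      finally show ?thesis .
    qed
    finally show "(V n - f p) powr \<theta> \<le> C * s n" by (simp add: C_def algebra_simps)
  qed (use s0 \<eta> Vge \<theta> \<delta> in auto)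
  with \<open>gr p = 0\<close> show ?thesis by blast
qed

end

section \<open>Avoidance of strict saddle points\<close>

text \<open>The second difference \<open>\<Delta>\<close> is symmetric in \<open>u\<close> and
  \<open>v\<close>. Two applications of the mean value theorem express it through \<open>H\<close>
  at a point near \<open>x\<close>, and continuity of \<open>H\<close> gives the limit.\<close>

lemma hessian_symmetric:
  fixes f :: "'a::euclidean_space \<Rightarrow> real" and gr :: "'a \<Rightarrow> 'a" and H :: "'a \<Rightarrow> 'a \<Rightarrow>\<^sub>L 'a"
  assumes grad: "\<And>x. GDERIV f x :> gr x"
    and H: "\<And>x. (gr has_derivative blinfun_apply (H x)) (at x)"
    and cont: "continuous_on UNIV H"
  shows "H x u \<bullet> v = H x v \<bullet> u"
proof -
  define \<Delta> where "\<Delta> s u v = f (x + s *\<^sub>R v + s *\<^sub>R u) - f (x + s *\<^sub>R u) - f (x + s *\<^sub>R v) + f x" for s :: real and u v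
  have mvt: "\<exists>y. norm (y - x) \<le> s * (norm u + norm v) \<and> \<Delta> s u v = s * (s * (H y v \<bullet> u))" if s: "s > 0" for s u v
  proof -
    have df: "((\<lambda>t. f (w + t *\<^sub>R u)) has_real_derivative gr (w + t *\<^sub>R u) \<bullet> u) (at t)" for w t
    proof -
      have "((\<lambda>t. w + t *\<^sub>R u) has_derivative (\<lambda>h. h *\<^sub>R u)) (at t)"
        by (auto intro!: derivative_eq_intros)
      from has_derivative_compose[OF this grad[unfolded gderiv_def]]
      show ?thesis
        unfolding has_field_derivative_def
        by (rule has_derivative_eq_rhs) (simp add: fun_eq_iff inner_commute mult.commute)
    qed
    have dg: "((\<lambda>t. gr (w + t *\<^sub>R v) \<bullet> u) has_real_derivative H (w + t *\<^sub>R v) v \<bullet> u) (at t)" for w t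
    proof -
      have "((\<lambda>t. w + t *\<^sub>R v) has_derivative (\<lambda>h. h *\<^sub>R v)) (at t)"
        by (auto intro!: derivative_eq_intros)
      from has_derivative_inner_left[OF has_derivative_compose[OF this H]]
      show ?thesis
        unfolding has_field_derivative_def
        by (rule has_derivative_eq_rhs) (simp add: fun_eq_iff blinfun.scaleR_right mult.commute)
    qed
    let ?\<phi> = "\<lambda>t. f (x + s *\<^sub>R v + t *\<^sub>R u) - f (x + t *\<^sub>R u)"
    have "\<exists>\<xi>>0. \<xi> < s \<and> ?\<phi> s - ?\<phi> 0 = (s - 0) * (gr (x + s *\<^sub>R v + \<xi> *\<^sub>R u) \<bullet> u - gr (x + \<xi> *\<^sub>R u) \<bullet> u)"
      using s by (intro MVT2 DERIV_diff df) auto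
    then obtain \<xi> where \<xi>: "0 < \<xi>" "\<xi> < s"
      and eq1: "?\<phi> s - ?\<phi> 0 = s * (gr (x + s *\<^sub>R v + \<xi> *\<^sub>R u) \<bullet> u - gr (x + \<xi> *\<^sub>R u) \<bullet> u)" by auto
    let ?\<psi> = "\<lambda>t. gr ((x + \<xi> *\<^sub>R u) + t *\<^sub>R v) \<bullet> u"
    have "\<exists>\<zeta>>0. \<zeta> < s \<and> ?\<psi> s - ?\<psi> 0 = (s - 0) * (H ((x + \<xi> *\<^sub>R u) + \<zeta> *\<^sub>R v) v \<bullet> u)"
      using s by (intro MVT2 dg) auto
    then obtain \<zeta> where \<zeta>: "0 < \<zeta>" "\<zeta> < s"
      and eq2: "?\<psi> s - ?\<psi> 0 = s * (H ((x + \<xi> *\<^sub>R u) + \<zeta> *\<^sub>R v) v \<bullet> u)" by auto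
    define y where "y = (x + \<xi> *\<^sub>R u) + \<zeta> *\<^sub>R v"
    have "?\<phi> s - ?\<phi> 0 = s * (?\<psi> s - ?\<psi> 0)" unfolding eq1 by (simp add: add.commute add.left_commute)
    then have "\<Delta> s u v = s * (s * (H y v \<bullet> u))" unfolding eq2 y_def \<Delta>_def by simp
    moreover have "norm (y - x) \<le> s * (norm u + norm v)"
    proof -
      have "norm (y - x) \<le> norm (\<xi> *\<^sub>R u) + norm (\<zeta> *\<^sub>R v)"
        unfolding y_def using norm_triangle_ineq[of "\<xi> *\<^sub>R u" "\<zeta> *\<^sub>R v"] by (simp add: algebra_simps)
      also have "\<dots> \<le> s * norm u + s * norm v"
        using \<xi> \<zeta> by (intro add_mono) (auto intro!: mult_right_mono)
      finally show ?thesis by (simp add: algebra_simps)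
    qed
    ultimately show ?thesis by blast
  qed
  have conv: "(\<lambda>n. H (y n) a \<bullet> b) \<longlonglongrightarrow> H x a \<bullet> b"
    if y: "\<And>n. norm (y n - x) \<le> inverse (real (Suc n)) * M" for y :: "nat \<Rightarrow> 'a" and M a b
  proof -
    have "(\<lambda>n. y n - x) \<longlonglongrightarrow> 0"
    proof (rule Lim_null_comparison)
      show "\<forall>\<^sub>F n in sequentially. norm (y n - x) \<le> inverse (real (Suc n)) * M" using y by simp
      show "(\<lambda>n. inverse (real (Suc n)) * M) \<longlonglongrightarrow> 0"
        using tendsto_mult[OF LIMSEQ_inverse_real_of_nat tendsto_const[of M]] by simp
    qed
    then have "y \<longlonglongrightarrow> x" by (rule LIM_zero_cancel)
    then have "(\<lambda>n. H (y n)) \<longlonglongrightarrow> H x"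
      using continuous_on_tendsto_compose[OF cont] by simp
    then show ?thesis by (intro tendsto_intros)
  qed
  have "\<exists>y. norm (y - x) \<le> inverse (real (Suc n)) * (norm u + norm v) \<and>
      \<Delta> (inverse (real (Suc n))) u v = inverse (real (Suc n)) * (inverse (real (Suc n)) * (H y v \<bullet> u))" for n
    by (rule mvt) simp
  then obtain y1 where y1: "\<And>n. norm (y1 n - x) \<le> inverse (real (Suc n)) * (norm u + norm v)"
    and e1: "\<And>n. \<Delta> (inverse (real (Suc n))) u v = inverse (real (Suc n)) * (inverse (real (Suc n)) * (H (y1 n) v \<bullet> u))"
    by metis
  have "\<exists>y. norm (y - x) \<le> inverse (real (Suc n)) * (norm v + norm u) \<and>
      \<Delta> (inverse (real (Suc n))) v u = inverse (real (Suc n)) * (inverse (real (Suc n)) * (H y u \<bullet> v))" for n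
    by (rule mvt) simp
  then obtain y2 where y2: "\<And>n. norm (y2 n - x) \<le> inverse (real (Suc n)) * (norm v + norm u)"
    and e2: "\<And>n. \<Delta> (inverse (real (Suc n))) v u = inverse (real (Suc n)) * (inverse (real (Suc n)) * (H (y2 n) u \<bullet> v))"
    by metis
  have "\<Delta> s u v = \<Delta> s v u" for s by (simp add: \<Delta>_def algebra_simps)
  then have "H (y1 n) v \<bullet> u = H (y2 n) u \<bullet> v" for n
    using e1[of n] e2[of n] by simp
  then show ?thesis
    using LIMSEQ_unique[OF conv[OF y1, of v u]] conv[OF y2, of u v] by simp
qed

text \<open>A minimiser \<open>v\<close> of the quadratic form on the unit sphere is an eigenvector:
  moving from \<open>v\<close> against the residual \<open>g\<close> by \<open>s\<close> changes a
  nonnegative form that vanishes at \<open>v\<close> by \<open>- 2 * s * (g \<bullet> g)\<close>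
  plus a term of order \<open>s\<^sup>2\<close>, so \<open>g = 0\<close>.\<close>

lemma symmetric_eigenvalue_exists:
  fixes T :: "'a::euclidean_space \<Rightarrow> 'a"
  assumes lin: "bounded_linear T" and sym: "\<And>x y. T x \<bullet> y = T y \<bullet> x"
  shows "\<exists>t v. v \<noteq> 0 \<and> T v = t *\<^sub>R v"
proof -
  interpret bounded_linear T by (rule lin)
  have "\<exists>v\<in>sphere 0 1. \<forall>y\<in>sphere 0 1. T v \<bullet> v \<le> T y \<bullet> y"
  proof (rule continuous_attains_inf)
    show "sphere (0::'a) 1 \<noteq> {}" by simp
    show "continuous_on (sphere 0 1) (\<lambda>y. T y \<bullet> y)"
      by (intro continuous_on_inner continuous_on continuous_on_id)
  qed simp
  then obtain v where v: "norm v = 1" and min: "\<And>y. norm y = 1 \<Longrightarrow> T v \<bullet> v \<le> T y \<bullet> y" by auto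
  define t where "t = T v \<bullet> v"
  have Q: "T y \<bullet> y - t * (y \<bullet> y) \<ge> 0" for y
  proof (cases "y = 0")
    case False
    have "t \<le> T (y /\<^sub>R norm y) \<bullet> (y /\<^sub>R norm y)"
      unfolding t_def by (rule min) (use False in simp)
    also have "\<dots> = (T y \<bullet> y) / (y \<bullet> y)"
      by (simp add: scaleR dot_square_norm power2_eq_square divide_inverse mult_ac)
    finally show ?thesis using False by (simp add: field_simps)
  qed (simp add: zero)
  define g where "g = T v - t *\<^sub>R v"
  have "g \<bullet> g \<le> s * (T g \<bullet> g - t * (g \<bullet> g)) / 2" if s: "s > 0" for s
  proof -
    have "T (v - s *\<^sub>R g) \<bullet> (v - s *\<^sub>R g) - t * ((v - s *\<^sub>R g) \<bullet> (v - s *\<^sub>R g)) =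
        - 2 * s * (g \<bullet> g) + s * s * (T g \<bullet> g - t * (g \<bullet> g))"
    proof -
      have "T g \<bullet> v = T v \<bullet> g" by (rule sym)
      moreover have "v \<bullet> v = 1" using v by (simp add: dot_square_norm)
      moreover have gg: "T v \<bullet> g = g \<bullet> g + t * (v \<bullet> g)"
        by (simp add: g_def inner_diff_left inner_diff_right inner_commute[of v "T v"])
      ultimately show ?thesis
        by (simp add: diff scaleR inner_diff_left inner_diff_right t_def[symmetric] inner_commute[of g v] gg algebra_simps)
    qed
    then have "2 * s * (g \<bullet> g) \<le> s * s * (T g \<bullet> g - t * (g \<bullet> g))" using Q[of "v - s *\<^sub>R g"] by simp
    then have "s * (2 * (g \<bullet> g)) \<le> s * (s * (T g \<bullet> g - t * (g \<bullet> g)))" by (simp add: mult_ac)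
    then have "2 * (g \<bullet> g) \<le> s * (T g \<bullet> g - t * (g \<bullet> g))" using s by (simp only: mult_le_cancel_left_pos)
    then show ?thesis by simp
  qed
  then have le: "\<forall>\<^sub>F s in at_right 0. g \<bullet> g \<le> s * (T g \<bullet> g - t * (g \<bullet> g)) / 2"
    by (intro eventually_at_rightI[of 0 1]) auto
  have "((\<lambda>s. s * (T g \<bullet> g - t * (g \<bullet> g)) / 2) \<longlongrightarrow> 0 * (T g \<bullet> g - t * (g \<bullet> g)) / 2) (at_right 0)"
    by (intro tendsto_intros) auto
  then have "g \<bullet> g \<le> 0"
    using tendsto_lowerbound[OF _ le] by simp
  then have "g = 0" by (metis inner_ge_zero inner_eq_zero_iff order_antisym)
  then show ?thesis using v by (intro exI[of _ t] exI[of _ v]) (auto simp: g_def)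
qed

text \<open>Eigenvectors for distinct eigenvalues are orthogonal, hence independent. Finiteness
  makes the minimum in \<open>lambda_min\<close> meaningful and leaves room for a shift that is not
  an eigenvalue.\<close>

lemma symmetric_eigenvalues_finite:
  fixes T :: "'a::euclidean_space \<Rightarrow> 'a"
  assumes sym: "\<And>x y. T x \<bullet> y = T y \<bullet> x"
  shows "finite {t. \<exists>v. v \<noteq> 0 \<and> T v = t *\<^sub>R v}"
proof -
  let ?E = "{t. \<exists>v. v \<noteq> 0 \<and> T v = t *\<^sub>R v}"
  define e where "e t = (SOME v. v \<noteq> 0 \<and> T v = t *\<^sub>R v)" for t
  have e: "e t \<noteq> 0 \<and> T (e t) = t *\<^sub>R e t" if "t \<in> ?E" for t
    using that unfolding e_def mem_Collect_eq by (rule someI_ex)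
  have orth: "e s \<bullet> e t = 0" if "s \<in> ?E" "t \<in> ?E" "s \<noteq> t" for s t
  proof -
    have "s * (e s \<bullet> e t) = t * (e s \<bullet> e t)"
      using sym[of "e s" "e t"] e[OF that(1)] e[OF that(2)] by (simp add: inner_commute)
    then show ?thesis using that(3) by simp
  qed
  have "inj_on e ?E"
  proof (rule inj_onI, rule ccontr)
    fix s t assume st: "s \<in> ?E" "t \<in> ?E" "e s = e t" "s \<noteq> t"
    then have "e t \<bullet> e t = 0" using orth[of s t] by simp
    then show False using e[OF st(2)] by simp
  qed
  moreover have "independent (e ` ?E)"
  proof (rule pairwise_orthogonal_independent)
    show "pairwise orthogonal (e ` ?E)"
    proof (rule pairwiseI)
      fix x y assume "x \<in> e ` ?E" "y \<in> e ` ?E" "x \<noteq> y"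
      then obtain s t where "s \<in> ?E" "t \<in> ?E" "x = e s" "y = e t" by blast
      then show "orthogonal x y" using orth[of s t] \<open>x \<noteq> y\<close> by (auto simp: orthogonal_def)
    qed
    show "0 \<notin> e ` ?E" using e by force
  qed
  then have "finite (e ` ?E)" by (rule independent_imp_finite)
  ultimately show ?thesis by (rule finite_imageD[rotated])
qed

text \<open>Choose \<open>a > 0\<close> such that \<open>-a\<close> lies above a negative eigenvalue but is not itself one, and put
  \<open>Q z = - ((T z + a *\<^sub>R z) \<bullet> z)\<close>. As \<open>T + a\<close> is injective, a gradient step with matrix \<open>T\<close> increases \<open>Q\<close>
  by a multiple of \<open>(norm z)\<^sup>2\<close> on top of the exponential growth, which absorbs the perturbation.\<close>

lemma expanding_form:
  fixes T :: "'a::euclidean_space \<Rightarrow> 'a"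
  assumes lin: "bounded_linear T" and sym: "\<And>x y. T x \<bullet> y = T y \<bullet> x"
    and bound: "\<And>z. norm (T z) \<le> l * norm z" and \<eta>: "0 < \<eta>" "2 * (\<eta> * l) < 1" and l: "0 < l"
    and v: "v \<noteq> 0" "T v = t *\<^sub>R v" "t < 0"
  obtains Q \<rho> \<epsilon> b where "\<rho> > 1" "\<epsilon> > 0" "\<And>z. Q z \<le> b * (norm z)\<^sup>2" "\<And>s. s \<noteq> 0 \<Longrightarrow> Q (s *\<^sub>R v) > 0"
    "\<And>z w. norm (w - (z - \<eta> *\<^sub>R T z)) \<le> \<epsilon> * norm z \<Longrightarrow> \<rho> * Q z \<le> Q w"
proof -
  interpret bounded_linear T by (rule lin)
  have "infinite ({t<..<0} - {t. \<exists>v. v \<noteq> 0 \<and> T v = t *\<^sub>R v})"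
    using symmetric_eigenvalues_finite[of T, OF sym] v(3) by (intro Diff_infinite_finite infinite_Ioo) auto
  then have "{t<..<0} - {t. \<exists>v. v \<noteq> 0 \<and> T v = t *\<^sub>R v} \<noteq> {}" by (metis finite.emptyI)
  then obtain t' where t'E: "t' \<in> {t<..<0} - {t. \<exists>v. v \<noteq> 0 \<and> T v = t *\<^sub>R v}" by blast
  then have t': "t < t'" "t' < 0" by auto
  have noeig: "v = 0" if "T v = t' *\<^sub>R v" for v using t'E that by blast
  define a where "a = - t'"
  have a: "a > 0" "t + a < 0" using t' by (simp_all add: a_def)
  define B where "B z = T z + a *\<^sub>R z" for z
  have linB: "linear B"
    by (rule linearI) (simp_all add: B_def add scaleR algebra_simps)
  have "inj B"
    unfolding linear_injective_0[OF linB] using noeig by (auto simp: B_def a_def)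
  then obtain k where k: "k > 0" "\<And>z. k * norm z \<le> norm (B z)"
    using linear_inj_bounded_below_pos[OF linB] by blast
  define b where "b = l + a"
  have b: "b > 0" using l a by (simp add: b_def)
  have Bbound: "norm (B z) \<le> b * norm z" for z
    using norm_triangle_ineq[of "T z" "a *\<^sub>R z"] bound[of z] a by (simp add: B_def b_def algebra_simps)
  have Bsym: "B x \<bullet> y = B y \<bullet> x" for x y
    using sym[of x y] by (simp add: B_def inner_add_left inner_commute[of x y])
  have BB: "\<bar>B x \<bullet> y\<bar> \<le> b * norm x * norm y" for x y
    using Cauchy_Schwarz_ineq2[of "B x" y] mult_right_mono[OF Bbound[of x] norm_ge_zero[of y]] by linarith
  define V where "V z = - (B z \<bullet> z)" for z
  \<comment> \<open>With this \<open>\<rho>\<close> a gradient step is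
    \<open>\<rho> *\<^sub>R z - \<eta> *\<^sub>R B z\<close>, so the form \<open>V\<close> gains the
    factor \<open>\<rho>\<^sup>2\<close>.\<close>
  define \<rho> where "\<rho> = 1 + \<eta> * a"
  have \<rho>: "\<rho> > 1" using \<eta> a by (simp add: \<rho>_def)
  \<comment> \<open>The perturbation costs at most \<open>4 * b * \<epsilon>\<close> times
    \<open>(norm z)\<^sup>2\<close>: 3 parts from the mixed term, as
    \<open>norm y \<le> 3 / 2 * norm z\<close>, and 1 from the quadratic one. The gain is
    \<open>\<eta> * k\<^sup>2\<close> times the same.\<close>
  define \<epsilon> where "\<epsilon> = min 1 (\<eta> * k\<^sup>2 / (4 * b))"
  have \<epsilon>: "0 < \<epsilon>" "\<epsilon> \<le> 1" using \<eta> k b by (simp_all add: \<epsilon>_def)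
  have \<epsilon>b: "4 * b * \<epsilon> \<le> \<eta> * k\<^sup>2"
  proof -
    have "\<epsilon> \<le> \<eta> * k\<^sup>2 / (4 * b)" by (simp add: \<epsilon>_def)
    then show ?thesis using b by (simp add: field_simps)
  qed
  have grow: "\<rho>\<^sup>2 * V z \<le> V w" if w: "norm (w - (z - \<eta> *\<^sub>R T z)) \<le> \<epsilon> * norm z" for z w
  proof -
    define y where "y = z - \<eta> *\<^sub>R T z"
    define e where "e = w - y"
    define N where "N = (norm z)\<^sup>2"
    have y: "y = \<rho> *\<^sub>R z - \<eta> *\<^sub>R B z" by (simp add: y_def \<rho>_def B_def algebra_simps)
    have By: "B y = \<rho> *\<^sub>R B z - \<eta> *\<^sub>R B (B z)"
      unfolding y by (simp add: linear_diff[OF linB] linear_scale[OF linB])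
    have Vy: "V y = \<rho>\<^sup>2 * V z + 2 * \<rho> * \<eta> * (B z \<bullet> B z) - \<eta>\<^sup>2 * (B (B z) \<bullet> B z)"
      unfolding V_def By using Bsym[of "B z" z]
      by (simp add: y inner_diff_left inner_diff_right power2_eq_square algebra_simps)
    have "B (B z) \<bullet> B z \<le> b * (B z \<bullet> B z)"
      using BB[of "B z" "B z"] by (simp add: dot_square_norm power2_eq_square mult.assoc)
    then have "\<eta>\<^sup>2 * (B (B z) \<bullet> B z) \<le> \<eta>\<^sup>2 * (b * (B z \<bullet> B z))" by (intro mult_left_mono) auto
    moreover have "2 * \<rho> * \<eta> * (B z \<bullet> B z) - \<eta>\<^sup>2 * (b * (B z \<bullet> B z)) = \<eta> * (2 + \<eta> * a - \<eta> * l) * (B z \<bullet> B z)"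
      by (simp add: \<rho>_def b_def power2_eq_square algebra_simps)
    moreover have "\<eta> * 1 * (B z \<bullet> B z) \<le> \<eta> * (2 + \<eta> * a - \<eta> * l) * (B z \<bullet> B z)"
    proof (intro mult_right_mono mult_left_mono)
      have "0 < \<eta> * a" using \<eta>(1) a(1) by (rule mult_pos_pos)
      then show "1 \<le> 2 + \<eta> * a - \<eta> * l" using \<eta>(2) by linarith
    qed (use \<eta> in auto)
    ultimately have V1: "\<rho>\<^sup>2 * V z + \<eta> * (B z \<bullet> B z) \<le> V y" unfolding Vy by linarith
    have "k\<^sup>2 * N \<le> B z \<bullet> B z"
      using power_mono[OF k(2)[of z], of 2] k(1) by (simp add: N_def dot_square_norm power_mult_distrib)
    then have V2: "\<eta> * (k\<^sup>2 * N) \<le> \<eta> * (B z \<bullet> B z)" using \<eta> by (intro mult_left_mono) auto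
    have ew: "norm e \<le> \<epsilon> * norm z" using w by (simp add: e_def y_def)
    have "norm y \<le> norm z + norm (\<eta> *\<^sub>R T z)" unfolding y_def by (rule norm_triangle_ineq4)
    also have "norm (\<eta> *\<^sub>R T z) \<le> \<eta> * (l * norm z)"
      using mult_left_mono[OF bound[of z], of \<eta>] \<eta>(1) by (simp only: norm_scaleR abs_of_pos less_imp_le)
    finally have "norm y \<le> norm z + \<eta> * (l * norm z)" by simp
    moreover have "2 * (\<eta> * l) * norm z \<le> 1 * norm z" using \<eta> by (intro mult_right_mono) auto
    ultimately have ny: "norm y \<le> 3 / 2 * norm z" by (simp add: algebra_simps)
    have "V w = V y - 2 * (B y \<bullet> e) - B e \<bullet> e"
    proof -
      have wye: "w = y + e" by (simp add: e_def)
      show ?thesis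
        unfolding V_def wye using Bsym[of e y]
        by (simp add: linear_add[OF linB] inner_add_left inner_add_right)
    qed
    moreover have "\<bar>B y \<bullet> e\<bar> \<le> 3 / 2 * (b * \<epsilon> * N)"
    proof -
      have "b * norm y * norm e \<le> b * (3 / 2 * norm z) * (\<epsilon> * norm z)"
        using b ny ew by (intro mult_mono) auto
      then show ?thesis using BB[of y e] by (simp add: N_def power2_eq_square algebra_simps)
    qed
    moreover have "\<bar>B e \<bullet> e\<bar> \<le> b * \<epsilon> * N"
    proof -
      have "b * norm e * norm e \<le> b * (\<epsilon> * norm z) * (1 * norm z)"
        using b ew \<epsilon> mult_right_mono[OF \<epsilon>(2) norm_ge_zero[of z]] by (intro mult_mono) auto
      then show ?thesis using BB[of e e] by (simp add: N_def power2_eq_square algebra_simps)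
    qed
    moreover have "4 * (b * \<epsilon> * N) \<le> \<eta> * (k\<^sup>2 * N)"
      using mult_right_mono[OF \<epsilon>b, of N] by (simp add: N_def algebra_simps)
    ultimately show ?thesis using V1 V2 by linarith
  qed
  show ?thesis
  proof (rule that[of "\<rho>\<^sup>2" \<epsilon> V b])
    show "\<rho>\<^sup>2 > 1" using \<rho> by (simp add: power2_eq_square less_1_mult)
    show "V z \<le> b * (norm z)\<^sup>2" for z
      using BB[of z z] by (simp add: V_def power2_eq_square mult.assoc abs_le_iff)
    show "V (s *\<^sub>R v) > 0" if "s \<noteq> 0" for s
    proof -
      have "B (s *\<^sub>R v) = (s * (t + a)) *\<^sub>R v" by (simp add: B_def scaleR v(2) algebra_simps)
      then have "V (s *\<^sub>R v) = - (t + a) * (s * s) * (v \<bullet> v)" by (simp add: V_def algebra_simps)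
      also have "\<dots> > 0"
      proof -
        have "- (t + a) > 0" "s * s > 0" "v \<bullet> v > 0"
          using a(2) that v(1) by (auto simp: zero_less_mult_iff linorder_neq_iff)
        then show ?thesis by (rule mult_pos_pos[OF mult_pos_pos])
      qed
      finally show ?thesis .
    qed
  qed (use grow \<epsilon> in auto)
qed

text \<open>Otherwise infinitely many disjoint translates of \<open>W\<close> would fit into a bounded set.\<close>

lemma negligible_thin:
  fixes W :: "'a::euclidean_space set"
  assumes W: "compact W" and thin: "\<And>x y s. x \<in> W \<Longrightarrow> y \<in> W \<Longrightarrow> x - y = s *\<^sub>R v \<Longrightarrow> s = 0"
  shows "negligible W"
proof -
  obtain r where "\<forall>x\<in>W. norm x \<le> r" using compact_imp_bounded[OF W] unfolding bounded_iff by blast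
  then have r: "W \<subseteq> cball 0 r" by auto
  define A where "A n = (+) ((1 / real (Suc n)) *\<^sub>R v) ` W" for n
  have lm: "W \<in> lmeasurable" using W by (rule lmeasurable_compact)
  have lmA: "A n \<in> lmeasurable" for n unfolding A_def by (rule measurable_translation[OF lm])
  have mA: "measure lebesgue (A n) = measure lebesgue W" for n unfolding A_def by (rule measure_translation)
  have disj: "disjoint_family_on A S" for S
    unfolding disjoint_family_on_def
  proof (intro ballI impI)
    fix m n :: nat assume "m \<noteq> n"
    show "A m \<inter> A n = {}"
    proof (rule ccontr)
      assume "A m \<inter> A n \<noteq> {}"
      then obtain x y where xy: "x \<in> W" "y \<in> W"
        "(1 / real (Suc m)) *\<^sub>R v + x = (1 / real (Suc n)) *\<^sub>R v + y" by (auto simp: A_def)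
      then have "x - y = (1 / real (Suc n) - 1 / real (Suc m)) *\<^sub>R v"
        by (simp add: algebra_simps)
      then have "1 / real (Suc n) - 1 / real (Suc m) = 0" by (rule thin[OF xy(1,2)])
      then show False using \<open>m \<noteq> n\<close> by simp
    qed
  qed
  let ?D = "cball (0::'a) (r + norm v)"
  have sub: "A n \<subseteq> ?D" for n
  proof
    fix y assume "y \<in> A n"
    then obtain x where x: "x \<in> W" "y = (1 / real (Suc n)) *\<^sub>R v + x" by (auto simp: A_def)
    have "norm ((1 / real (Suc n)) *\<^sub>R v) \<le> 1 * norm v"
      unfolding norm_scaleR by (intro mult_right_mono) auto
    then have "norm y \<le> norm v + norm x" using norm_triangle_ineq[of "(1 / real (Suc n)) *\<^sub>R v" x] x(2) by simp
    moreover have "norm x \<le> r" using r x(1) by auto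
    ultimately show "y \<in> ?D" by simp
  qed
  have le: "real N * measure lebesgue W \<le> measure lebesgue ?D" for N
  proof -
    have "measure lebesgue (\<Union>n\<in>{..<N}. A n) = (\<Sum>n<N. measure lebesgue (A n))"
    proof (intro measure_finite_Union disj)
      show "emeasure lebesgue (A n) \<noteq> \<infinity>" for n
        using fmeasurableD2[OF lmA[of n]] by (simp only: infinity_ennreal_def) simp
    qed (use lmA fmeasurableD in auto)
    then have "real N * measure lebesgue W = measure lebesgue (\<Union>n\<in>{..<N}. A n)" by (simp add: mA)
    also have "\<dots> \<le> measure lebesgue ?D"
      using sub lmA by (intro measure_mono_fmeasurable lmeasurable_cball) (auto intro!: sets.finite_UN simp: fmeasurable_def)
    finally show ?thesis .
  qed
  have "measure lebesgue W = 0"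
  proof (rule ccontr)
    assume "measure lebesgue W \<noteq> 0"
    then have "measure lebesgue W > 0" using measure_nonneg[of lebesgue W] by linarith
    then obtain N :: nat where "measure lebesgue ?D < real N * measure lebesgue W"
      using reals_Archimedean3 by blast
    with le[of N] show False by simp
  qed
  then show ?thesis using lm by (simp add: negligible_iff_measure)
qed

section \<open>Trajectories that stay near a point\<close>

text \<open>Non-autonomous iteration: the value of \<open>h\<close> at time \<open>n\<close> is
  absorbed into the map \<open>\<phi> n\<close>. Restarting at time \<open>m\<close> therefore also
  shifts the sequence of maps, as in \<open>orbit_add\<close>.\<close>

primrec orbit :: "(nat \<Rightarrow> 'a \<Rightarrow> 'a) \<Rightarrow> nat \<Rightarrow> 'a \<Rightarrow> 'a" where
  "orbit \<phi> 0 x = x"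
| "orbit \<phi> (Suc n) x = \<phi> n (orbit \<phi> n x)"

lemma orbit_add: "orbit \<phi> (m + n) x = orbit (\<lambda>k. \<phi> (m + k)) n (orbit \<phi> m x)"
  by (induction n) auto

lemma orbit_continuous:
  fixes \<phi> :: "nat \<Rightarrow> 'a::topological_space \<Rightarrow> 'a"
  assumes "\<And>n. continuous_on UNIV (\<phi> n)"
  shows "continuous_on UNIV (orbit \<phi> n)"
  by (induction n) (auto intro!: continuous_on_compose2[OF assms] simp: continuous_on_id)

lemma staying_negligible:
  fixes \<phi> :: "nat \<Rightarrow> 'a::euclidean_space \<Rightarrow> 'a"
  assumes cont: "\<And>n. continuous_on UNIV (\<phi> n)"
    and Q: "\<rho> > 1" "\<And>z. Q z \<le> b * (norm z)\<^sup>2" "\<And>s. s \<noteq> 0 \<Longrightarrow> Q (s *\<^sub>R v) > 0"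
    and expand: "\<And>n x y. x \<in> cball p r \<Longrightarrow> y \<in> cball p r \<Longrightarrow> \<rho> * Q (x - y) \<le> Q (\<phi> n x - \<phi> n y)"
  shows "negligible {x. \<forall>n. orbit \<phi> n x \<in> cball p r}"
proof (rule negligible_thin[where v=v])
  let ?W = "{x. \<forall>n. orbit \<phi> n x \<in> cball p r}"
  have "closed ?W"
  proof -
    have "?W = (\<Inter>n. orbit \<phi> n -` cball p r)" by auto
    then show ?thesis by (auto intro!: closed_INT closed_vimage orbit_continuous cont)
  qed
  moreover have "?W \<subseteq> cball p r"
  proof
    fix x assume "x \<in> ?W"
    then have "orbit \<phi> 0 x \<in> cball p r" by blast
    then show "x \<in> cball p r" by simp
  qed
  then have "bounded ?W" by (rule bounded_subset[OF bounded_cball])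
  ultimately show "compact ?W" by (simp add: compact_eq_bounded_closed)
  fix x y s assume x: "x \<in> ?W" and y: "y \<in> ?W" and s: "x - y = s *\<^sub>R v"
  show "s = 0"
  proof (rule ccontr)
    assume "s \<noteq> 0"
    then have pos: "Q (x - y) > 0" using Q(3) s by simp
    have grow: "\<rho> ^ n * Q (x - y) \<le> Q (orbit \<phi> n x - orbit \<phi> n y)" for n
    proof (induction n)
      case (Suc n)
      have "\<rho> ^ Suc n * Q (x - y) = \<rho> * (\<rho> ^ n * Q (x - y))" by simp
      also have "\<dots> \<le> \<rho> * Q (orbit \<phi> n x - orbit \<phi> n y)" using Suc Q(1) by (intro mult_left_mono) auto
      also have "\<dots> \<le> Q (orbit \<phi> (Suc n) x - orbit \<phi> (Suc n) y)"
        using expand x y by simp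
      finally show ?case .
    qed simp
    have bound: "Q (orbit \<phi> n x - orbit \<phi> n y) \<le> \<bar>b\<bar> * (2 * r)\<^sup>2" for n
    proof -
      have "norm (orbit \<phi> n x - orbit \<phi> n y) \<le> 2 * r"
        using x y dist_triangle2[of "orbit \<phi> n x" "orbit \<phi> n y" p]
        by (smt (verit, ccfv_threshold) dist_commute dist_norm mem_Collect_eq mem_cball)
      then have "(norm (orbit \<phi> n x - orbit \<phi> n y))\<^sup>2 \<le> (2 * r)\<^sup>2" by (intro power_mono) auto
      then have "\<bar>b\<bar> * (norm (orbit \<phi> n x - orbit \<phi> n y))\<^sup>2 \<le> \<bar>b\<bar> * (2 * r)\<^sup>2" by (intro mult_left_mono) auto
      moreover have "b * (norm (orbit \<phi> n x - orbit \<phi> n y))\<^sup>2 \<le> \<bar>b\<bar> * (norm (orbit \<phi> n x - orbit \<phi> n y))\<^sup>2"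
        by (intro mult_right_mono) auto
      ultimately show ?thesis using Q(2)[of "orbit \<phi> n x - orbit \<phi> n y"] by linarith
    qed
    obtain n where "\<bar>b\<bar> * (2 * r)\<^sup>2 / Q (x - y) < \<rho> ^ n" using real_arch_pow[OF Q(1)] by blast
    then have "\<bar>b\<bar> * (2 * r)\<^sup>2 < \<rho> ^ n * Q (x - y)" using pos by (simp add: field_simps)
    then show False using grow[of n] bound[of n] by linarith
  qed
qed

section \<open>Local analysis at a strict saddle\<close>

text \<open>\<open>C2_fun\<close> speaks of derivatives as functionals. The Riesz isomorphism
  \<open>T\<close> turns them into vectors; being bounded and linear, it carries the second
  derivative over as well.\<close>

lemma C2_gradient:
  fixes f :: "'a::euclidean_space \<Rightarrow> real"
  assumes "C2_fun f"
  obtains gr :: "'a \<Rightarrow> 'a" and H :: "'a \<Rightarrow> 'a \<Rightarrow>\<^sub>L 'a" where "\<And>x. GDERIV f x :> gr x"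
    "\<And>x. (gr has_derivative blinfun_apply (H x)) (at x)" "continuous_on UNIV H"
proof -
  obtain f' :: "'a \<Rightarrow> 'a \<Rightarrow>\<^sub>L real" and f'' :: "'a \<Rightarrow> 'a \<Rightarrow>\<^sub>L ('a \<Rightarrow>\<^sub>L real)"
    where f': "\<And>x. (f has_derivative blinfun_apply (f' x)) (at x)"
      and f'': "\<And>x. (f' has_derivative blinfun_apply (f'' x)) (at x)" and cont: "continuous_on UNIV f''"
    using assms unfolding C2_fun_def C1_fun_def by blast
  define T where "T \<phi> = (\<Sum>b\<in>Basis. blinfun_apply \<phi> b *\<^sub>R b)" for \<phi> :: "'a \<Rightarrow>\<^sub>L real"
  have T: "bounded_linear T"
    unfolding T_def[abs_def]
    by (intro bounded_linear_sum bounded_linear_scaleR_const blinfun.bounded_linear_left)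
  have inner_T: "h \<bullet> T \<phi> = blinfun_apply \<phi> h" for h \<phi>
  proof -
    have "h \<bullet> T \<phi> = (\<Sum>b\<in>Basis. blinfun_apply \<phi> ((h \<bullet> b) *\<^sub>R b))"
      by (simp add: T_def inner_sum_right blinfun.scaleR_right mult.commute)
    also have "\<dots> = blinfun_apply \<phi> (\<Sum>b\<in>Basis. (h \<bullet> b) *\<^sub>R b)" by (simp add: blinfun.sum_right)
    finally show ?thesis by (simp add: euclidean_representation)
  qed
  define H where "H x = Blinfun T o\<^sub>L f'' x" for x
  show ?thesis
  proof (rule that[of "\<lambda>x. T (f' x)" H])
    show "GDERIV f x :> T (f' x)" for x
      unfolding gderiv_def inner_T by (rule f')
    show "((\<lambda>x. T (f' x)) has_derivative blinfun_apply (H x)) (at x)" for x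
      by (rule has_derivative_eq_rhs[OF bounded_linear.has_derivative[OF T f'']])
        (simp add: H_def fun_eq_iff bounded_linear_Blinfun_apply[OF T])
    show "continuous_on UNIV H"
      unfolding H_def[abs_def]
      by (intro bounded_bilinear.continuous_on[OF bounded_bilinear_blinfun_compose] continuous_on_const cont)
  qed
qed

lemma gradient_eq: "GDERIV f x :> D \<Longrightarrow> gradient f x = D"
  unfolding gradient_def
proof (rule the_equality)
  fix D' assume "GDERIV f x :> D" "GDERIV f x :> D'"
  then have "(\<lambda>h. h \<bullet> D) = (\<lambda>h. h \<bullet> D')" unfolding gderiv_def by (rule has_derivative_unique)
  then have "\<forall>h. h \<bullet> D' = h \<bullet> D" by (metis)
  then show "D' = D" by (simp only: vector_eq_ldot)
qed

text \<open>By symmetry the set of eigenvalues is finite and nonempty, so \<open>lambda_min\<close>,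
  defined through \<open>Min\<close>, is attained by an eigenvector.\<close>

lemma strict_saddle_eigenvector:
  fixes f :: "real ^ 'd \<Rightarrow> real"
  assumes grad: "\<And>x. GDERIV f x :> gr x" and H: "(gr has_derivative blinfun_apply H) (at p)"
    and sym: "\<And>u v. H u \<bullet> v = H v \<bullet> u" and saddle: "strict_saddle_point f p"
  shows "\<exists>v t. v \<noteq> 0 \<and> t < 0 \<and> H v = t *\<^sub>R v"
proof -
  have "gradient f = gr" using gradient_eq[OF grad] by blast
  then have "(gr has_derivative (\<lambda>h. hessian f p *v h)) (at p)"
    unfolding hessian_def using H jacobian_works differentiableI by metis
  then have mv: "hessian f p *v v = H v" for v
    using has_derivative_unique[OF _ H] by metis
  have E: "eigenvalues (hessian f p) = {t. \<exists>v. v \<noteq> 0 \<and> H v = t *\<^sub>R v}"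
    by (simp add: eigenvalues_def mv)
  have "finite (eigenvalues (hessian f p))"
    unfolding E using sym by (rule symmetric_eigenvalues_finite)
  moreover have "eigenvalues (hessian f p) \<noteq> {}"
    unfolding E using symmetric_eigenvalue_exists[OF blinfun.bounded_linear_right sym] by blast
  ultimately have "lambda_min (hessian f p) \<in> eigenvalues (hessian f p)"
    unfolding lambda_min_def by (rule Min_in)
  moreover have "lambda_min (hessian f p) < 0" using saddle by (simp add: strict_saddle_point_def)
  ultimately show ?thesis unfolding E by blast
qed

lemma derivative_Lipschitz_bound:
  assumes der: "(g has_derivative g') (at x)" and Lip: "\<And>x y. norm (g x - g y) \<le> l * norm (x - y)"
  shows "norm (g' z) \<le> l * norm z"
proof (cases "z = 0")
  case True
  then show ?thesis using linear_0[OF has_derivative_linear[OF der]] by simp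
next
  case False
  show ?thesis
  proof (rule field_le_epsilon)
    fix e :: real assume e: "e > 0"
    define e' where "e' = e / norm z"
    have "e' > 0" using e False by (simp add: e'_def)
    then obtain \<delta> where \<delta>: "\<delta> > 0"
      and alt: "\<And>y. norm (y - x) < \<delta> \<Longrightarrow> norm (g y - g x - g' (y - x)) \<le> e' * norm (y - x)"
      using der unfolding has_derivative_at_alt by blast
    define s where "s = \<delta> / (2 * norm z)"
    have s: "s > 0" using \<delta> False by (simp add: s_def)
    have "norm (s *\<^sub>R z) < \<delta>" using s \<delta> False by (simp add: s_def)
    then have "norm (g (x + s *\<^sub>R z) - g x - g' (s *\<^sub>R z)) \<le> e' * norm (s *\<^sub>R z)"
      using alt[of "x + s *\<^sub>R z"] by simp
    moreover have "norm (g (x + s *\<^sub>R z) - g x) \<le> l * norm (s *\<^sub>R z)"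
      using Lip[of "x + s *\<^sub>R z" x] by simp
    ultimately have "norm (g' (s *\<^sub>R z)) \<le> l * norm (s *\<^sub>R z) + e' * norm (s *\<^sub>R z)"
      using norm_triangle_ineq4[of "g (x + s *\<^sub>R z) - g x" "g (x + s *\<^sub>R z) - g x - g' (s *\<^sub>R z)"] by simp
    moreover have "g' (s *\<^sub>R z) = s *\<^sub>R g' z" using linear_scale[OF has_derivative_linear[OF der]] by blast
    ultimately have "s * norm (g' z) \<le> s * (l * norm z + e' * norm z)"
      using s by (simp add: algebra_simps)
    then have "norm (g' z) \<le> l * norm z + e' * norm z" using s by (simp only: mult_le_cancel_left_pos)
    then show "norm (g' z) \<le> l * norm z + e" using False by (simp add: e'_def)
  qed
qed

text \<open>Near \<open>(p, 0)\<close> the derivative of \<open>q\<close> in the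
  \<open>x\<close>-directions is within \<open>\<epsilon> / \<eta>\<close> of \<open>H\<close>. By
  the mean value inequality for \<open>q - H\<close>, the difference of two points evolves by the
  linear gradient step up to the error that the expanding form tolerates. The radius
  \<open>r\<close> does not depend on the sequence \<open>h\<close>, so it also serves every tail of
  \<open>h\<close>.\<close>

lemma saddle_staying_negligible:
  fixes q :: "'a::euclidean_space \<times> real \<Rightarrow> 'a"
  assumes q: "\<And>z. (q has_derivative blinfun_apply (q' z)) (at z)" and contq: "continuous_on UNIV q'"
    and q0: "\<And>x. q (x, 0) = gr x" and H: "(gr has_derivative blinfun_apply H) (at p)"
    and sym: "\<And>u v. H u \<bullet> v = H v \<bullet> u" and bound: "\<And>z. norm (H z) \<le> l * norm z"
    and \<eta>: "0 < \<eta>" "2 * (\<eta> * l) < 1" and l: "0 < l" and v: "v \<noteq> 0" "H v = t *\<^sub>R v" "t < 0"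
  obtains r where "r > 0" "\<And>h :: nat \<Rightarrow> real. (\<And>n. \<bar>h n\<bar> \<le> r) \<Longrightarrow>
    negligible {x. \<forall>n. orbit (\<lambda>n x. x - \<eta> *\<^sub>R q (x, h n)) n x \<in> cball p r}"
proof -
  obtain Q \<rho> \<epsilon> b where Q: "\<rho> > 1" "\<epsilon> > 0" "\<And>z. Q z \<le> b * (norm z)\<^sup>2" "\<And>s. s \<noteq> 0 \<Longrightarrow> Q (s *\<^sub>R v) > 0"
    and expand: "\<And>z w. norm (w - (z - \<eta> *\<^sub>R H z)) \<le> \<epsilon> * norm z \<Longrightarrow> \<rho> * Q z \<le> Q w"
    by (rule expanding_form[OF blinfun.bounded_linear_right[of H] sym bound \<eta> l v]) (rule that)
  have "\<epsilon> / \<eta> > 0" using Q(2) \<eta> by simp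
  then obtain r0 where r0: "r0 > 0" "\<And>z. dist z (p, 0) < r0 \<Longrightarrow> dist (q' z) (q' (p, 0)) \<le> \<epsilon> / \<eta>"
    using contq[unfolded continuous_on_iff, rule_format, of "(p, 0)" "\<epsilon> / \<eta>"] less_imp_le by blast
  \<comment> \<open>The offsets in \<open>x\<close> and in \<open>h\<close> are at most
    \<open>r\<close> each, and \<open>2 * r < r0\<close>.\<close>
  define r where "r = r0 / 3"
  have r: "r > 0" using r0 by (simp add: r_def)
  have q'p: "q' (p, 0) (z, 0) = H z" for z
  proof -
    have emb: "((\<lambda>x. (x, 0::real)) has_derivative (\<lambda>z. (z, 0))) (at p)"
      by (auto intro!: derivative_eq_intros)
    have "((\<lambda>x. q (x, 0)) has_derivative (\<lambda>z. q' (p, 0) (z, 0))) (at p)"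
      using has_derivative_compose[OF emb q] .
    then have "(gr has_derivative (\<lambda>z. q' (p, 0) (z, 0))) (at p)" by (simp add: q0)
    from has_derivative_unique[OF this H] show ?thesis by (rule fun_cong)
  qed
  show ?thesis
  proof (rule that[OF r])
    fix h :: "nat \<Rightarrow> real" assume h: "\<And>n. \<bar>h n\<bar> \<le> r"
    let ?\<phi> = "\<lambda>n x. x - \<eta> *\<^sub>R q (x, h n)"
    show "negligible {x. \<forall>n. orbit ?\<phi> n x \<in> cball p r}"
    proof (rule staying_negligible[OF _ Q(1,3,4)])
      show "continuous_on UNIV (?\<phi> n)" for n
      proof -
        have "continuous_on UNIV q"
          by (intro continuous_at_imp_continuous_on ballI has_derivative_continuous[OF q])
        then show ?thesis
          by (intro continuous_on_diff continuous_on_scaleR continuous_on_id continuous_on_const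
              continuous_on_compose2[of UNIV q UNIV "\<lambda>x. (x, h n)"] continuous_on_Pair subset_UNIV)
      qed
      fix n x y assume xy: "x \<in> cball p r" "y \<in> cball p r"
      let ?G = "\<lambda>x. q (x, h n) - H x"
      have "norm (?G x - ?G y) \<le> \<epsilon> / \<eta> * norm (x - y)"
      proof (rule differentiable_bound[OF convex_cball[of p r] _ _ xy])
        fix w assume w: "w \<in> cball p r"
        have emb: "((\<lambda>x. (x, h n)) has_derivative (\<lambda>z. (z, 0))) (at w)"
          by (auto intro!: derivative_eq_intros)
        have "(?G has_derivative (\<lambda>z. q' (w, h n) (z, 0) - H z)) (at w)"
          by (rule has_derivative_diff[OF has_derivative_compose[OF emb q]
              bounded_linear_imp_has_derivative[OF blinfun.bounded_linear_right]])
        then show "(?G has_derivative (\<lambda>z. q' (w, h n) (z, 0) - H z)) (at w within cball p r)"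
          by (rule has_derivative_at_withinI)
        show "onorm (\<lambda>z. q' (w, h n) (z, 0) - H z) \<le> \<epsilon> / \<eta>"
        proof (rule onorm_le)
          fix z :: 'a
          have "dist (w, h n) (p, 0) \<le> dist w p + \<bar>h n\<bar>"
            unfolding dist_Pair_Pair using sqrt_sum_squares_le_sum_abs[of "dist w p" "dist (h n) 0"]
            by (simp add: dist_real_def)
          also have "\<dots> < r0" using w h[of n] r0(1) by (simp add: r_def dist_commute)
          finally have "norm (q' (w, h n) - q' (p, 0)) \<le> \<epsilon> / \<eta>" using r0(2) by (simp add: dist_norm)
          then have "norm (q' (w, h n) - q' (p, 0)) * norm (z, 0::real) \<le> \<epsilon> / \<eta> * norm z"
            using mult_right_mono[of "norm (q' (w, h n) - q' (p, 0))" "\<epsilon> / \<eta>" "norm z"] by (simp add: norm_Pair)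
          then show "norm (q' (w, h n) (z, 0) - H z) \<le> \<epsilon> / \<eta> * norm z"
            using norm_blinfun[of "q' (w, h n) - q' (p, 0)" "(z, 0)"]
            by (simp add: blinfun.diff_left q'p)
        qed
      qed
      then have "\<eta> * norm (?G x - ?G y) \<le> \<epsilon> * norm (x - y)"
        using mult_left_mono[of "norm (?G x - ?G y)" "\<epsilon> / \<eta> * norm (x - y)" \<eta>] \<eta> by simp
      moreover have "(?\<phi> n x - ?\<phi> n y) - ((x - y) - \<eta> *\<^sub>R H (x - y)) = - (\<eta> *\<^sub>R (?G x - ?G y))"
        by (simp add: algebra_simps blinfun.diff_right)
      ultimately show "\<rho> * Q (x - y) \<le> Q (?\<phi> n x - ?\<phi> n y)"
        using \<eta> by (intro expand) simp
    qed
  qed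
qed

lemma negligible_preimage_expanding:
  fixes \<phi> :: "'a::euclidean_space \<Rightarrow> 'a"
  assumes m: "m > 0" and expand: "\<And>x y. m * norm (x - y) \<le> norm (\<phi> x - \<phi> y)" and N: "negligible N"
  shows "negligible {x. \<phi> x \<in> N}"
proof -
  have inj: "inj \<phi>"
  proof (rule injI)
    fix x y assume "\<phi> x = \<phi> y"
    then show "x = y" using expand[of x y] m by (simp add: mult_le_0_iff)
  qed
  have "{x. \<phi> x \<in> N} = inv \<phi> ` (N \<inter> range \<phi>)"
  proof (intro set_eqI iffI)
    fix x assume "x \<in> {x. \<phi> x \<in> N}"
    then show "x \<in> inv \<phi> ` (N \<inter> range \<phi>)"
      using inv_f_f[OF inj, of x] by (intro image_eqI[of _ _ "\<phi> x"]) auto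
  qed (use inv_f_f[OF inj] in auto)
  moreover have "negligible (inv \<phi> ` (N \<inter> range \<phi>))"
  proof (rule negligible_locally_Lipschitz_image)
    show "negligible (N \<inter> range \<phi>)" using N by (rule negligible_subset) auto
    fix x assume "x \<in> N \<inter> range \<phi>"
    then obtain a where a: "x = \<phi> a" by auto
    show "\<exists>T B. open T \<and> x \<in> T \<and> (\<forall>y\<in>N \<inter> range \<phi> \<inter> T. norm (inv \<phi> y - inv \<phi> x) \<le> B * norm (y - x))"
    proof (intro exI[of _ UNIV] exI[of _ "1 / m"] conjI ballI)
      fix y assume "y \<in> N \<inter> range \<phi> \<inter> UNIV"
      then obtain b where b: "y = \<phi> b" by auto
      show "norm (inv \<phi> y - inv \<phi> x) \<le> 1 / m * norm (y - x)"
        using expand[of b a] m by (simp add: a b inv_f_f[OF inj] field_simps)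
    qed auto
  qed simp
  ultimately show ?thesis by simp
qed

lemma negligible_orbit_preimage:
  fixes \<phi> :: "nat \<Rightarrow> 'a::euclidean_space \<Rightarrow> 'a"
  assumes m: "m > 0" and expand: "\<And>n x y. m * norm (x - y) \<le> norm (\<phi> n x - \<phi> n y)"
  shows "negligible N \<Longrightarrow> negligible {x. orbit \<phi> n x \<in> N}"
proof (induction n arbitrary: N)
  case (Suc n)
  have "negligible {y. \<phi> n y \<in> N}" by (rule negligible_preimage_expanding[OF m expand Suc.prems])
  from Suc.IH[OF this] show ?case by simp
qed simp

text \<open>A trajectory converging to a saddle stays in one of countably many balls from some time
  \<open>m\<close> on, with \<open>h\<close> small from then on. The starting points are thus
  preimages, under the first \<open>m\<close> steps, of null sets belonging to the shifted
  sequence.\<close>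

lemma saddle_basin_negligible:
  fixes \<psi> :: "real \<Rightarrow> 'a::euclidean_space \<Rightarrow> 'a" and h :: "nat \<Rightarrow> real"
  assumes m: "m > 0" and expand: "\<And>h x y. m * norm (x - y) \<le> norm (\<psi> h x - \<psi> h y)"
    and h: "h \<longlonglongrightarrow> 0"
    and stay: "\<And>p. p \<in> Z \<Longrightarrow> \<exists>r>0. \<forall>h :: nat \<Rightarrow> real. (\<forall>n. \<bar>h n\<bar> \<le> r) \<longrightarrow>
      negligible {x. \<forall>n. orbit (\<lambda>n. \<psi> (h n)) n x \<in> cball p r}"
  shows "negligible {x. \<exists>p\<in>Z. (\<lambda>n. orbit (\<lambda>n. \<psi> (h n)) n x) \<longlonglongrightarrow> p}"
proof -
  obtain r where r: "\<And>p. p \<in> Z \<Longrightarrow> r p > 0"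
    and neg: "\<And>p h. p \<in> Z \<Longrightarrow> (\<And>n. \<bar>h n\<bar> \<le> r p) \<Longrightarrow>
      negligible {x. \<forall>n. orbit (\<lambda>n. \<psi> ((h :: nat \<Rightarrow> real) n)) n x \<in> cball p (r p)}"
    using stay by metis
  let ?B = "\<lambda>p. ball p (r p)"
  obtain F where F: "F \<subseteq> ?B ` Z" "countable F" "\<Union>F = \<Union>(?B ` Z)"
    using Lindelof[of "?B ` Z"] by blast
  obtain Z' where Z': "countable Z'" "Z' \<subseteq> Z" "F = ?B ` Z'"
    using countable_subset_image[of F ?B Z] F(1,2) by blast
  let ?\<phi> = "\<lambda>n. \<psi> (h n)"
  define W where "W p m = {x. \<forall>n. orbit (\<lambda>n. \<psi> (h (m + n))) n x \<in> cball p (r p)}" for p m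
  \<comment> \<open>Nullity of \<open>W p m\<close> is available only if the tail of
    \<open>h\<close> from time \<open>m\<close> is small; other pairs contribute nothing.\<close>
  define S where "S = (\<lambda>(p, m). if \<forall>n. \<bar>h (m + n)\<bar> \<le> r p then {x. orbit ?\<phi> m x \<in> W p m} else {})"
  have "negligible (S (p, k))" if "p \<in> Z'" for p k
  proof (cases "\<forall>n. \<bar>h (k + n)\<bar> \<le> r p")
    case True
    have "negligible (W p k)" unfolding W_def by (rule neg) (use that Z' True in auto)
    then have "negligible {x. orbit ?\<phi> k x \<in> W p k}" by (rule negligible_orbit_preimage[OF m expand])
    then show ?thesis using True by (simp add: S_def)
  next
    case False
    then have "S (p, k) = {}" by (simp only: S_def prod.case if_False)
    then show ?thesis by simp
  qed
  then have "negligible (\<Union>(S ` (Z' \<times> UNIV)))"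
    using Z'(1) by (intro negligible_countable_Union) auto
  moreover have "{x. \<exists>p\<in>Z. (\<lambda>n. orbit ?\<phi> n x) \<longlonglongrightarrow> p} \<subseteq> \<Union>(S ` (Z' \<times> UNIV))"
  proof
    fix x assume "x \<in> {x. \<exists>p\<in>Z. (\<lambda>n. orbit ?\<phi> n x) \<longlonglongrightarrow> p}"
    then obtain p where p: "p \<in> Z" "(\<lambda>n. orbit ?\<phi> n x) \<longlonglongrightarrow> p" by blast
    have "p \<in> \<Union>(?B ` Z)" using p(1) r by force
    then have "p \<in> \<Union>F" unfolding F(3) .
    then obtain p' where p': "p' \<in> Z'" "p \<in> ?B p'" unfolding Z'(3) by blast
    have "\<forall>\<^sub>F n in sequentially. orbit ?\<phi> n x \<in> ?B p'"
      using p(2) p'(2) by (intro topological_tendstoD) auto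
    moreover have "\<forall>\<^sub>F n in sequentially. \<bar>h n\<bar> < r p'"
      using order_tendstoD(2)[OF tendsto_rabs_zero[OF h], of "r p'"] r p'(1) Z'(2) by auto
    ultimately have "\<forall>\<^sub>F n in sequentially. orbit ?\<phi> n x \<in> ?B p' \<and> \<bar>h n\<bar> < r p'"
      by (rule eventually_conj)
    then obtain k where k: "\<And>n. n \<ge> k \<Longrightarrow> orbit ?\<phi> n x \<in> ?B p' \<and> \<bar>h n\<bar> < r p'"
      unfolding eventually_sequentially by blast
    have "\<forall>n. \<bar>h (k + n)\<bar> \<le> r p'"
    proof
      fix n show "\<bar>h (k + n)\<bar> \<le> r p'" using k[of "k + n"] by simp
    qed
    moreover have "orbit ?\<phi> k x \<in> W p' k"
      unfolding W_def
    proof (intro CollectI allI)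
      fix n
      have "orbit ?\<phi> (k + n) x \<in> ?B p'" using k by simp
      then show "orbit (\<lambda>n. \<psi> (h (k + n))) n (orbit ?\<phi> k x) \<in> cball p' (r p')"
        using orbit_add[of ?\<phi> k n x] by simp
    qed
    ultimately have "x \<in> S (p', k)" by (simp add: S_def)
    then show "x \<in> \<Union>(S ` (Z' \<times> UNIV))" using p'(1) by blast
  qed
  ultimately show ?thesis by (rule negligible_subset)
qed

section \<open>Measurability and the probability of the event\<close>

text \<open>For a fixed radius, being minimal in the ball of that radius is a closed condition; the
  radii \<open>1 / Suc n\<close> exhaust all local minimizers.\<close>

lemma local_minimizers_borel:
  fixes f :: "'a::euclidean_space \<Rightarrow> real"
  assumes f: "continuous_on UNIV f"
  shows "{x. local_minimizer f x} \<in> sets borel"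
proof -
  define A where "A n = {x. \<forall>y. dist y x < 1 / real (Suc n) \<longrightarrow> f x \<le> f y}" for n
  have "closed (A n)" for n
    unfolding closed_sequential_limits
  proof (intro allI impI)
    fix x l assume "(\<forall>k. x k \<in> A n) \<and> x \<longlonglongrightarrow> l"
    then have x: "\<And>k. x k \<in> A n" "x \<longlonglongrightarrow> l" by auto
    show "l \<in> A n"
      unfolding A_def
    proof (intro CollectI allI impI)
      fix y assume y: "dist y l < 1 / real (Suc n)"
      have "(\<lambda>k. dist y (x k)) \<longlonglongrightarrow> dist y l" by (intro tendsto_intros x)
      then have "\<forall>\<^sub>F k in sequentially. dist y (x k) < 1 / real (Suc n)" using y by (rule order_tendstoD)
      then have "\<forall>\<^sub>F k in sequentially. f (x k) \<le> f y" by eventually_elim (use x(1) in \<open>auto simp: A_def\<close>)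
      moreover have "(\<lambda>k. f (x k)) \<longlonglongrightarrow> f l" using continuous_on_tendsto_compose[OF f x(2)] by simp
      ultimately show "f l \<le> f y" by (intro tendsto_upperbound[of "\<lambda>k. f (x k)" "f l" sequentially]) auto
    qed
  qed
  moreover have "{x. local_minimizer f x} = (\<Union>n. A n)"
  proof (intro set_eqI iffI)
    fix x assume "x \<in> {x. local_minimizer f x}"
    then obtain d where d: "d > 0" "\<And>y. dist y x < d \<Longrightarrow> f x \<le> f y"
      unfolding local_minimizer_def eventually_nhds_metric by auto
    obtain n where "inverse (real (Suc n)) < d" using reals_Archimedean[OF d(1)] by blast
    then have "dist y x < d" if "dist y x < 1 / real (Suc n)" for y
      using that by (simp only: inverse_eq_divide)
    then have "x \<in> A n" using d(2) unfolding A_def by blast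
    then show "x \<in> (\<Union>n. A n)" by blast
  next
    fix x assume "x \<in> (\<Union>n. A n)"
    then obtain n where "x \<in> A n" by blast
    then show "x \<in> {x. local_minimizer f x}"
      unfolding local_minimizer_def eventually_nhds_metric A_def mem_Collect_eq
      by (intro exI[of _ "1 / real (Suc n)"]) simp
  qed
  ultimately show ?thesis by auto
qed

theorem theorem3:
  fixes f :: "real ^ 'd \<Rightarrow> real"
    and g\<^sub>0 :: "(real ^ 'd) \<times> real \<Rightarrow> (real ^ 'd) \<times> real"
    and l L B c \<eta> \<beta> :: real
    and \<mu> :: "(real ^ 'd) measure"
  assumes "C2_fun f"
    and "gradient_Lipschitz l f"
    and "real_analytic f"
    and "\<And>a. compact {x. f x \<le> a}"
    and "\<And>x. saddle_point f x \<Longrightarrow> strict_saddle_point f x"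
    and "\<eta> > 0" and "\<beta> > 0"
    and "well_behaved f \<eta> \<beta> L B c g\<^sub>0"
    and "\<eta> < min (1 / L) (1 / (2 * l))"
    and "\<beta> < (1 - 2 * \<eta> * l) / B"
    and "prob_space \<mu>" and "sets \<mu> = sets borel" and "absolutely_continuous lborel \<mu>"
  shows "\<forall>h\<^sub>0. \<P>(x\<^sub>0 in \<mu>. \<exists>x'. local_minimizer f x' \<and>
           (\<lambda>k. fst ((g\<^sub>0 ^^ k) (x\<^sub>0, h\<^sub>0))) \<longlonglongrightarrow> x') = 1"
proof
  fix h\<^sub>0 :: real
  obtain gr :: "real ^ 'd \<Rightarrow> real ^ 'd" and H where grad: "\<And>x. GDERIV f x :> gr x"
    and H: "\<And>x. (gr has_derivative blinfun_apply (H x)) (at x)" and contH: "continuous_on UNIV H"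
    by (rule C2_gradient[OF assms(1)]) (rule that)
  have gradient: "gradient f = gr" using gradient_eq[OF grad] by blast
  obtain q\<^sub>x q\<^sub>h where g: "g\<^sub>0 = dynamics \<eta> \<beta> q\<^sub>x q\<^sub>h" and q: "C1_fun q\<^sub>x" and qh: "C1_fun q\<^sub>h" "q\<^sub>h 0 = 0"
    and qL: "\<And>h. L-lipschitz_on UNIV (\<lambda>x. q\<^sub>x (x, h))"
    and qhB: "\<And>h. 0 < deriv q\<^sub>h h" "\<And>h. deriv q\<^sub>h h \<le> B"
    and approx: "\<And>x h. norm (q\<^sub>x (x, h) - gr x) \<le> c * \<bar>h\<bar>"
    using assms(8) unfolding well_behaved_def gradient by blast
  \<comment> \<open>The strict bound on \<open>\<eta>\<close> excludes \<open>L = 0\<close> too, as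
    \<open>1 / 0 = 0\<close>; likewise for \<open>l\<close> below.\<close>
  have L: "L > 0"
  proof -
    have "0 < 1 / L" using assms(6,9) by linarith
    then show ?thesis by simp
  qed
  have \<eta>L: "\<eta> * L < 1" using assms(9) L by (simp add: field_simps)
  have l: "l > 0"
  proof -
    have "0 < 1 / (2 * l)" using assms(6,9) by linarith
    then show ?thesis by (simp add: zero_less_divide_iff)
  qed
  have \<eta>l: "2 * (\<eta> * l) < 1" using assms(9) l by (simp add: field_simps)
  have B: "B > 0" using qhB[of 0] by simp
  \<comment> \<open>Since \<open>q\<^sub>h 0 = 0\<close> and its derivative is between 0 and
    \<open>B\<close>, \<open>\<kappa>\<close> is a Lipschitz bound for one step of \<open>h\<close>
    towards 0; the bound on \<open>\<beta>\<close> puts it below 1.\<close>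
  define \<kappa> where "\<kappa> = \<beta> * B"
  have "\<kappa> < 1 - 2 * \<eta> * l" using assms(10) B by (simp add: \<kappa>_def field_simps)
  moreover have "0 < \<eta> * l" using assms(6) l by (rule mult_pos_pos)
  ultimately have \<kappa>: "0 \<le> \<kappa>" "\<kappa> < 1" using B assms(7) by (auto simp: \<kappa>_def)
  have Lip: "norm (gr x - gr y) \<le> l * norm (x - y)" for x y
    using assms(2) by (simp add: gradient_Lipschitz_def gradient)
  interpret gradient_system f gr l c \<eta> \<kappa> "\<lambda>x h. q\<^sub>x (x, h)"
    by unfold_locales (use grad Lip assms(3,4,6) \<eta>l l \<kappa> approx in auto)
  have sym: "H x u \<bullet> v = H x v \<bullet> u" for x u v by (rule hessian_symmetric[OF grad H contH])
  have Hbound: "norm (H x z) \<le> l * norm z" for x z by (rule derivative_Lipschitz_bound[OF H Lip])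
  obtain q' where q': "\<And>z. (q\<^sub>x has_derivative blinfun_apply (q' z)) (at z)" and contq': "continuous_on UNIV q'"
    using q unfolding C1_fun_def by blast
  have qx0: "q\<^sub>x (x, 0) = gr x" for x using approx[of x 0] by simp
  have qh_bound: "\<bar>\<beta> * q\<^sub>h h\<bar> \<le> \<kappa> * \<bar>h\<bar>" for h
  proof -
    obtain qh' where qh': "\<And>x. (q\<^sub>h has_derivative blinfun_apply (qh' x)) (at x)"
      using qh(1) unfolding C1_fun_def by blast
    have "(q\<^sub>h has_field_derivative deriv q\<^sub>h x) (at x)" for x
    proof -
      have "blinfun_apply (qh' x) t = qh' x 1 * t" for t
        using blinfun.scaleR_right[of "qh' x" t 1] by simp
      then have "blinfun_apply (qh' x) = (*) (qh' x 1)" by blast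
      then have "(q\<^sub>h has_field_derivative qh' x 1) (at x)"
        using qh'[of x] unfolding has_field_derivative_def by (simp only:)
      then show ?thesis using DERIV_imp_deriv by metis
    qed
    then have "norm (q\<^sub>h h - q\<^sub>h 0) \<le> B * norm (h - 0)"
      using qhB by (intro field_differentiable_bound[of UNIV q\<^sub>h "deriv q\<^sub>h"]) (auto simp: less_imp_le abs_of_pos)
    then have "\<beta> * \<bar>q\<^sub>h h\<bar> \<le> \<beta> * (B * \<bar>h\<bar>)" using assms(7) qh(2) by (intro mult_left_mono) auto
    then show ?thesis using assms(7) by (simp add: abs_mult \<kappa>_def mult.assoc)
  qed
  define h where "h k = ((\<lambda>h. \<beta> * q\<^sub>h h) ^^ k) h\<^sub>0" for k
  define \<psi> where "\<psi> s x = x - \<eta> *\<^sub>R q\<^sub>x (x, s)" for s x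
  let ?X = "\<lambda>k x. orbit (\<lambda>n. \<psi> (h n)) k x"
  have iter: "(g\<^sub>0 ^^ k) (x, h\<^sub>0) = (?X k x, h k)" for k x
    by (induction k) (simp_all add: g dynamics_def h_def \<psi>_def)
  have h_dec: "\<bar>h (Suc n)\<bar> \<le> \<kappa> * \<bar>h n\<bar>" for n using qh_bound by (simp add: h_def)
  have conv: "\<exists>p. gr p = 0 \<and> (\<lambda>k. ?X k x) \<longlonglongrightarrow> p" for x
    by (rule converges[of _ h]) (simp_all add: \<psi>_def h_dec)
  have expand: "(1 - \<eta> * L) * norm (x - y) \<le> norm (\<psi> s x - \<psi> s y)" for s x y
  proof -
    have "norm (\<eta> *\<^sub>R (q\<^sub>x (x, s) - q\<^sub>x (y, s))) \<le> \<eta> * (L * norm (x - y))"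
      using lipschitz_onD[OF qL[of s], of x y] assms(6) by (simp add: dist_norm)
    moreover have "x - y = (\<psi> s x - \<psi> s y) + \<eta> *\<^sub>R (q\<^sub>x (x, s) - q\<^sub>x (y, s))"
      by (simp add: \<psi>_def algebra_simps)
    then have "norm (x - y) \<le> norm (\<psi> s x - \<psi> s y) + norm (\<eta> *\<^sub>R (q\<^sub>x (x, s) - q\<^sub>x (y, s)))"
      by (metis norm_triangle_ineq)
    ultimately show ?thesis by (simp add: algebra_simps)
  qed
  have "negligible {x. \<exists>p\<in>{p. saddle_point f p}. (\<lambda>k. ?X k x) \<longlonglongrightarrow> p}"
  proof (rule saddle_basin_negligible[OF _ expand])
    show "1 - \<eta> * L > 0" using \<eta>L by simp
    show "h \<longlonglongrightarrow> 0" using \<kappa> h_dec by (rule geometric_decay_null)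
    fix p assume "p \<in> {p. saddle_point f p}"
    then have "strict_saddle_point f p" using assms(5) by simp
    from strict_saddle_eigenvector[OF grad H sym this]
    obtain v t where v: "v \<noteq> 0" "H p v = t *\<^sub>R v" "t < 0" by blast
    show "\<exists>r>0. \<forall>h :: nat \<Rightarrow> real. (\<forall>n. \<bar>h n\<bar> \<le> r) \<longrightarrow>
        negligible {x. \<forall>n. orbit (\<lambda>n. \<psi> (h n)) n x \<in> cball p r}"
    proof (rule saddle_staying_negligible[OF q' contq' qx0 H sym Hbound assms(6) \<eta>l l v])
      fix r :: real assume "r > 0" "\<And>h :: nat \<Rightarrow> real. (\<And>n. \<bar>h n\<bar> \<le> r) \<Longrightarrow>
          negligible {x. \<forall>n. orbit (\<lambda>n x. x - \<eta> *\<^sub>R q\<^sub>x (x, h n)) n x \<in> cball p r}"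
      then show ?thesis unfolding \<psi>_def by blast
    qed
  qed
  note saddles = this
  \<comment> \<open>Every trajectory converges, so the limit is an everywhere defined pointwise
    limit of continuous maps and hence Borel measurable.\<close>
  define Xlim where "Xlim x = lim (\<lambda>k. ?X k x)" for x
  have Xlim: "(\<lambda>k. ?X k x) \<longlonglongrightarrow> Xlim x" "gr (Xlim x) = 0" for x
    using conv[of x] limI unfolding Xlim_def by blast+
  have limit_iff: "(\<exists>x'. local_minimizer f x' \<and> (\<lambda>k. fst ((g\<^sub>0 ^^ k) (x, h\<^sub>0))) \<longlonglongrightarrow> x') \<longleftrightarrow>
      local_minimizer f (Xlim x)" for x
    unfolding iter fst_conv using Xlim(1)[of x] LIMSEQ_unique by blast
  let ?N = "{x. \<not> local_minimizer f (Xlim x)}"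
  have contX: "continuous_on UNIV (?X k)" for k
  proof (rule orbit_continuous)
    have "continuous_on UNIV q\<^sub>x"
      by (intro continuous_at_imp_continuous_on ballI has_derivative_continuous[OF q'])
    then show "continuous_on UNIV (\<psi> (h n))" for n
      unfolding \<psi>_def
      by (intro continuous_on_diff continuous_on_scaleR continuous_on_id continuous_on_const
          continuous_on_compose2[of UNIV q\<^sub>x UNIV "\<lambda>x. (x, h n)"] continuous_on_Pair subset_UNIV)
  qed
  have "Xlim \<in> borel_measurable borel"
    by (rule borel_measurable_LIMSEQ_metric[of ?X]) (use contX Xlim(1) in \<open>auto intro: borel_measurable_continuous_onI\<close>)
  from measurable_sets[OF this local_minimizers_borel[OF f_cont]]
  have "- (Xlim -` {x. local_minimizer f x}) \<in> sets borel" by (simp add: borel_comp)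
  then have N_borel: "?N \<in> sets borel" by (simp add: vimage_def Collect_neg_eq)
  \<comment> \<open>The limit is always critical; if it is not a local minimizer, it is a saddle
    point by definition.\<close>
  have "?N \<subseteq> {x. \<exists>p\<in>{p. saddle_point f p}. (\<lambda>k. ?X k x) \<longlonglongrightarrow> p}"
    using Xlim by (auto simp: saddle_point_def gradient)
  with saddles have "negligible ?N" by (rule negligible_subset)
  \<comment> \<open>\<open>negligible\<close> refers to the completed Lebesgue measure, absolute
    continuity to \<open>lborel\<close>; the Borel measurability of the exceptional set bridges the
    two.\<close>
  then have "?N \<in> null_sets (completion lborel)" by (simp only: negligible_iff_null_sets)
  then have "?N \<in> null_sets lborel" using N_borel by (subst (asm) null_sets_completion_iff) auto
  then have N_null: "?N \<in> null_sets \<mu>" using assms(13) unfolding absolutely_continuous_def by blast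
  interpret prob_space \<mu> by (rule assms(11))
  have space: "space \<mu> = UNIV" using sets_eq_imp_space_eq[OF assms(12)] by simp
  have "prob {x \<in> space \<mu>. local_minimizer f (Xlim x)} = prob (space \<mu> - ?N)"
    by (rule arg_cong[of _ _ prob]) auto
  also have "\<dots> = 1 - prob ?N" by (rule prob_compl) (use N_null in auto)
  also have "prob ?N = 0" using N_null by (rule measure_eq_0_null_sets)
  finally show "\<P>(x\<^sub>0 in \<mu>. \<exists>x'. local_minimizer f x' \<and>
      (\<lambda>k. fst ((g\<^sub>0 ^^ k) (x\<^sub>0, h\<^sub>0))) \<longlonglongrightarrow> x') = 1"
    unfolding limit_iff by simp
qed

end
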